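(* Fix an integer $d\ge 2$ and $\alpha>0$. There is a randomized algorithm which, given any $n$-element set $A\subset\mathbb{R}^d$ in general position with $\Delta(A)\le\alpha n^{1/d}$, runs in $\mathcal{O}(n\log n)$ expected time and outputs a subset of $A$ in convex position whose size is at least $c\, n^{-\frac{d-1}{d(d+1)}}\cdot\mathrm{OPT}(A)$, where $c>0$ depends only on $d$ and $\alpha$, and $\mathrm{OPT}(A)$ is the maximum size of a subset of $A$ in convex position.
   Context: A finite set of points in $\mathbb{R}^d$ is in general position if any $d+1$ or fewer of its points are affinely independent, and in convex position if no point lies in the convex hull of the others. The spread $\Delta(A)$ of a finite set $A$ is the ratio of the maximum pairwise Euclidean distance to the minimum pairwise Euclidean distance among points of $A$. *)

theory Defs
  imports "HOL-Probability.Probability" "HOL-Library.Landau_Symbols"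
begin

section \<open>Point sets\<close>

definition general_position :: "(real ^ 'n) set \<Rightarrow> bool" where
  "general_position A \<longleftrightarrow>
     (\<forall>B. B \<subseteq> A \<and> finite B \<and> card B \<le> CARD('n) + 1 \<longrightarrow> \<not> affine_dependent B)"

definition convex_position :: "(real ^ 'n) set \<Rightarrow> bool" where
  "convex_position B \<longleftrightarrow> (\<forall>x\<in>B. x \<notin> convex hull (B - {x}))"

text \<open>Meaningful for finite sets with at least two points only.\<close>

definition spread :: "(real ^ 'n) set \<Rightarrow> real" where
  "spread A = Max {dist x y | x y. x \<in> A \<and> y \<in> A \<and> x \<noteq> y}
            / Min {dist x y | x y. x \<in> A \<and> y \<in> A \<and> x \<noteq> y}"

definition OPT :: "(real ^ 'n) set \<Rightarrow> nat" where
  "OPT A = Max {card B | B. B \<subseteq> A \<and> convex_position B}"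


section \<open>A randomized real RAM\<close>

text \<open>
  The machine has two unbounded memories, one holding natural numbers and one holding exact
  reals, both addressed (possibly indirectly) by natural numbers. It offers exact field
  arithmetic and comparisons on reals, and a cast from naturals to reals, but no rounding from
  reals to naturals. Every atomic command and every evaluation of a guard costs one time unit;
  a program is fixed independently of its input, so the expressions in it have constant size.

  Arithmetic on naturals is restricted to addition, truncated subtraction and halving, so that
  unit cost cannot be exploited through the rapid growth of numbers under multiplication.
  Real literals are not provided either, so that no information can be hidden in the digits of
  a constant; rational constants are obtained from the cast and division. Division by zero
  yields zero.
\<close>

record state =
  nmem :: "nat \<Rightarrow> nat"
  rmem :: "nat \<Rightarrow> real"

datatype nexp =
    NConst nat
  | NRead nexp
  | NAdd nexp nexp
  | NSub nexp nexp
  | NHalf nexp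

datatype rexp =
    RCast nexp
  | RRead nexp
  | RAdd rexp rexp
  | RSub rexp rexp
  | RMul rexp rexp
  | RDiv rexp rexp

datatype bexp =
    NLess nexp nexp
  | RLess rexp rexp
  | BNot bexp
  | BAnd bexp bexp

datatype com =
    Skip
  | NAssign nexp nexp  \<comment> \<open>address, value\<close>
  | RAssign nexp rexp  \<comment> \<open>address, value\<close>
  | Random nexp nexp   \<comment> \<open>address, maximum; uniform between zero and the maximum\<close>
  | Seq com com
  | Cond bexp com com
  | While bexp com

primrec nval :: "state \<Rightarrow> nexp \<Rightarrow> nat" where
  "nval s (NConst k) = k"
| "nval s (NRead a) = nmem s (nval s a)"
| "nval s (NAdd a b) = nval s a + nval s b"
| "nval s (NSub a b) = nval s a - nval s b"
| "nval s (NHalf a) = nval s a div 2"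

primrec rval :: "state \<Rightarrow> rexp \<Rightarrow> real" where
  "rval s (RCast a) = real (nval s a)"
| "rval s (RRead a) = rmem s (nval s a)"
| "rval s (RAdd a b) = rval s a + rval s b"
| "rval s (RSub a b) = rval s a - rval s b"
| "rval s (RMul a b) = rval s a * rval s b"
| "rval s (RDiv a b) = rval s a / rval s b"

primrec bval :: "state \<Rightarrow> bexp \<Rightarrow> bool" where
  "bval s (NLess a b) \<longleftrightarrow> nval s a < nval s b"
| "bval s (RLess a b) \<longleftrightarrow> rval s a < rval s b"
| "bval s (BNot b) \<longleftrightarrow> \<not> bval s b"
| "bval s (BAnd a b) \<longleftrightarrow> bval s a \<and> bval s b"

definition nwrite :: "nat \<Rightarrow> nat \<Rightarrow> state \<Rightarrow> state" where
  "nwrite a v s = s\<lparr>nmem := (nmem s)(a := v)\<rparr>"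

definition rwrite :: "nat \<Rightarrow> real \<Rightarrow> state \<Rightarrow> state" where
  "rwrite a v s = s\<lparr>rmem := (rmem s)(a := v)\<rparr>"

abbreviation after :: "nat \<Rightarrow> (state \<times> nat) spmf \<Rightarrow> (state \<times> nat) spmf" where
  "after k \<equiv> map_spmf (\<lambda>(s, t). (s, k + t))"

text \<open>
  The joint distribution of the final state and the running time. The missing probability mass
  is the probability of not terminating.
\<close>

partial_function (spmf) exec :: "com \<Rightarrow> state \<Rightarrow> (state \<times> nat) spmf" where
  "exec c s = (case c of
      Skip \<Rightarrow> return_spmf (s, 1)
    | NAssign a e \<Rightarrow> return_spmf (nwrite (nval s a) (nval s e) s, 1)
    | RAssign a e \<Rightarrow> return_spmf (rwrite (nval s a) (rval s e) s, 1)
    | Random a e \<Rightarrow> map_spmf (\<lambda>v. (nwrite (nval s a) v s, 1)) (spmf_of_set {0..nval s e})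
    | Seq c1 c2 \<Rightarrow> bind_spmf (exec c1 s) (\<lambda>(s', t). after t (exec c2 s'))
    | Cond b c1 c2 \<Rightarrow> after 1 (if bval s b then exec c1 s else exec c2 s)
    | While b c1 \<Rightarrow>
        (if bval s b
         then bind_spmf (exec c1 s) (\<lambda>(s', t). after (1 + t) (exec (While b c1) s'))
         else return_spmf (s, 1)))"

lemma exec_simps:
  "exec Skip s = return_spmf (s, 1)"
  "exec (NAssign a e) s = return_spmf (nwrite (nval s a) (nval s e) s, 1)"
  "exec (RAssign a f) s = return_spmf (rwrite (nval s a) (rval s f) s, 1)"
  "exec (Random a e) s =
     map_spmf (\<lambda>v. (nwrite (nval s a) v s, 1)) (spmf_of_set {0..nval s e})"
  "exec (Seq c1 c2) s = bind_spmf (exec c1 s) (\<lambda>(s', t). after t (exec c2 s'))"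
  "exec (Cond b c1 c2) s = after 1 (if bval s b then exec c1 s else exec c2 s)"
  by (subst exec.simps, simp)+

lemma exec_While:
  "exec (While b c) s =
     (if bval s b
      then bind_spmf (exec c s) (\<lambda>(s', t). after (1 + t) (exec (While b c) s'))
      else return_spmf (s, 1))"
  by (subst exec.simps) simp

text \<open>A run that does not terminate takes infinite time.\<close>

definition expected_time :: "com \<Rightarrow> state \<Rightarrow> ennreal" where
  "expected_time c s =
     (\<integral>\<^sup>+ r. (case r of None \<Rightarrow> \<infinity> | Some (s', t) \<Rightarrow> of_nat t) \<partial>measure_pmf (exec c s))"


section \<open>Input and output\<close>

text \<open>
  A point set is presented as a list of its points, in arbitrary order: natural cell \<open>0\<close> holds
  the number of points, and real cell \<open>i * d + j\<close> holds coordinate \<open>j\<close> of point \<open>i\<close>. The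
  coordinates are numbered by a bijection \<open>e\<close> from \<open>{..<d}\<close> to the index type.
\<close>

definition input_state :: "(nat \<Rightarrow> 'n) \<Rightarrow> (real ^ 'n) list \<Rightarrow> state" where
  "input_state e ps =
     \<lparr>nmem = (\<lambda>k. if k = 0 then length ps else 0),
      rmem = (\<lambda>k. if k < length ps * CARD('n)
                  then (ps ! (k div CARD('n))) $ e (k mod CARD('n)) else 0)\<rparr>"

text \<open>
  On termination natural cell \<open>0\<close> holds the length \<open>k\<close> of the output, and the cells \<open>1, \<dots>, k\<close>
  hold indices into the input list.
\<close>

definition output_indices :: "state \<Rightarrow> nat set" where
  "output_indices s = nmem s ` {1..nmem s 0}"

definition outputs :: "(real ^ 'n) list \<Rightarrow> state \<Rightarrow> (real ^ 'n) set \<Rightarrow> bool" where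
  "outputs ps s B \<longleftrightarrow>
     output_indices s \<subseteq> {..<length ps} \<and> B = (\<lambda>i. ps ! i) ` output_indices s"

end

theory Submission
  imports Defs
begin

text \<open>
  If \<open>q\<close> and \<open>p\<close> satisfy \<open>\<bar>q - c\<bar>\<^sup>2 - \<bar>p - c\<bar>\<^sup>2 < \<bar>p - q\<bar>\<^sup>2\<close>, then the hyperplane through \<open>p\<close> orthogonal to
  \<open>p - c\<close> has \<open>q\<close> strictly on the side of \<open>c\<close>. Hence points in a spherical shell around \<open>c\<close> on
  which the squared distance varies by less than \<open>b\<^sup>2\<close> are in convex position as soon as they are
  pairwise at distance more than \<open>b\<close>. Take \<open>b\<close> proportional to \<open>diam(A) / n\<^bsup>1/(d+1)\<^esup>\<close>, so that there are
  about \<open>n\<^bsup>2/(d+1)\<^esup>\<close> shells, subdivide space into cubes of side \<open>b\<close>, and choose one point in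
  each nonempty intersection of a shell and a cube. Points of one shell in distinct cubes whose
  coordinates have the same parities are far enough apart, so the largest such group is in convex
  position.

  The centre \<open>c\<close> is a random point of \<open>A\<close>. A pair of points at distance \<open>D\<close> lies in a common shell only
  if \<open>c\<close> lies in a slab of width about \<open>b\<^sup>2 / D\<close> around its bisector; as \<open>A\<close> is spread out, packing
  bounds show that on average only \<open>O(n)\<close> pairs share both shell and cube. By Cauchy-Schwarz a
  positive fraction of \<open>n\<close> points is then chosen in total, and \<open>n\<^bsup>(d-1)/(d+1)\<^esup>\<close>, up to a constant,
  in the best group. With probability at least one half a trial succeeds, and it is repeated
  until it does.

  For the optimum, a set in convex position can be pushed along outer normals onto the faces of a
  surrounding cube without decreasing distances, so its size is at most of order \<open>n\<^bsup>(d-1)/d\<^esup>\<close>.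

  A trial takes \<open>O(n log n)\<close> steps: the number of a shell or cube is found bit by bit, and since the
  memory is unbounded these numbers are used directly as addresses, without sorting.
\<close>

section \<open>An expected-time calculus\<close>

text \<open>The continuation cost \<open>f\<close> and the running time are added in one integral,
  and nontermination is infinitely expensive. A finite bound thus yields almost sure termination and
  a time bound together, and an \<open>f\<close> that is infinite on wrong states yields
  correctness.\<close>

definition wp :: "com \<Rightarrow> (state \<Rightarrow> ennreal) \<Rightarrow> state \<Rightarrow> ennreal" where
  "wp c f s =
     (\<integral>\<^sup>+ r. (case r of None \<Rightarrow> \<infinity> | Some (s', t) \<Rightarrow> f s' + of_nat t) \<partial>measure_pmf (exec c s))"

lemma nn_integral_after:
  fixes g :: "state \<times> nat \<Rightarrow> ennreal"
  shows "(\<integral>\<^sup>+ r. (case r of None \<Rightarrow> \<infinity> | Some st \<Rightarrow> g st) \<partial>measure_pmf (after k p)) =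
     (\<integral>\<^sup>+ r. (case r of None \<Rightarrow> \<infinity> | Some (s, t) \<Rightarrow> g (s, k + t)) \<partial>measure_pmf p)"
  by (auto intro!: nn_integral_cong split: option.split)

lemma wp_after: "(\<integral>\<^sup>+ r. (case r of None \<Rightarrow> \<infinity> | Some (s', t) \<Rightarrow> f s' + of_nat t) \<partial>measure_pmf (after k (exec c s)))
   = of_nat k + wp c f s"
proof -
  have "(\<integral>\<^sup>+ r. (case r of None \<Rightarrow> \<infinity> | Some (s', t) \<Rightarrow> f s' + of_nat t) \<partial>measure_pmf (after k (exec c s)))
    = (\<integral>\<^sup>+ r. of_nat k + (case r of None \<Rightarrow> \<infinity> | Some (s', t) \<Rightarrow> f s' + of_nat t) \<partial>measure_pmf (exec c s))"
    by (subst nn_integral_after) (auto intro!: nn_integral_cong split: option.split simp: add_ac)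
  also have "\<dots> = of_nat k + wp c f s"
    unfolding wp_def by (subst nn_integral_add) auto
  finally show ?thesis .
qed

lemma wp_Skip: "wp Skip f s = f s + 1"
  and wp_NAssign: "wp (NAssign a e) f s = f (nwrite (nval s a) (nval s e) s) + 1"
  and wp_RAssign: "wp (RAssign a r) f s = f (rwrite (nval s a) (rval s r) s) + 1"
  by (simp_all add: wp_def exec_simps)

lemma wp_Seq: "wp (Seq c1 c2) f s = wp c1 (wp c2 f) s"
proof -
  have "wp (Seq c1 c2) f s = (\<integral>\<^sup>+ r. (case r of None \<Rightarrow> \<infinity> | Some (s', t) \<Rightarrow>
     (\<integral>\<^sup>+ r. (case r of None \<Rightarrow> \<infinity> | Some (s', t) \<Rightarrow> f s' + of_nat t) \<partial>measure_pmf (after t (exec c2 s')))) \<partial>measure_pmf (exec c1 s))"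
    unfolding wp_def exec_simps bind_spmf_def nn_integral_bind_pmf
    by (rule nn_integral_cong) (auto split: option.split)
  also have "\<dots> = wp c1 (wp c2 f) s"
    unfolding wp_after unfolding wp_def[of c1] by (rule nn_integral_cong) (auto split: option.split simp: add_ac)
  finally show ?thesis .
qed

lemma wp_Cond: "wp (Cond b c1 c2) f s = 1 + (if bval s b then wp c1 f s else wp c2 f s)"
  using wp_after[where f=f and k=1] by (simp add: wp_def[of "Cond _ _ _"] exec_simps)

lemma wp_Random:
  "wp (Random a e) f s = (\<Sum>v\<in>{..nval s e}. f (nwrite (nval s a) v s)) / of_nat (nval s e + 1) + 1"
proof -
  have *: "spmf_of_set {0..N} = map_pmf Some (pmf_of_set {..N})" for N :: nat
    by (simp add: spmf_of_set_def spmf_of_pmf_def atMost_atLeast0)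
  have "wp (Random a e) f s = (\<integral>\<^sup>+ v. f (nwrite (nval s a) v s) + 1 \<partial>measure_pmf (pmf_of_set {..nval s e}))"
    by (simp add: wp_def exec_simps *)
  also have "\<dots> = (\<Sum>v\<le>nval s e. f (nwrite (nval s a) v s)) / of_nat (nval s e + 1) + 1"
    by (subst nn_integral_add) (auto simp: nn_integral_pmf_of_set)
  finally show ?thesis .
qed

lemma wp_le_add:
  assumes "\<And>s. f s \<le> g s + B"
  shows "wp c f s \<le> wp c g s + B"
proof -
  have "wp c f s \<le> (\<integral>\<^sup>+ r. (case r of None \<Rightarrow> \<infinity> | Some (s', t) \<Rightarrow> g s' + of_nat t) + B \<partial>measure_pmf (exec c s))"
    unfolding wp_def
  proof (rule nn_integral_mono, goal_cases)
    case (1 r)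
    show ?case using assms
      by (auto split: option.split simp: add_right_mono add.assoc add.commute[of _ B])
  qed
  also have "\<dots> = wp c g s + B" unfolding wp_def by (subst nn_integral_add) auto
  finally show ?thesis .
qed

text \<open>
  A Hoare triple for total correctness with expected time at most \<open>T\<close>. Bounding every continuation
  cost \<open>f\<close>, rather than an indicator of \<open>Q\<close>, makes triples compose without monotonicity arguments.
\<close>

definition spec :: "(state \<Rightarrow> bool) \<Rightarrow> com \<Rightarrow> (state \<Rightarrow> bool) \<Rightarrow> nat \<Rightarrow> bool" where
  "spec P c Q T \<longleftrightarrow>
     (\<forall>s f B. P s \<longrightarrow> (\<forall>s'. Q s' \<longrightarrow> f s' \<le> B) \<longrightarrow> wp c f s \<le> B + of_nat T)"

lemma specD: "spec P c Q T \<Longrightarrow> P s \<Longrightarrow> (\<And>s'. Q s' \<Longrightarrow> f s' \<le> B) \<Longrightarrow> wp c f s \<le> B + of_nat T"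
  by (auto simp: spec_def)

lemma spec_conseq:
  assumes "spec P c Q T" "\<And>s. P' s \<Longrightarrow> P s" "\<And>s. Q s \<Longrightarrow> Q' s" "T \<le> T'"
  shows "spec P' c Q' T'"
proof -
  have "of_nat T \<le> (of_nat T' :: ennreal)" using assms(4) by simp
  then show ?thesis
    unfolding spec_def by (meson add_left_mono assms(1-3) order_trans specD)
qed

lemma spec_Skip: "(\<And>s. P s \<Longrightarrow> Q s) \<Longrightarrow> spec P Skip Q 1"
  by (simp add: spec_def wp_Skip add_right_mono)

lemma spec_NAssign: "(\<And>s. P s \<Longrightarrow> Q (nwrite (nval s a) (nval s e) s)) \<Longrightarrow> spec P (NAssign a e) Q 1"
  by (simp add: spec_def wp_NAssign add_right_mono)

lemma spec_RAssign: "(\<And>s. P s \<Longrightarrow> Q (rwrite (nval s a) (rval s e) s)) \<Longrightarrow> spec P (RAssign a e) Q 1"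
  by (simp add: spec_def wp_RAssign add_right_mono)

lemma spec_Seq:
  assumes "spec P c1 R T1" "spec R c2 Q T2"
  shows "spec P (Seq c1 c2) Q (T1 + T2)"
proof -
  { fix s f and B :: ennreal assume "P s" "\<forall>s'. Q s' \<longrightarrow> f s' \<le> B"
    then have "wp c1 (wp c2 f) s \<le> (B + of_nat T2) + of_nat T1"
      by (intro specD[OF assms(1)] specD[OF assms(2)]) auto }
  then show ?thesis unfolding spec_def wp_Seq by (simp add: add_ac)
qed

lemma spec_Cond:
  assumes "spec (\<lambda>s. P s \<and> bval s b) c1 Q T" "spec (\<lambda>s. P s \<and> \<not> bval s b) c2 Q T"
  shows "spec P (Cond b c1 c2) Q (Suc T)"
proof -
  { fix s f and B :: ennreal assume "P s" "\<forall>s'. Q s' \<longrightarrow> f s' \<le> B"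
    then have "(if bval s b then wp c1 f s else wp c2 f s) \<le> B + of_nat T"
      by (auto intro: specD[OF assms(1)] specD[OF assms(2)])
    then have "1 + (if bval s b then wp c1 f s else wp c2 f s) \<le> 1 + (B + of_nat T)"
      by (rule add_left_mono) }
  then show ?thesis unfolding spec_def wp_Cond by (simp add: add_ac)
qed

section \<open>Loops: a fixed number of rounds, and repetition until success\<close>

lemma wp_While:
  "wp (While b c) f s = (if bval s b then 1 + wp c (wp (While b c) f) s else f s + 1)"
proof (cases "bval s b")
  case True
  have "wp (While b c) f s = (\<integral>\<^sup>+ r. (case r of None \<Rightarrow> \<infinity> | Some (s', t) \<Rightarrow>
     (\<integral>\<^sup>+ r. (case r of None \<Rightarrow> \<infinity> | Some (s', t) \<Rightarrow> f s' + of_nat t) \<partial>measure_pmf (after (1 + t) (exec (While b c) s')))) \<partial>measure_pmf (exec c s))"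
    using True unfolding wp_def exec_While[of b c s] bind_spmf_def
    by (simp only: if_True nn_integral_bind_pmf)
      (rule nn_integral_cong, auto split: option.split)
  also have "\<dots> = (\<integral>\<^sup>+ r. 1 + (case r of None \<Rightarrow> \<infinity> | Some (s', t) \<Rightarrow> wp (While b c) f s' + of_nat t) \<partial>measure_pmf (exec c s))"
    unfolding wp_after by (rule nn_integral_cong) (auto split: option.split simp: add_ac)
  also have "\<dots> = 1 + wp c (wp (While b c) f) s"
    unfolding wp_def[of c] by (subst nn_integral_add) auto
  finally show ?thesis using True by simp
next
  case False
  then show ?thesis by (simp add: wp_def exec_While)
qed

text \<open>The counter \<open>i\<close> exists only in the invariant; the program sees it through
  the guard. Each round pays one for its guard test, and the failing test at the end pays the final
  one.\<close>

lemma spec_For: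
  assumes step: "\<And>i. i < N \<Longrightarrow> spec (J i) c (J (Suc i)) T"
    and guard: "\<And>i s. i \<le> N \<Longrightarrow> J i s \<Longrightarrow> bval s b \<longleftrightarrow> i < N"
  shows "spec (J 0) (While b c) (J N) (N * (T + 1) + 1)"
proof -
  have "spec (J i) (While b c) (J N) ((N - i) * (T + 1) + 1)" if "i \<le> N" for i
    using that
  proof (induction i rule: inc_induct)
    case base
    then show ?case using guard[of N] by (auto simp: spec_def wp_While add_right_mono)
  next
    case (step i)
    show ?case unfolding spec_def
    proof (intro allI impI)
      fix s f B assume s: "J i s" and Q: "\<forall>s'. J N s' \<longrightarrow> f s' \<le> (B::ennreal)"
      have "wp c (wp (While b c) f) s \<le> (B + of_nat ((N - Suc i) * (T + 1) + 1)) + of_nat T"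
        using Q by (intro specD[OF assms(1)[OF \<open>i < N\<close>] s] specD[OF step.IH]) auto
      then have "1 + wp c (wp (While b c) f) s \<le> 1 + ((B + of_nat ((N - Suc i) * (T + 1) + 1)) + of_nat T)"
        by (rule add_left_mono)
      also have "\<dots> = B + of_nat (1 + ((N - Suc i) * (T + 1) + 1) + T)"
        by (simp add: add_ac)
      also have "1 + ((N - Suc i) * (T + 1) + 1) + T = (N - i) * (T + 1) + 1"
        using step.hyps by (simp flip: Suc_diff_Suc)
      finally show "wp (While b c) f s \<le> B + of_nat ((N - i) * (T + 1) + 1)"
        using guard[OF _ s] step.hyps by (simp add: wp_While[of b c f s])
    qed
  qed
  from this[of 0] show ?thesis by simp
qed

text \<open>
  The expected cost \<open>S\<close> of the loop satisfies \<open>S \<le> T + 3 + S / 2\<close>, which bounds \<open>S\<close> only if it is finite.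
  The argument is therefore applied to costs truncated at \<open>N\<close>, where nontermination costs \<open>N\<close> too.
\<close>

lemma spec_geometric_loop:
  assumes good: "\<And>s. I s \<Longrightarrow> bval s b \<Longrightarrow>
      \<exists>G \<subseteq> {..nval s e}. nval s e + 1 \<le> 2 * card G \<and>
        (\<forall>v\<in>G. spec (\<lambda>s'. s' = nwrite (nval s a) v s) c (\<lambda>s'. I s' \<and> \<not> bval s' b) T)"
    and body: "\<And>s v. I s \<Longrightarrow> bval s b \<Longrightarrow> v \<le> nval s e \<Longrightarrow>
       spec (\<lambda>s'. s' = nwrite (nval s a) v s) c I T"
  shows "spec I (While b (Seq (Random a e) c)) (\<lambda>s. I s \<and> \<not> bval s b) (2 * T + 6)"
proof -
  let ?W = "While b (Seq (Random a e) c)"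
  let ?body = "Seq (Random a e) c"
  \<comment> \<open>This is the extreme cost: any admissible continuation cost with bound
    \<open>B\<close> is at most \<open>f + B\<close>, so by \<open>wp_le_add\<close> it suffices to
    bound this one.\<close>
  { define f where "f = (\<lambda>s. if I s \<and> \<not> bval s b then 0 else (\<infinity>::ennreal))"
    have f: "f s = 0" if "I s" "\<not> bval s b" for s using that by (simp add: f_def)
    define X where "X = (\<lambda>r. case r of None \<Rightarrow> (\<infinity>::ennreal) | Some (s', t) \<Rightarrow> f s' + of_nat (t::nat))"
    define F where "F = (\<lambda>N s. \<integral>\<^sup>+ r. min (of_nat N) (X r) \<partial>measure_pmf (exec ?W s))"
    have F_le: "F N s \<le> of_nat N" for N s
      unfolding F_def by (rule order_trans[OF nn_integral_mono[where v="\<lambda>_. of_nat N"]]) auto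
    have F_step: "F N s \<le> 1 + wp ?body (F N) s" if "bval s b" for N s
    proof -
      have "F N s = (\<integral>\<^sup>+ r. (\<integral>\<^sup>+ r. min (of_nat N) (X r) \<partial>measure_pmf (case r of None \<Rightarrow> return_pmf None | Some (s', t) \<Rightarrow> after (1 + t) (exec ?W s'))) \<partial>measure_pmf (exec ?body s))"
        unfolding F_def exec_While[of b ?body s] bind_spmf_def
        using that by (simp only: if_True nn_integral_bind_pmf)
      also have "\<dots> \<le> (\<integral>\<^sup>+ r. 1 + (case r of None \<Rightarrow> \<infinity> | Some (s', t) \<Rightarrow> F N s' + of_nat t) \<partial>measure_pmf (exec ?body s))"
      proof (rule nn_integral_mono, goal_cases)
        case (1 r)
        show ?case
        proof (cases r)
          case (Some st)
          obtain s' t where st: "st = (s', t)" by force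
          have "(\<integral>\<^sup>+ r. min (of_nat N) (X r) \<partial>measure_pmf (after (1 + t) (exec ?W s'))) =
             (\<integral>\<^sup>+ r. min (of_nat N) (X (map_option (\<lambda>(s, u). (s, 1 + t + u)) r)) \<partial>measure_pmf (exec ?W s'))"
            by simp
          also have "\<dots> \<le> (\<integral>\<^sup>+ r. of_nat (1 + t) + min (of_nat N) (X r) \<partial>measure_pmf (exec ?W s'))"
          proof (rule nn_integral_mono, goal_cases)
            case (1 r)
            have "min A (C + D) \<le> C + min A D" for A C D :: ennreal
              by (metis add_increasing add_left_mono le_cases min.cobounded1 min.cobounded2 min_def zero_le)
            moreover have "X (map_option (\<lambda>(s, u). (s, 1 + t + u)) r) = of_nat (1 + t) + X r"
              by (auto simp: X_def add_ac split: option.split)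
            ultimately show ?case by metis
          qed
          also have "\<dots> = of_nat (1 + t) + F N s'"
            unfolding F_def by (subst nn_integral_add) auto
          finally show ?thesis by (simp add: Some st add_ac)
        qed auto
      qed
      also have "\<dots> = 1 + wp ?body (F N) s"
        unfolding wp_def[of ?body] by (subst nn_integral_add) auto
      finally show ?thesis .
    qed
    define S where "S N = (SUP s\<in>Collect I. F N s)" for N
    have S_le: "S N \<le> of_nat N" for N unfolding S_def by (intro SUP_least F_le)
    have FS: "F N s \<le> S N" if "I s" for N s unfolding S_def using that by (intro SUP_upper) auto
    have Fexit: "F N s \<le> 1" if "I s" "\<not> bval s b" for N s
    proof -
      have "F N s \<le> X (Some (s, 1))" unfolding F_def using that by (simp add: exec_While)
      also have "\<dots> = 1" using f[OF that] by (simp add: X_def)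
      finally show ?thesis .
    qed
    \<comment> \<open>The guard test, the draw and the exit test after a success cost one each,
      which with \<open>T\<close> makes \<open>T + 3\<close>. Draws outside \<open>G\<close>, at
      most half of all, lead back to the invariant and cost at most \<open>S N\<close> more.\<close>
    have "F N s \<le> 1 + of_nat T + 2 + S N / 2" if "I s" for N s
    proof (cases "bval s b")
      case False
      have "F N s \<le> 1" using Fexit that False by simp
      also have "\<dots> \<le> 1 + (of_nat T + 2 + S N / 2)" by simp
      finally show ?thesis by (simp add: add_ac)
    next
      case True
      let ?M = "nval s e + 1"
      obtain G where G: "G \<subseteq> {..nval s e}" "?M \<le> 2 * card G"
        and sG: "\<And>v. v \<in> G \<Longrightarrow> spec (\<lambda>s'. s' = nwrite (nval s a) v s) c (\<lambda>s'. I s' \<and> \<not> bval s' b) T"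
        using good[OF \<open>I s\<close> True] by blast
      have w: "wp c (F N) (nwrite (nval s a) v s) \<le> (1 + of_nat T) + (if v \<in> G then 0 else S N)"
        if v: "v \<in> {..nval s e}" for v
      proof (cases "v \<in> G")
        case True
        then show ?thesis using specD[OF sG[OF True], of _ "F N" 1] Fexit by auto
      next
        case False
        have "wp c (F N) (nwrite (nval s a) v s) \<le> S N + of_nat T"
          using FS by (intro specD[OF body[OF \<open>I s\<close> \<open>bval s b\<close>]]) (use v in auto)
        also have "\<dots> \<le> S N + of_nat T + (1)" by simp
        finally show ?thesis using False by (simp add: add_ac)
      qed
      have cardG: "of_nat (card ({..nval s e} - G)) \<le> (of_nat ?M / 2 :: ennreal)"
      proof -
        have "2 * card ({..nval s e} - G) \<le> ?M"
          using G by (simp add: card_Diff_subset finite_subset[OF G(1)])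
        then have "real (2 * card ({..nval s e} - G)) \<le> real ?M" by (simp only: of_nat_le_iff)
        then have "real (card ({..nval s e} - G)) \<le> real ?M / 2" by simp
        then have "ennreal (real (card ({..nval s e} - G))) \<le> ennreal (real ?M / 2)" by (rule ennreal_leI)
        also have "ennreal (real ?M / 2) = of_nat ?M / 2"
          using divide_ennreal[of "real ?M" 2, symmetric]
          by (simp add: ennreal_of_nat_eq_real_of_nat del: of_nat_add)
        finally show ?thesis by (simp add: ennreal_of_nat_eq_real_of_nat)
      qed
      have "(\<Sum>v\<le>nval s e. wp c (F N) (nwrite (nval s a) v s)) \<le>
          (\<Sum>v\<le>nval s e. (1 + of_nat T) + (if v \<in> G then 0 else S N))"
        by (rule sum_mono) (rule w)
      also have "\<dots> = of_nat ?M * (1 + of_nat T) + of_nat (card ({..nval s e} - G)) * S N"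
        by (simp add: sum.distrib sum.If_cases Diff_eq)
      also have "\<dots> \<le> of_nat ?M * (1 + of_nat T) + (of_nat ?M / 2) * S N"
        by (intro add_left_mono mult_right_mono cardG) auto
      also have "\<dots> = of_nat ?M * (1 + of_nat T + S N / 2)"
        by (simp add: distrib_left divide_ennreal_def mult_ac)
      finally have "(\<Sum>v\<le>nval s e. wp c (F N) (nwrite (nval s a) v s)) / of_nat ?M \<le> of_nat ?M * (1 + of_nat T + S N / 2) / of_nat ?M"
        by (rule divide_right_mono_ennreal)
      also have "\<dots> = 1 + of_nat T + S N / 2"
        by (metis ennreal_of_nat_neq_top mult.commute mult_divide_eq_ennreal of_nat_eq_0_iff Zero_not_Suc Suc_eq_plus1)
      finally have "wp ?body (F N) s \<le> 1 + of_nat T + S N / 2 + 1"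
        unfolding wp_Seq wp_Random by (rule add_right_mono)
      then have "1 + wp ?body (F N) s \<le> 1 + (1 + of_nat T + S N / 2 + 1)" by (rule add_left_mono)
      then have "F N s \<le> 1 + (1 + of_nat T + S N / 2 + 1)" using F_step[OF True, of N] by (rule order_trans[rotated])
      moreover have "1 + (1 + of_nat T + A + 1) = 1 + of_nat T + 2 + A" for A :: ennreal
        by (simp add: add_ac flip: one_add_one)
      ultimately show ?thesis by simp
    qed
    then have S1: "S N \<le> 1 + of_nat T + 2 + S N / 2" for N
      unfolding S_def[of N] by (intro SUP_least) (auto simp: S_def)
    have S2: "S N \<le> 2 * (of_nat T + 3)" for N
    proof -
      have "S N < top" using S_le[of N] by (meson le_less_trans of_nat_less_top)
      then obtain x where x: "S N = ennreal x" "x \<ge> 0" by (cases "S N") auto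
      have "ennreal x / 2 = ennreal (x / 2)" using divide_ennreal[of x 2] x by simp
      moreover have "1 + of_nat T + 2 = (3 + of_nat T :: ennreal)"
        by (simp add: add.commute[of _ "of_nat T"] add.assoc)
      ultimately have "S N \<le> 3 + of_nat T + S N / 2" using S1[of N] by metis
      with \<open>ennreal x / 2 = _\<close> have "ennreal x \<le> ennreal (1 + real T + 2 + x / 2)"
        using x by (simp add: ennreal_plus ennreal_of_nat_eq_real_of_nat)
      then have "x \<le> 1 + real T + 2 + x / 2" by (subst (asm) ennreal_le_iff) (use x in auto)
      then have "x \<le> 2 * (real T + 3)" by simp
      then have "ennreal x \<le> ennreal (2 * (real T + 3))" by (rule ennreal_leI)
      also have "\<dots> = 2 * (of_nat T + 3)"
        by (simp add: ennreal_mult ennreal_plus ennreal_of_nat_eq_real_of_nat)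
      finally show ?thesis using x by simp
    qed
    have "wp ?W f s \<le> 2 * (of_nat T + 3)" if "I s" for s
    proof -
      \<comment> \<open>The bound on \<open>F N s\<close> is uniform in \<open>N\<close>, so
        monotone convergence removes the truncation.\<close>
      have "wp ?W f s = (\<integral>\<^sup>+ r. (SUP N. min (of_nat N) (X r)) \<partial>measure_pmf (exec ?W s))"
        unfolding wp_def X_def[symmetric]
      proof (rule nn_integral_cong)
        fix r
        have "(SUP N. inf (X r) (of_nat N)) = inf (X r) (SUP N. of_nat N)" by (rule inf_SUP[symmetric])
        also have "\<dots> = X r" by (simp only: ennreal_SUP_of_nat_eq_top inf_top_right)
        finally show "X r = (SUP N. min (of_nat N) (X r))" by (simp only: inf_min min.commute[of "X r"])
      qed
      also have "\<dots> = (SUP N. F N s)"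
        unfolding F_def
        by (rule nn_integral_monotone_convergence_SUP) (auto intro!: incseq_SucI le_funI min.mono of_nat_mono)
      also have "\<dots> \<le> 2 * (of_nat T + 3)"
        using FS[OF that] S2 by (intro SUP_least) (meson order_trans)
      finally show ?thesis unfolding f_def .
    qed }
  note * = this
  show ?thesis
    unfolding spec_def
  proof (intro allI impI)
    fix s f B assume "I s" and Q: "\<forall>s'. I s' \<and> \<not> bval s' b \<longrightarrow> f s' \<le> (B::ennreal)"
    have "wp ?W f s \<le> wp ?W (\<lambda>s. if I s \<and> \<not> bval s b then 0 else \<infinity>) s + B"
      using Q by (intro wp_le_add) auto
    also have "\<dots> \<le> 2 * (of_nat T + 3) + B"
      by (intro add_right_mono *) fact
    finally show "wp ?W f s \<le> B + of_nat (2 * T + 6)" by (simp add: distrib_left add_ac)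
  qed
qed

section \<open>Packing bounds\<close>

text \<open>Rounding \<open>(f x k - a k) / s\<close> down in every coordinate is injective by the
  separation hypothesis, and coordinate \<open>k\<close> takes at most \<open>L k / s + 1\<close>
  values. The map \<open>f\<close> is left general so that oblique coordinates and displaced points
  are covered.\<close>

lemma card_grid_packing:
  fixes f :: "'a \<Rightarrow> 'n::finite \<Rightarrow> real"
  assumes s: "s > 0" and L: "\<And>k. L k \<ge> 0"
    and range: "\<And>x k. x \<in> S \<Longrightarrow> a k \<le> f x k \<and> f x k \<le> a k + L k"
    and sep: "\<And>x y. x \<in> S \<Longrightarrow> y \<in> S \<Longrightarrow> (\<And>k. \<bar>f x k - f y k\<bar> < s) \<Longrightarrow> x = y"
  shows "real (card S) \<le> (\<Prod>k\<in>UNIV. L k / s + 1)"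
proof -
  define g where "g = (\<lambda>x k. nat \<lfloor>(f x k - a k) / s\<rfloor>)"
  define R where "R = (\<lambda>k. {..nat \<lfloor>L k / s\<rfloor>})"
  have "inj_on g S"
  proof (rule inj_onI)
    fix x y assume xy: "x \<in> S" "y \<in> S" "g x = g y"
    show "x = y"
    proof (rule sep[OF xy(1,2)])
      fix k
      have "nat \<lfloor>(f x k - a k) / s\<rfloor> = nat \<lfloor>(f y k - a k) / s\<rfloor>"
        using fun_cong[OF xy(3)] by (simp add: g_def)
      moreover have "0 \<le> (f x k - a k) / s" "0 \<le> (f y k - a k) / s"
        using range[OF xy(1), of k] range[OF xy(2), of k] s by auto
      ultimately have "\<lfloor>(f x k - a k) / s\<rfloor> = \<lfloor>(f y k - a k) / s\<rfloor>" by (simp add: eq_nat_nat_iff)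
      then have "\<bar>(f x k - a k) / s - (f y k - a k) / s\<bar> < 1" by linarith
      moreover have "(f x k - a k) / s - (f y k - a k) / s = (f x k - f y k) / s"
        by (simp add: diff_divide_distrib)
      ultimately show "\<bar>f x k - f y k\<bar> < s" using s by (simp add: abs_divide)
    qed
  qed
  moreover have "g ` S \<subseteq> PiE UNIV R"
    using range s by (auto simp: g_def R_def intro!: nat_mono floor_mono divide_right_mono)
       (smt (verit) range)
  moreover have "finite (PiE UNIV R)" by (rule finite_PiE) (auto simp: R_def)
  ultimately have "card S \<le> card (PiE UNIV R)" by (metis card_image card_mono)
  also have "\<dots> = (\<Prod>k\<in>UNIV. nat \<lfloor>L k / s\<rfloor> + 1)" by (simp add: card_PiE R_def)
  finally have "real (card S) \<le> (\<Prod>k\<in>UNIV. real (nat \<lfloor>L k / s\<rfloor> + 1))"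
    by (metis of_nat_le_iff of_nat_prod)
  also have "\<dots> \<le> (\<Prod>k\<in>UNIV. L k / s + 1)"
    using L s by (intro prod_mono) (auto simp: of_nat_nat)
  finally show ?thesis .
qed

lemma prod_one_exception:
  "(\<Prod>k\<in>UNIV. if k = l then x else y) = x * y ^ (CARD('n) - 1)" for l :: "'n::finite" and x :: real
proof -
  have "(\<Prod>k\<in>UNIV. if k = l then x else y) = x * (\<Prod>k\<in>UNIV - {l}. if k = l then x else y)"
    by (subst prod.remove[of _ l]) auto
  also have "(\<Prod>k\<in>UNIV - {l}. if k = l then x else y) = y ^ (CARD('n) - 1)"
    by (subst prod.cong[of _ "UNIV - {l}" _ "\<lambda>_. y"]) (auto simp: card_Diff_subset)
  finally show ?thesis .
qed

lemma obtain_max_component: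
  fixes z :: "real ^ 'n"
  obtains l where "\<And>k. \<bar>z $ k\<bar> \<le> \<bar>z $ l\<bar>" "norm z \<le> CARD('n) * \<bar>z $ l\<bar>"
proof -
  obtain l where l: "\<And>k. \<bar>z $ k\<bar> \<le> \<bar>z $ l\<bar>"
    using Max_ge[of "range (\<lambda>k. \<bar>z $ k\<bar>)"] Max_in[of "range (\<lambda>k. \<bar>z $ k\<bar>)"] by fastforce
  have "norm z \<le> (\<Sum>k\<in>UNIV. \<bar>z $ k\<bar>)" by (rule norm_le_l1_cart)
  also have "\<dots> \<le> (\<Sum>k\<in>(UNIV :: 'n set). \<bar>z $ l\<bar>)" by (rule sum_mono) (rule l)
  finally have "norm z \<le> CARD('n) * \<bar>z $ l\<bar>" by simp
  then show ?thesis using l by (rule that[rotated])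
qed

lemma norm_less_card_times:
  fixes z :: "real ^ 'n" and s :: real
  assumes "\<And>k. \<bar>z $ k\<bar> < s"
  shows "norm z < CARD('n) * s"
proof -
  obtain l where "norm z \<le> CARD('n) * \<bar>z $ l\<bar>" using obtain_max_component[of z] by blast
  also have "\<dots> < CARD('n) * s" using assms[of l] by simp
  finally show ?thesis .
qed

text \<open>
  A grid packing argument in which the coordinate \<open>l\<close> with \<open>\<bar>z\<^sub>l\<bar>\<close> maximal is replaced
  by \<open>(z \<bullet> x) / z\<^sub>l\<close>, so that the slab becomes a box.
\<close>

lemma card_slab_packing:
  fixes S :: "(real ^ 'n) set" and z o' :: "real ^ 'n"
  assumes \<delta>: "\<delta> > 0" and sep: "\<And>x y. x \<in> S \<Longrightarrow> y \<in> S \<Longrightarrow> x \<noteq> y \<Longrightarrow> \<delta> \<le> norm (x - y)"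
    and z: "z \<noteq> 0" and slab: "\<And>x. x \<in> S \<Longrightarrow> \<bar>z \<bullet> x - t\<bar> \<le> \<eta>" and \<eta>: "\<eta> \<ge> 0"
    and cube: "\<And>x k. x \<in> S \<Longrightarrow> \<bar>x $ k - o' $ k\<bar> \<le> \<rho>" and \<rho>: "\<rho> \<ge> 0"
  defines "d \<equiv> real CARD('n)"
  shows "real (card S) \<le> (4 * d\<^sup>2 * \<eta> / (norm z * \<delta>) + 1) * (4 * d * \<rho> / \<delta> + 1) ^ (CARD('n) - 1)"
proof -
  have d: "d \<ge> 1" by (simp add: d_def Suc_leI)
  \<comment> \<open>If two points agree up to \<open>s\<close> in all new coordinates, then their
    \<open>l\<close>-th coordinates differ by less than \<open>d * s\<close>, because the ratios
    \<open>z $ k / z $ l\<close> are at most one in absolute value. The other \<open>d - 1\<close>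
    coordinates add at most \<open>s\<close> each, and the norm stays below
    \<open>2 * d * s\<close>.\<close>
  define s where "s = \<delta> / (2 * d)"
  have s: "s > 0" using \<delta> d by (simp add: s_def)
  obtain l where l: "\<And>k. \<bar>z $ k\<bar> \<le> \<bar>z $ l\<bar>" "norm z \<le> d * \<bar>z $ l\<bar>"
    unfolding d_def using obtain_max_component[of z] by blast
  have zl: "\<bar>z $ l\<bar> > 0" using l(2) z by (cases "z $ l = 0") auto
  define f where "f = (\<lambda>x k. if k = l then z \<bullet> x / z $ l else x $ k)"
  define L where "L = (\<lambda>k. if k = l then 2 * \<eta> / \<bar>z $ l\<bar> else 2 * \<rho>)"
  define a where "a = (\<lambda>k. if k = l then t / z $ l - \<eta> / \<bar>z $ l\<bar> else o' $ k - \<rho>)"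
  have "real (card S) \<le> (\<Prod>k\<in>UNIV. L k / s + 1)"
  proof (rule card_grid_packing[where f=f and a=a])
    fix x k assume x: "x \<in> S"
    have "\<bar>z \<bullet> x / z $ l - t / z $ l\<bar> \<le> \<eta> / \<bar>z $ l\<bar>"
      using slab[OF x] zl by (simp add: abs_divide divide_right_mono flip: diff_divide_distrib)
    then show "a k \<le> f x k \<and> f x k \<le> a k + L k"
      using cube[OF x, of k] by (auto simp: f_def a_def L_def)
  next
    fix x y assume xy: "x \<in> S" "y \<in> S" "\<And>k. \<bar>f x k - f y k\<bar> < s"
    define w where "w = x - y"
    have wk: "\<bar>w $ k\<bar> < s" if "k \<noteq> l" for k using xy(3)[of k] that by (simp add: f_def w_def)
    have wz: "\<bar>z \<bullet> w / z $ l\<bar> < s"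
      using xy(3)[of l] by (simp add: f_def w_def inner_diff_right diff_divide_distrib)
    have "z \<bullet> w / z $ l = (\<Sum>k\<in>UNIV. z $ k / z $ l * w $ k)"
      by (simp add: inner_vec_def sum_divide_distrib)
    also have "\<dots> = w $ l + (\<Sum>k\<in>UNIV - {l}. z $ k / z $ l * w $ k)"
      using zl by (subst sum.remove[of _ l]) auto
    finally have "w $ l = z \<bullet> w / z $ l - (\<Sum>k\<in>UNIV - {l}. z $ k / z $ l * w $ k)" by simp
    also have "\<bar>\<dots>\<bar> \<le> \<bar>z \<bullet> w / z $ l\<bar> + \<bar>\<Sum>k\<in>UNIV - {l}. z $ k / z $ l * w $ k\<bar>" by linarith
    also have "\<bar>\<Sum>k\<in>UNIV - {l}. z $ k / z $ l * w $ k\<bar> \<le> (\<Sum>k\<in>UNIV - {l}. s)"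
    proof (rule order_trans[OF sum_abs], rule sum_mono)
      fix k assume "k \<in> UNIV - {l}"
      then have "\<bar>z $ k / z $ l\<bar> * \<bar>w $ k\<bar> \<le> 1 * s"
        using l(1)[of k] zl wk[of k] by (intro mult_mono) (auto simp: abs_divide)
      then show "\<bar>z $ k / z $ l * w $ k\<bar> \<le> s" by (simp add: abs_mult)
    qed
    also have "\<dots> = (d - 1) * s" by (simp add: card_Diff_subset d_def of_nat_diff Suc_leI)
    finally have wl: "\<bar>w $ l\<bar> < d * s" using wz by (simp add: algebra_simps)
    have "norm w \<le> (\<Sum>k\<in>UNIV. \<bar>w $ k\<bar>)" by (rule norm_le_l1_cart)
    also have "\<dots> = \<bar>w $ l\<bar> + (\<Sum>k\<in>UNIV - {l}. \<bar>w $ k\<bar>)" by (subst sum.remove[of _ l]) auto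
    also have "(\<Sum>k\<in>UNIV - {l}. \<bar>w $ k\<bar>) \<le> (\<Sum>k\<in>UNIV - {l}. s)"
      by (rule sum_mono) (use wk in fastforce)
    also have "\<dots> = (d - 1) * s" by (simp add: card_Diff_subset d_def of_nat_diff Suc_leI)
    also have "\<bar>w $ l\<bar> + (d - 1) * s < 2 * d * s" using wl s by (simp add: algebra_simps)
    also have "2 * d * s = \<delta>" using d by (simp add: s_def)
    finally show "x = y" using sep[OF xy(1,2)] by (auto simp: w_def)
  qed (use s \<eta> \<rho> in \<open>auto simp: L_def\<close>)
  also have "(\<Prod>k\<in>UNIV. L k / s + 1) = (\<Prod>k\<in>UNIV. if k = l then 2 * \<eta> / \<bar>z $ l\<bar> / s + 1 else 2 * \<rho> / s + 1)"
    by (rule prod.cong) (auto simp: L_def)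
  also have "\<dots> = (2 * \<eta> / \<bar>z $ l\<bar> / s + 1) * (2 * \<rho> / s + 1) ^ (CARD('n) - 1)"
    by (rule prod_one_exception)
  also have "\<dots> \<le> (4 * d\<^sup>2 * \<eta> / (norm z * \<delta>) + 1) * (4 * d * \<rho> / \<delta> + 1) ^ (CARD('n) - 1)"
  proof (intro mult_mono)
    have "1 / \<bar>z $ l\<bar> \<le> d / norm z" using l(2) zl z by (simp add: field_simps)
    then have "4 * d * \<eta> / \<delta> * (1 / \<bar>z $ l\<bar>) \<le> 4 * d * \<eta> / \<delta> * (d / norm z)"
      using d \<delta> \<eta> by (intro mult_left_mono) auto
    then show "2 * \<eta> / \<bar>z $ l\<bar> / s + 1 \<le> 4 * d\<^sup>2 * \<eta> / (norm z * \<delta>) + 1"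
      by (simp add: s_def field_simps power2_eq_square)
  qed (use d \<delta> \<eta> \<rho> s in \<open>auto simp: s_def field_simps\<close>)
  finally show ?thesis .
qed

lemma card_ball_packing:
  fixes S :: "(real ^ 'n) set"
  assumes \<delta>: "\<delta> > 0" and sep: "\<And>x y. x \<in> S \<Longrightarrow> y \<in> S \<Longrightarrow> x \<noteq> y \<Longrightarrow> \<delta> \<le> norm (x - y)"
    and ball: "\<And>x. x \<in> S \<Longrightarrow> norm (x - p) \<le> r" and r: "r \<ge> 0"
  shows "real (card S) \<le> (2 * real CARD('n) * r / \<delta> + 1) ^ CARD('n)"
proof -
  have "real (card S) \<le> (\<Prod>k\<in>(UNIV::'n set). 2 * r / (\<delta> / CARD('n)) + 1)"
  proof (rule card_grid_packing[where f="\<lambda>x k. x $ k" and a="\<lambda>k. p $ k - r"])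
    fix x k assume "x \<in> S"
    then show "p $ k - r \<le> x $ k \<and> x $ k \<le> p $ k - r + 2 * r"
      using component_le_norm_cart[of "x - p" k] ball[of x] by auto
  next
    fix x y assume xy: "x \<in> S" "y \<in> S" "\<And>k. \<bar>x $ k - y $ k\<bar> < \<delta> / CARD('n)"
    then have "norm (x - y) < \<delta>" using norm_less_card_times[of "x - y" "\<delta> / CARD('n)"] by simp
    then show "x = y" using sep[OF xy(1,2)] by auto
  qed (use \<delta> r in auto)
  then show ?thesis by (simp add: field_simps)
qed

text \<open>Dyadic decomposition: a ball of radius \<open>r\<close> holds a number of points of
  order \<open>(r / \<delta>) ^ d\<close>, and each point of the outer half contributes at most
  \<open>2 / r\<close>. The inner half is handled by induction.\<close>

lemma sum_inverse_norm_packing: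
  fixes Q :: "(real ^ 'n) set"
  assumes \<delta>: "\<delta> > 0" and sep: "\<And>x y. x \<in> Q \<Longrightarrow> y \<in> Q \<Longrightarrow> x \<noteq> y \<Longrightarrow> \<delta> \<le> norm (x - y)"
    and far: "\<And>x. x \<in> Q \<Longrightarrow> \<delta> \<le> norm (p - x)" and fin: "finite Q" and dim: "CARD('n) \<ge> 2"
    and r: "r \<ge> 0"
  shows "(\<Sum>x | x \<in> Q \<and> norm (p - x) \<le> r. 1 / norm (p - x))
     \<le> 4 * real (2 * CARD('n) + 1) ^ CARD('n) * r ^ (CARD('n) - 1) / \<delta> ^ CARD('n)"
proof -
  define C where "C = real (2 * CARD('n) + 1) ^ CARD('n)"
  have C: "C > 0" by (simp add: C_def)
  define S where "S = (\<lambda>r. \<Sum>x | x \<in> Q \<and> norm (p - x) \<le> r. 1 / norm (p - x))"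
  \<comment> \<open>Here \<open>j\<close> bounds the number of halvings that bring \<open>r\<close>
    below \<open>\<delta>\<close>, where the sum is empty.\<close>
  have "S r \<le> 4 * C * r ^ (CARD('n) - 1) / \<delta> ^ CARD('n)" if "r < 2 ^ j * \<delta>" "r \<ge> 0" for j r
    using that
  proof (induction j arbitrary: r)
    case 0
    then have e: "{x. x \<in> Q \<and> norm (p - x) \<le> r} = {}" using far by fastforce
    show ?case unfolding S_def e using C \<delta> 0 by simp
  next
    case (Suc j)
    show ?case
    proof (cases "r < \<delta>")
      case True
      then have e: "{x. x \<in> Q \<and> norm (p - x) \<le> r} = {}" using far by fastforce
      show ?thesis unfolding S_def e using C \<delta> Suc.prems by simp
    next
      case False
      define N where "N = {x. x \<in> Q \<and> norm (p - x) \<le> r \<and> \<not> norm (p - x) \<le> r / 2}"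
      have "r > 0" using False \<delta> by simp
      have e: "{x. x \<in> Q \<and> norm (p - x) \<le> r} = {x. x \<in> Q \<and> norm (p - x) \<le> r / 2} \<union> N"
        using Suc.prems by (auto simp: N_def)
      have "S r = S (r / 2) + (\<Sum>x\<in>N. 1 / norm (p - x))"
        unfolding S_def e by (rule sum.union_disjoint) (use fin in \<open>auto simp: N_def\<close>)
      also have "S (r / 2) \<le> 4 * C * (r / 2) ^ (CARD('n) - 1) / \<delta> ^ CARD('n)"
        using Suc.prems by (intro Suc.IH) auto
      \<comment> \<open>Since \<open>d - 1 \<ge> 1\<close>, halving \<open>r\<close> at least halves
        the bound. The recursive part and the outer shell then contribute \<open>2 * C\<close> each
        and add up to \<open>4 * C\<close>.\<close>
      also have "4 * C * (r / 2) ^ (CARD('n) - 1) / \<delta> ^ CARD('n) \<le> 2 * C * r ^ (CARD('n) - 1) / \<delta> ^ CARD('n)"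
      proof -
        have "2 ^ 1 \<le> (2 :: real) ^ (CARD('n) - 1)" using dim by (intro power_increasing) auto
        then have "r ^ (CARD('n) - 1) / 2 ^ (CARD('n) - 1) \<le> r ^ (CARD('n) - 1) / 2"
          using \<open>r > 0\<close> by (intro divide_left_mono) auto
        then have "(4 * C / \<delta> ^ CARD('n)) * (r ^ (CARD('n) - 1) / 2 ^ (CARD('n) - 1))
              \<le> (4 * C / \<delta> ^ CARD('n)) * (r ^ (CARD('n) - 1) / 2)"
          using C \<delta> by (intro mult_left_mono) auto
        then show ?thesis by (simp add: power_divide mult_ac)
      qed
      also have "(\<Sum>x\<in>N. 1 / norm (p - x)) \<le> (\<Sum>x\<in>N. 2 / r)"
      proof (rule sum_mono)
        fix x assume "x \<in> N"
        then have "r / 2 < norm (p - x)" by (simp add: N_def)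
        then show "1 / norm (p - x) \<le> 2 / r" using \<open>r > 0\<close> frac_le[of 1 1 "r / 2" "norm (p - x)"] by simp
      qed
      also have "\<dots> = real (card N) * (2 / r)" by simp
      also have "\<dots> \<le> (C * (r / \<delta>) ^ CARD('n)) * (2 / r)"
      proof (rule mult_right_mono)
        have "real (card N) \<le> (2 * real CARD('n) * r / \<delta> + 1) ^ CARD('n)"
          by (rule card_ball_packing[where p=p]) (use \<delta> sep \<open>r > 0\<close> in \<open>auto simp: N_def norm_minus_commute\<close>)
        also have "\<dots> \<le> (real (2 * CARD('n) + 1) * (r / \<delta>)) ^ CARD('n)"
          using False \<delta> by (intro power_mono) (auto simp: field_simps)
        finally show "real (card N) \<le> C * (r / \<delta>) ^ CARD('n)"
          unfolding C_def power_mult_distrib by simp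
      qed (use \<open>r > 0\<close> in auto)
      also have "(C * (r / \<delta>) ^ CARD('n)) * (2 / r) = 2 * C * r ^ (CARD('n) - 1) / \<delta> ^ CARD('n)"
      proof -
        have "r ^ CARD('n) = r * r ^ (CARD('n) - 1)" by (simp flip: power_Suc)
        then show ?thesis using \<open>r > 0\<close> by (simp add: power_divide)
      qed
      finally show ?thesis by (simp add: field_simps)
    qed
  qed
  moreover obtain j where "r < 2 ^ j * \<delta>"
    using real_arch_pow[of 2 "r / \<delta>"] \<delta> by (auto simp: field_simps)
  ultimately show ?thesis using r unfolding S_def C_def by blast
qed

section \<open>Convex position: a sufficient condition and an upper bound on the size\<close>

lemma convex_position_if_norm_diff_less:
  fixes B :: "(real ^ 'n) set"
  assumes "\<And>p q. p \<in> B \<Longrightarrow> q \<in> B \<Longrightarrow> p \<noteq> q \<Longrightarrow> (norm (q - c))\<^sup>2 - (norm (p - c))\<^sup>2 < (norm (p - q))\<^sup>2"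
  shows "convex_position B"
  unfolding convex_position_def
proof
  fix p assume p: "p \<in> B"
  let ?H = "{q. (p - c) \<bullet> q < (p - c) \<bullet> p}"
  have "(p - c) \<bullet> q < (p - c) \<bullet> p" if "q \<in> B - {p}" for q
  proof -
    have "q \<noteq> p" "q \<in> B" using that by auto
    with assms[OF p this(2)] show ?thesis
      by (simp add: power2_norm_eq_inner inner_diff_left inner_diff_right inner_commute)
  qed
  then have "convex hull (B - {p}) \<subseteq> ?H"
    by (intro hull_minimal) (auto simp: convex_halfspace_lt)
  then show "p \<notin> convex hull (B - {p})" by blast
qed

text \<open>Separate \<open>p\<close> from the compact hull of the other points. The separating
  functional is larger on the hull, hence the sign change; a single point allows any nonzero
  vector.\<close>

lemma convex_position_supporting_vector:
  fixes B :: "(real ^ 'n) set"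
  assumes "finite B" "convex_position B" "p \<in> B"
  obtains u where "u \<noteq> 0" "\<And>q. q \<in> B \<Longrightarrow> u \<bullet> q \<le> u \<bullet> p"
proof (cases "B - {p} = {}")
  case True
  have "axis undefined 1 \<noteq> (0 :: real ^ 'n)" by (simp add: axis_eq_0_iff)
  then show ?thesis using True by (intro that[of "axis undefined 1"]) auto
next
  case False
  let ?K = "convex hull (B - {p})"
  have "p \<notin> ?K" using assms(2,3) by (simp add: convex_position_def)
  moreover have "closed ?K" using assms(1) by (simp add: compact_imp_closed finite_imp_compact_convex_hull)
  ultimately obtain a b where ab: "a \<bullet> p < b" "\<And>x. x \<in> ?K \<Longrightarrow> a \<bullet> x > b"
    using separating_hyperplane_closed_point[of ?K p] by auto
  have K: "q \<in> ?K" if "q \<in> B - {p}" for q using that by (rule hull_inc)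
  show ?thesis
  proof (rule that[of "- a"])
    show "- a \<noteq> 0" using False ab K by fastforce
    show "- a \<bullet> q \<le> - a \<bullet> p" if "q \<in> B" for q
      using that ab K[of q] by (cases "q = p") fastforce+
  qed
qed

text \<open>Each of the two displacements has nonnegative inner product with the difference that it
  enlarges, so the cross term in the expanded square is nonnegative.\<close>

lemma norm_le_norm_push_outward:
  fixes p q u u' :: "'a::real_inner"
  assumes "u \<bullet> q \<le> u \<bullet> p" "u' \<bullet> p \<le> u' \<bullet> q" "t \<ge> 0" "t' \<ge> 0"
  shows "norm (p - q) \<le> norm ((p + t *\<^sub>R u) - (q + t' *\<^sub>R u'))"
proof -
  define w where "w = t *\<^sub>R u - t' *\<^sub>R u'"
  have "(p - q) \<bullet> w = t * (u \<bullet> p - u \<bullet> q) + t' * (u' \<bullet> q - u' \<bullet> p)"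
    by (simp add: w_def algebra_simps inner_commute)
  also have "\<dots> \<ge> 0" using assms by simp
  finally have "(norm (p - q))\<^sup>2 \<le> (norm ((p - q) + w))\<^sup>2"
    unfolding power2_norm_eq_inner by (simp add: inner_add_left inner_add_right inner_commute)
  then show ?thesis by (simp add: w_def algebra_simps power2_le_iff_abs_le)
qed

text \<open>
  Scale the outer normal at \<open>p\<close> to have largest coordinate \<open>\<plusminus>1\<close> and move \<open>p\<close> along it until this
  coordinate reaches the boundary of the cube; grid packing in each of the \<open>2d\<close> faces finishes.
\<close>

lemma card_convex_position_le:
  fixes B :: "(real ^ 'n) set" and o' :: "real ^ 'n"
  assumes \<delta>: "\<delta> > 0" and sep: "\<And>x y. x \<in> B \<Longrightarrow> y \<in> B \<Longrightarrow> x \<noteq> y \<Longrightarrow> \<delta> \<le> norm (x - y)"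
    and cube: "\<And>x k. x \<in> B \<Longrightarrow> \<bar>x $ k - o' $ k\<bar> \<le> \<rho>" and \<rho>: "\<rho> \<ge> 0"
    and fin: "finite B" and conv: "convex_position B"
  defines "d \<equiv> real CARD('n)"
  shows "real (card B) \<le> 2 * d * (6 * d * \<rho> / \<delta> + 1) ^ (CARD('n) - 1)"
proof -
  have d: "d \<ge> 1" by (simp add: d_def Suc_leI)
  have "\<forall>p\<in>B. \<exists>u l. \<bar>u $ l\<bar> = 1 \<and> (\<forall>k. \<bar>u $ k\<bar> \<le> 1) \<and> (\<forall>q\<in>B. u \<bullet> q \<le> u \<bullet> p)"
  proof
    fix p assume p: "p \<in> B"
    obtain u where u: "u \<noteq> 0" "\<And>q. q \<in> B \<Longrightarrow> u \<bullet> q \<le> u \<bullet> p"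
      using convex_position_supporting_vector[OF fin conv p] by blast
    obtain l where l: "\<And>k. \<bar>u $ k\<bar> \<le> \<bar>u $ l\<bar>" "norm u \<le> CARD('n) * \<bar>u $ l\<bar>"
      using obtain_max_component[of u] by blast
    have ul: "\<bar>u $ l\<bar> > 0" using l(2) u(1) by auto
    show "\<exists>u l. \<bar>u $ l\<bar> = 1 \<and> (\<forall>k. \<bar>u $ k\<bar> \<le> 1) \<and> (\<forall>q\<in>B. u \<bullet> q \<le> u \<bullet> p)"
      using u(2) l(1) ul by (intro exI[of _ "u /\<^sub>R \<bar>u $ l\<bar>"] exI[of _ l])
        (auto simp: abs_mult divide_simps intro!: divide_right_mono)
  qed
  then have "\<exists>u l. \<forall>p\<in>B. \<bar>u p $ l p\<bar> = 1 \<and> (\<forall>k. \<bar>u p $ k\<bar> \<le> 1) \<and> (\<forall>q\<in>B. u p \<bullet> q \<le> u p \<bullet> p)"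
    unfolding bchoice_iff .
  then obtain u l where u: "\<And>p. p \<in> B \<Longrightarrow> \<bar>u p $ l p\<bar> = 1" "\<And>p k. p \<in> B \<Longrightarrow> \<bar>u p $ k\<bar> \<le> 1"
    "\<And>p q. p \<in> B \<Longrightarrow> q \<in> B \<Longrightarrow> u p \<bullet> q \<le> u p \<bullet> p"
    by blast
  \<comment> \<open>As \<open>u p $ l p\<close> is \<open>1\<close> or \<open>-1\<close>, this is
    the step that carries coordinate \<open>l p\<close> exactly to the boundary. It is at most
    \<open>2 * \<rho>\<close>, so all coordinates stay within \<open>3 * \<rho>\<close> of the
    centre.\<close>
  define t where "t = (\<lambda>p. \<rho> - u p $ l p * (p $ l p - o' $ l p))"
  define s where "s = (\<lambda>p. p + t p *\<^sub>R u p)"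
  have t: "0 \<le> t p \<and> t p \<le> 2 * \<rho>" if "p \<in> B" for p
  proof -
    have "\<bar>u p $ l p * (p $ l p - o' $ l p)\<bar> \<le> \<rho>" using u(1)[OF that] cube[OF that] by (simp add: abs_mult)
    then show ?thesis by (auto simp: t_def)
  qed
  have sl: "s p $ l p = o' $ l p + \<rho> * u p $ l p" if "p \<in> B" for p
  proof -
    have "u p $ l p * u p $ l p = 1" using u(1)[OF that] by (metis abs_mult_self_eq mult_1)
    then show ?thesis by (simp add: s_def t_def algebra_simps)
  qed
  have sk: "\<bar>s p $ k - o' $ k\<bar> \<le> 3 * \<rho>" if "p \<in> B" for p k
  proof -
    have "\<bar>t p * u p $ k\<bar> \<le> 2 * \<rho> * 1" unfolding abs_mult using t[OF that] u(2)[OF that, of k] by (intro mult_mono) auto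
    then show ?thesis using cube[OF that, of k] by (simp add: s_def)
  qed
  have sep_s: "norm (p - q) \<le> norm (s p - s q)" if "p \<in> B" "q \<in> B" for p q
    unfolding s_def using u(3) t that by (intro norm_le_norm_push_outward) auto
  define Bl where "Bl = (\<lambda>(k, \<sigma>). {p \<in> B. l p = k \<and> u p $ l p = \<sigma>})"
  have bound: "real (card (Bl (k0, \<sigma>))) \<le> (6 * d * \<rho> / \<delta> + 1) ^ (CARD('n) - 1)" for k0 \<sigma>
  proof -
    \<comment> \<open>All points pushed onto one face share coordinate \<open>k0\<close>, which
      therefore contributes the factor one and lowers the exponent to \<open>d - 1\<close>.\<close>
    define L where "L = (\<lambda>k. if k = k0 then 0 else 6 * \<rho>)"
    have "real (card (Bl (k0, \<sigma>))) \<le> (\<Prod>k\<in>UNIV. L k / (\<delta> / d) + 1)"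
    proof (rule card_grid_packing[where f="\<lambda>p k. s p $ k" and a="\<lambda>k. if k = k0 then o' $ k + \<rho> * \<sigma> else o' $ k - 3 * \<rho>"])
      fix p k assume "p \<in> Bl (k0, \<sigma>)"
      then have p: "p \<in> B" "l p = k0" "u p $ l p = \<sigma>" by (auto simp: Bl_def)
      show "(if k = k0 then o' $ k + \<rho> * \<sigma> else o' $ k - 3 * \<rho>) \<le> s p $ k \<and>
        s p $ k \<le> (if k = k0 then o' $ k + \<rho> * \<sigma> else o' $ k - 3 * \<rho>) + L k"
        using sl[OF p(1)] sk[OF p(1), of k] p by (auto simp: L_def)
    next
      fix p q assume pq: "p \<in> Bl (k0, \<sigma>)" "q \<in> Bl (k0, \<sigma>)" "\<And>k. \<bar>s p $ k - s q $ k\<bar> < \<delta> / d"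
      then have pqB: "p \<in> B" "q \<in> B" by (auto simp: Bl_def)
      have "norm (s p - s q) < \<delta>" using norm_less_card_times[of "s p - s q" "\<delta> / d"] pq(3) d by (simp add: d_def)
      then show "p = q" using sep[OF pqB] sep_s[OF pqB] by auto
    qed (use \<delta> \<rho> d in \<open>auto simp: L_def\<close>)
    also have "\<dots> = (\<Prod>k\<in>UNIV. if k = k0 then 1 else 6 * \<rho> / (\<delta> / d) + 1)"
      by (rule prod.cong) (auto simp: L_def)
    also have "\<dots> = 1 * (6 * \<rho> / (\<delta> / d) + 1) ^ (CARD('n) - 1)"
      by (rule prod_one_exception)
    finally show ?thesis by (simp add: mult_ac)
  qed
  have "B \<subseteq> (\<Union>x\<in>UNIV \<times> {1, -1}. Bl x)"
    using u(1) by (force simp: Bl_def abs_if split: if_splits)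
  then have "card B \<le> card (\<Union>x\<in>UNIV \<times> {1, -1}. Bl x)"
    by (rule card_mono[rotated]) (use fin in \<open>auto simp: Bl_def\<close>)
  also have "\<dots> \<le> (\<Sum>x\<in>UNIV \<times> {1, -1}. card (Bl x))" by (rule card_UN_le) auto
  finally have "real (card B) \<le> (\<Sum>x\<in>UNIV \<times> {1, -1}. real (card (Bl x)))"
    by (metis of_nat_le_iff of_nat_sum)
  also have "\<dots> \<le> (\<Sum>x\<in>(UNIV :: 'n set) \<times> {1, -1 :: real}. (6 * d * \<rho> / \<delta> + 1) ^ (CARD('n) - 1))"
    by (rule sum_mono) (use bound in auto)
  also have "\<dots> = 2 * d * (6 * d * \<rho> / \<delta> + 1) ^ (CARD('n) - 1)"
    by (simp add: card_cartesian_product d_def)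
  finally show ?thesis .
qed

section \<open>Collisions, and their average over the centre\<close>

lemma card_collision_pairs:
  assumes "finite I"
  shows "(card I)\<^sup>2 \<le> card {(i, j) \<in> I \<times> I. K i = K j} * card (K ` I)"
proof -
  let ?F = "\<lambda>k. {i \<in> I. K i = k}"
  have 1: "card I = (\<Sum>k\<in>K ` I. card (?F k))"
    using assms by (subst card_UN_disjoint[symmetric]) (auto intro!: arg_cong[of _ _ card])
  have un: "{(i, j) \<in> I \<times> I. K i = K j} = (\<Union>k\<in>K ` I. ?F k \<times> ?F k)" by auto
  have 2: "card {(i, j) \<in> I \<times> I. K i = K j} = (\<Sum>k\<in>K ` I. (card (?F k))\<^sup>2)"
    unfolding un using assms by (subst card_UN_disjoint) (auto simp: card_cartesian_product power2_eq_square)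
  have "(\<Sum>k\<in>K ` I. real (card (?F k)))\<^sup>2 \<le> (\<Sum>k\<in>K ` I. (real (card (?F k)))\<^sup>2) * card (K ` I)"
    by (rule sum_squared_le_sum_of_squares)
  then have "real ((card I)\<^sup>2) \<le> real (card {(i, j) \<in> I \<times> I. K i = K j} * card (K ` I))"
    unfolding 1 2 by simp
  then show ?thesis by (simp only: of_nat_le_iff)
qed

text \<open>A consequence of lying in a common cube of side \<open>b\<close> and a common shell
  around \<open>c\<close> that mentions neither the position of the grid nor any rounding, and can
  therefore be counted geometrically.\<close>

definition close :: "real \<Rightarrow> real ^ 'n \<Rightarrow> real ^ 'n \<Rightarrow> real ^ 'n \<Rightarrow> bool" where
  "close b c x y \<longleftrightarrow> norm (x - y) \<le> real CARD('n) * b \<and> \<bar>(norm (x - c))\<^sup>2 - (norm (y - c))\<^sup>2\<bar> < b\<^sup>2"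

text \<open>The product of \<open>3 * d\<^sup>2 * (5 * d) ^ (d - 1)\<close> from slab packing,
  \<open>4 * (2 * d + 1) ^ d\<close> from the dyadic sum, and \<open>d ^ (d - 1)\<close> from
  summing up to radius \<open>d * b\<close>.\<close>

definition close_const :: "nat \<Rightarrow> real" where
  "close_const d = 12 * real d ^ 2 * (5 * real d) ^ (d - 1) * (2 * real d + 1) ^ d * real d ^ (d - 1)"

text \<open>The assumptions on \<open>b\<close> and on the spread say that \<open>b\<close> is at
  most \<open>\<rho>\<close> divided by the root of order \<open>d + 1\<close> of the number of
  points, and that \<open>\<rho> / \<delta>\<close> is at most of the order of the
  \<open>d\<close>-th root of that number. Powers replace the roots.\<close>

locale spread_set =
  fixes A :: "(real ^ 'n) set" and o' :: "real ^ 'n" and \<delta> \<rho> b \<beta> :: real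
  assumes finite: "finite A" and dim: "CARD('n) \<ge> 2"
    and \<delta>: "\<delta> > 0" and sep: "\<And>x y. x \<in> A \<Longrightarrow> y \<in> A \<Longrightarrow> x \<noteq> y \<Longrightarrow> \<delta> \<le> norm (x - y)"
    and cube: "\<And>x k. x \<in> A \<Longrightarrow> \<bar>x $ k - o' $ k\<bar> \<le> \<rho>" and \<rho>: "\<delta> \<le> real CARD('n) * \<rho>"
    and b: "b > 0" "b ^ (CARD('n) + 1) * card A \<le> \<rho> ^ (CARD('n) + 1)"
    and spread: "(\<rho> / \<delta>) ^ CARD('n) \<le> \<beta> * card A"
begin

lemma card_ge_2: "real CARD('n) \<ge> 2" using dim by simp

lemma \<rho>_pos: "\<rho> > 0" using \<rho> \<delta> card_ge_2 by (smt (verit) mult_nonneg_nonpos)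

text \<open>Expanding the squares shows that such centres lie within \<open>b\<^sup>2 / 2\<close>,
  measured by the functional \<open>x - y\<close>, of the bisecting hyperplane;
  \<open>card_slab_packing\<close> counts them. The factor \<open>1 / norm (x - y)\<close> is what
  makes the sum over \<open>y\<close> small.\<close>

lemma card_close_centers:
  assumes xy: "x \<in> A" "y \<in> A" "x \<noteq> y" "norm (x - y) \<le> real CARD('n) * b"
  shows "real (card {c \<in> A. close b c x y})
    \<le> 3 * (real CARD('n))\<^sup>2 * (5 * real CARD('n)) ^ (CARD('n) - 1) * ((\<rho> / \<delta>) ^ (CARD('n) - 1) * b\<^sup>2 / \<delta>) * (1 / norm (x - y))"
proof -
  define D where "D = norm (x - y)"
  have D: "\<delta> \<le> D" "D \<le> real CARD('n) * b" using sep xy by (auto simp: D_def)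
  let ?S = "{c \<in> A. close b c x y}"
  have abs_le_half: "\<bar>a\<bar> < B \<Longrightarrow> a = - 2 * w \<Longrightarrow> \<bar>w\<bar> \<le> B / 2" for a B w :: real by linarith
  have "real (card ?S) \<le> (4 * (real CARD('n))\<^sup>2 * (b\<^sup>2 / 2) / (norm (x - y) * \<delta>) + 1) * (4 * real CARD('n) * \<rho> / \<delta> + 1) ^ (CARD('n) - 1)"
  proof (rule card_slab_packing[where o'=o' and t="(x \<bullet> x - y \<bullet> y) / 2"])
    fix c assume "c \<in> ?S"
    then have "\<bar>(norm (x - c))\<^sup>2 - (norm (y - c))\<^sup>2\<bar> < b\<^sup>2" by (simp add: close_def)
    moreover have "(norm (x - c))\<^sup>2 - (norm (y - c))\<^sup>2 = - 2 * ((x - y) \<bullet> c - (x \<bullet> x - y \<bullet> y) / 2)"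
      by (simp add: power2_norm_eq_inner inner_diff_left inner_diff_right inner_commute field_simps)
    ultimately show "\<bar>(x - y) \<bullet> c - (x \<bullet> x - y \<bullet> y) / 2\<bar> \<le> b\<^sup>2 / 2"
      using abs_le_half by blast
  qed (use xy \<delta> sep cube \<rho>_pos in auto)
  also have "\<dots> \<le> (3 * (real CARD('n))\<^sup>2 * b\<^sup>2 / (D * \<delta>)) * (5 * real CARD('n) * (\<rho> / \<delta>)) ^ (CARD('n) - 1)"
  proof (intro mult_mono power_mono)
    \<comment> \<open>The additive ones of the packing bound are absorbed:
      \<open>\<delta> * D \<le> (d * b)\<^sup>2\<close> turns the factor two into three, and
      \<open>\<delta> \<le> d * \<rho>\<close> turns four into five.\<close>
    have "\<delta> * D \<le> (real CARD('n) * b) * (real CARD('n) * b)" using D \<delta> by (intro mult_mono) auto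
    then have "1 \<le> (real CARD('n))\<^sup>2 * b\<^sup>2 / (D * \<delta>)" using D \<delta> by (simp add: power2_eq_square field_simps)
    then show "4 * (real CARD('n))\<^sup>2 * (b\<^sup>2 / 2) / (norm (x - y) * \<delta>) + 1 \<le> 3 * (real CARD('n))\<^sup>2 * b\<^sup>2 / (D * \<delta>)"
      by (simp add: D_def add_divide_distrib[symmetric] field_simps)
    have "1 \<le> real CARD('n) * (\<rho> / \<delta>)" using \<rho> \<delta> by (simp add: field_simps)
    moreover have "4 * a + 1 \<le> 5 * a" if "1 \<le> a" for a :: real using that by simp
    ultimately have "4 * (real CARD('n) * (\<rho> / \<delta>)) + 1 \<le> 5 * (real CARD('n) * (\<rho> / \<delta>))" by blast
    then show "4 * real CARD('n) * \<rho> / \<delta> + 1 \<le> 5 * real CARD('n) * (\<rho> / \<delta>)" by (simp add: mult_ac)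
  qed (use D \<delta> \<rho>_pos card_ge_2 in auto)
  also have "\<dots> = 3 * (real CARD('n))\<^sup>2 * (5 * real CARD('n)) ^ (CARD('n) - 1) * ((\<rho> / \<delta>) ^ (CARD('n) - 1) * b\<^sup>2 / \<delta>) * (1 / norm (x - y))"
    unfolding power_mult_distrib D_def by (simp add: field_simps)
  finally show ?thesis .
qed

text \<open>The slab counts decay like the inverse distance, and summing them over the ball of
  radius \<open>d * b\<close> gives order
  \<open>\<rho> ^ (d - 1) * b ^ (d + 1) / \<delta> ^ (2 * d)\<close>. The bound on \<open>b\<close>
  turns this into the square of \<open>(\<rho> / \<delta>) ^ d\<close> over the number of points.
  The additional one accounts for \<open>y = x\<close>.\<close>

lemma sum_card_close_centers:
  assumes x: "x \<in> A"
  shows "(\<Sum>y\<in>A. real (card {c \<in> A. close b c x y})) \<le> (close_const CARD('n) * \<beta>\<^sup>2 + 1) * card A"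
proof -
  define n where "n = real (card A)"
  have n: "n > 0" using x finite by (auto simp: n_def card_gt_0_iff)
  define C where "C = 3 * (real CARD('n))\<^sup>2 * (5 * real CARD('n)) ^ (CARD('n) - 1)"
  define E where "E = (\<rho> / \<delta>) ^ (CARD('n) - 1) * b\<^sup>2 / \<delta>"
  have CE: "C \<ge> 0" "E \<ge> 0" using \<delta> \<rho>_pos by (auto simp: C_def E_def)
  let ?Q = "{y. y \<in> A - {x} \<and> norm (x - y) \<le> real CARD('n) * b}"
  have "(\<Sum>y\<in>A. real (card {c \<in> A. close b c x y})) =
      real (card {c \<in> A. close b c x x}) + (\<Sum>y\<in>A - {x}. real (card {c \<in> A. close b c x y}))"
    using x finite by (simp add: sum.remove)
  also have "(\<Sum>y\<in>A - {x}. real (card {c \<in> A. close b c x y})) = (\<Sum>y\<in>?Q. real (card {c \<in> A. close b c x y}))"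
    by (rule sum.mono_neutral_right) (use finite in \<open>auto simp: close_def\<close>)
  also have "\<dots> \<le> (\<Sum>y\<in>?Q. C * E * (1 / norm (x - y)))"
    by (rule sum_mono) (use card_close_centers x in \<open>auto simp: C_def E_def\<close>)
  also have "\<dots> = C * E * (\<Sum>y\<in>?Q. 1 / norm (x - y))" by (simp add: sum_distrib_left)
  also have "\<dots> \<le> C * E * (4 * real (2 * CARD('n) + 1) ^ CARD('n) * (real CARD('n) * b) ^ (CARD('n) - 1) / \<delta> ^ CARD('n))"
    by (intro mult_left_mono sum_inverse_norm_packing) (use \<delta> sep x finite dim b CE in auto)
  also have "\<dots> = close_const CARD('n) * ((\<rho> / \<delta>) ^ (CARD('n) - 1) * b ^ (CARD('n) + 1) / \<delta> ^ (CARD('n) + 1))"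
  proof -
    have "b ^ (CARD('n) + 1) = b\<^sup>2 * b ^ (CARD('n) - 1)"
      using dim by (simp add: power_add[symmetric] del: power_Suc)
    then show ?thesis
      unfolding C_def E_def close_const_def power_mult_distrib by (simp add: field_simps)
  qed
  also have "\<dots> \<le> close_const CARD('n) * (\<beta>\<^sup>2 * n)"
  proof (rule mult_left_mono)
    have "b ^ (CARD('n) + 1) \<le> \<rho> ^ (CARD('n) + 1) / n"
      using b n by (simp add: n_def field_simps)
    then have "(\<rho> / \<delta>) ^ (CARD('n) - 1) * b ^ (CARD('n) + 1) / \<delta> ^ (CARD('n) + 1)
      \<le> (\<rho> / \<delta>) ^ (CARD('n) - 1) * (\<rho> ^ (CARD('n) + 1) / n) / \<delta> ^ (CARD('n) + 1)"
      using \<delta> \<rho>_pos by (intro divide_right_mono mult_left_mono) auto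
    also have "\<dots> = (\<rho> / \<delta>) ^ (CARD('n) - 1) * (\<rho> / \<delta>) ^ (CARD('n) + 1) / n"
      by (simp add: power_divide mult_ac)
    also have "(\<rho> / \<delta>) ^ (CARD('n) - 1) * (\<rho> / \<delta>) ^ (CARD('n) + 1) = ((\<rho> / \<delta>) ^ CARD('n))\<^sup>2"
      using dim unfolding power_mult[symmetric] power_add[symmetric] by (intro arg_cong[of _ _ "power _"]) simp
    also have "\<dots> / n \<le> (\<beta> * n)\<^sup>2 / n"
      using spread \<delta> \<rho>_pos n by (intro divide_right_mono power_mono) (auto simp: n_def)
    also have "\<dots> = \<beta>\<^sup>2 * n" using n by (simp add: power2_eq_square)
    finally show "(\<rho> / \<delta>) ^ (CARD('n) - 1) * b ^ (CARD('n) + 1) / \<delta> ^ (CARD('n) + 1) \<le> \<beta>\<^sup>2 * n" .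
  qed (simp add: close_const_def)
  also have "real (card {c \<in> A. close b c x x}) \<le> n"
    unfolding n_def by (simp add: card_mono finite)
  finally show ?thesis unfolding n_def[symmetric] by (simp only: distrib_right mult.assoc mult_1 add.commute)
qed

text \<open>Double counting of the triples \<open>(c, x, y)\<close> bounds the average number of
  close pairs per centre by \<open>H * card A\<close>, and Markov's inequality leaves at most half
  of the centres above twice this average.\<close>

lemma many_good_centers:
  defines "H \<equiv> close_const CARD('n) * \<beta>\<^sup>2 + 1"
  shows "card A \<le> 2 * card {c \<in> A. real (card {(x, y) \<in> A \<times> A. close b c x y}) \<le> 2 * H * real (card A)}"
proof (cases "A = {}")
  case False
  let ?P = "\<lambda>c. {(x, y) \<in> A \<times> A. close b c x y}"
  let ?G = "{c \<in> A. real (card (?P c)) \<le> 2 * H * real (card A)}"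
  have H: "H \<ge> 1" by (simp add: H_def close_const_def)
  have n: "real (card A) > 0" using False finite by (simp add: card_gt_0_iff)
  have card_if: "real (card {x \<in> S. R x}) = (\<Sum>x\<in>S. if R x then 1 else 0)" if "finite S" for S :: "'x set" and R
    using that by (simp flip: sum.inter_filter)
  have P: "real (card (?P c)) = (\<Sum>x\<in>A. \<Sum>y\<in>A. if close b c x y then 1 else 0)" for c
  proof -
    have "?P c = {p \<in> A \<times> A. close b c (fst p) (snd p)}" by auto
    then have "real (card (?P c)) = (\<Sum>p\<in>A \<times> A. if close b c (fst p) (snd p) then 1 else 0)"
      using card_if[of "A \<times> A" "\<lambda>p. close b c (fst p) (snd p)"] finite by simp
    then show ?thesis by (simp add: sum.cartesian_product case_prod_unfold)
  qed
  have Q: "real (card {c \<in> A. close b c x y}) = (\<Sum>c\<in>A. if close b c x y then 1 else 0)" for x y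
    by (rule card_if[OF finite])
  have "(\<Sum>c\<in>A. real (card (?P c))) = (\<Sum>x\<in>A. \<Sum>y\<in>A. real (card {c \<in> A. close b c x y}))"
    unfolding P Q by (subst sum.swap, rule sum.cong[OF refl], rule sum.swap)
  also have "\<dots> \<le> (\<Sum>x\<in>A. H * card A)"
    unfolding H_def by (rule sum_mono) (rule sum_card_close_centers)
  finally have total: "(\<Sum>c\<in>A. real (card (?P c))) \<le> H * (real (card A))\<^sup>2"
    by (simp add: power2_eq_square mult_ac)
  have "real (card (A - ?G)) * (2 * H * card A) = (\<Sum>c\<in>A - ?G. 2 * H * card A)" by simp
  also have "\<dots> \<le> (\<Sum>c\<in>A - ?G. real (card (?P c)))" by (rule sum_mono) auto
  also have "\<dots> \<le> (\<Sum>c\<in>A. real (card (?P c)))" by (rule sum_mono2) (use finite in auto)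
  finally have "real (card (A - ?G)) * (2 * H * card A) \<le> H * (real (card A))\<^sup>2"
    using total by linarith
  then have "2 * real (card (A - ?G)) \<le> real (card A)"
    using H n by (simp add: power2_eq_square field_simps)
  moreover have "card (A - ?G) = card A - card ?G" "card ?G \<le> card A"
    using finite by (auto intro!: card_Diff_subset card_mono)
  ultimately show ?thesis by linarith
qed simp

end

section \<open>The grid algorithm\<close>

primrec nmul :: "nat \<Rightarrow> nexp \<Rightarrow> nexp" where
  "nmul 0 e = NConst 0"
| "nmul (Suc k) e = NAdd e (nmul k e)"

lemma nval_nmul[simp]: "nval s (nmul k e) = k * nval s e"
  by (induction k) auto

primrec rsum :: "(nat \<Rightarrow> rexp) \<Rightarrow> nat \<Rightarrow> rexp" where
  "rsum f 0 = RCast (NConst 0)"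
| "rsum f (Suc k) = RAdd (rsum f k) (f k)"

lemma rval_rsum[simp]: "rval s (rsum f k) = (\<Sum>l<k. rval s (f l))"
  by (induction k) auto

primrec rpow :: "rexp \<Rightarrow> nat \<Rightarrow> rexp" where
  "rpow e 0 = RCast (NConst 1)"
| "rpow e (Suc k) = RMul e (rpow e k)"

lemma rval_rpow[simp]: "rval s (rpow e k) = rval s e ^ k"
  by (induction k) auto

primrec seqs :: "(nat \<Rightarrow> com) \<Rightarrow> nat \<Rightarrow> com" where
  "seqs f 0 = Skip"
| "seqs f (Suc k) = Seq (seqs f k) (f k)"

lemma spec_seqs:
  assumes "\<And>l. l < k \<Longrightarrow> spec (J l) (f l) (J (Suc l)) T"
  shows "spec (J 0) (seqs f k) (J k) (k * T + 1)"
  using assms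
proof (induction k)
  case 0
  then show ?case using spec_Skip[of "J 0" "J 0"] by simp
next
  case (Suc k)
  have "spec (J 0) (Seq (seqs f k) (f k)) (J (Suc k)) (k * T + 1 + T)"
    by (rule spec_Seq[OF Suc.IH]) (use Suc.prems in auto)
  then show ?case by (simp add: add_ac)
qed

lemma spec_ex:
  assumes "\<And>a. spec (P a) c (Q a) T"
  shows "spec (\<lambda>s. \<exists>a. P a s) c (\<lambda>s. \<exists>a. Q a s) T"
  using assms unfolding spec_def by blast

text \<open>Fixing the initial state \<open>s0\<close> lets a postcondition refer to it, as frame
  conditions must; the reference is then eliminated by \<open>R\<close>.\<close>

lemma spec_pointwise:
  assumes "\<And>s0. P s0 \<Longrightarrow> spec (\<lambda>s. s = s0) c (Q s0) T" "\<And>s0 s. P s0 \<Longrightarrow> Q s0 s \<Longrightarrow> R s"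
  shows "spec P c R T"
  unfolding spec_def
proof (intro allI impI)
  fix s f B assume "P s" "\<forall>s'. R s' \<longrightarrow> f s' \<le> (B :: ennreal)"
  then show "wp c f s \<le> B + of_nat T"
    using assms(2) by (intro specD[OF assms(1)[OF \<open>P s\<close>]]) auto
qed

text \<open>This is the equality test for naturals, expressed by two negated comparisons.\<close>

abbreviation neq :: "nexp \<Rightarrow> nexp \<Rightarrow> bexp" where
  "neq a b \<equiv> BAnd (BNot (NLess a b)) (BNot (NLess b a))"

text \<open>
  The natural memory above the input size is split into five interleaved arrays; array \<open>0\<close> serves
  as a bank of registers. Addresses are taken relative to cell \<open>0\<close>, so that the cells
  \<open>1, \<dots>, n\<close> stay free for the output. The real registers follow the input coordinates.
\<close>

definition cell :: "nat \<Rightarrow> nexp \<Rightarrow> nexp" where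
  "cell r e = NAdd (NAdd (NRead (NConst 0)) (NConst (Suc r))) (nmul 5 e)"

abbreviation nget :: "nat \<Rightarrow> nexp \<Rightarrow> nexp" where "nget r e \<equiv> NRead (cell r e)"
abbreviation nput :: "nat \<Rightarrow> nexp \<Rightarrow> nexp \<Rightarrow> com" where "nput r e v \<equiv> NAssign (cell r e) v"
abbreviation reg :: "nat \<Rightarrow> nexp" where "reg j \<equiv> nget 0 (NConst j)"
abbreviation setreg :: "nat \<Rightarrow> nexp \<Rightarrow> com" where "setreg j v \<equiv> nput 0 (NConst j) v"

definition rcell :: "nat \<Rightarrow> nat \<Rightarrow> nexp" where
  "rcell d j = NAdd (nmul d (NRead (NConst 0))) (NConst j)"

abbreviation rreg :: "nat \<Rightarrow> nat \<Rightarrow> rexp" where "rreg d j \<equiv> RRead (rcell d j)"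
abbreviation setrreg :: "nat \<Rightarrow> nat \<Rightarrow> rexp \<Rightarrow> com" where "setrreg d j e \<equiv> RAssign (rcell d j) e"

definition coord :: "nat \<Rightarrow> nexp \<Rightarrow> nat \<Rightarrow> rexp" where
  "coord d i l = RRead (NAdd (nmul d i) (NConst l))"

definition arr :: "state \<Rightarrow> nat \<Rightarrow> nat \<Rightarrow> nat" where
  "arr s r x = nmem s (nmem s 0 + Suc r + 5 * x)"

definition upd :: "nat \<Rightarrow> nat \<Rightarrow> nat \<Rightarrow> state \<Rightarrow> state" where
  "upd r x v s = nwrite (nmem s 0 + Suc r + 5 * x) v s"

definition rg :: "nat \<Rightarrow> state \<Rightarrow> nat \<Rightarrow> real" where
  "rg d s j = rmem s (d * nmem s 0 + j)"

definition updr :: "nat \<Rightarrow> nat \<Rightarrow> real \<Rightarrow> state \<Rightarrow> state" where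
  "updr d j v s = rwrite (d * nmem s 0 + j) v s"

definition cx :: "nat \<Rightarrow> state \<Rightarrow> nat \<Rightarrow> nat \<Rightarrow> real" where
  "cx d s i l = rmem s (d * i + l)"

lemma nmem_cell[simp]: "nmem s (nval s (cell r e)) = arr s r (nval s e)"
  by (simp add: cell_def arr_def)

lemma nwrite_cell[simp]: "nwrite (nval s (cell r e)) v s = upd r (nval s e) v s"
  by (simp add: cell_def upd_def)

lemma rmem_rcell[simp]: "rmem s (nval s (rcell d j)) = rg d s j"
  by (simp add: rcell_def rg_def)

lemma rwrite_rcell[simp]: "rwrite (nval s (rcell d j)) v s = updr d j v s"
  by (simp add: rcell_def updr_def)

lemma rval_coord[simp]: "rval s (coord d i l) = cx d s (nval s i) l"
  by (simp add: coord_def cx_def)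

text \<open>The interleaved arrays do not overlap, because \<open>r + 5 * x\<close> with
  \<open>r < 5\<close> determines \<open>r\<close> and \<open>x\<close>.\<close>

lemma arr_upd[simp]:
  assumes "r < 5" "r' < 5"
  shows "arr (upd r x v s) r' y = (if r = r' \<and> x = y then v else arr s r' y)"
proof -
  have "r' + 5 * y = r + 5 * x \<longleftrightarrow> r = r' \<and> x = y" using assms by presburger
  then show ?thesis by (auto simp: arr_def upd_def nwrite_def)
qed

lemma state_upd[simp]:
  "nmem (upd r x v s) 0 = nmem s 0" "rmem (upd r x v s) = rmem s"
  "rg d (upd r x v s) = rg d s" "cx d (upd r x v s) = cx d s"
  "k \<le> nmem s 0 \<Longrightarrow> nmem (upd r x v s) k = nmem s k"
  by (auto simp: upd_def nwrite_def rg_def cx_def fun_eq_iff)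

lemma state_updr[simp]:
  "nmem (updr d j v s) = nmem s" "arr (updr d j v s) = arr s"
  "rg d (updr d j v s) k = (if j = k then v else rg d s k)"
  by (auto simp: updr_def rwrite_def rg_def arr_def fun_eq_iff)

lemma cx_updr[simp]:
  assumes "i < nmem s 0" "l < d"
  shows "cx d (updr d j v s) i l = cx d s i l"
proof -
  have "d * i + l < d * Suc i" using assms by simp
  also have "\<dots> \<le> d * nmem s 0" using assms by (intro mult_le_mono2) auto
  finally show ?thesis by (simp add: updr_def cx_def rwrite_def)
qed

lemma arr_nwrite_output[simp]:
  assumes "0 < k" "k \<le> nmem s 0"
  shows "arr (nwrite k v s) r x = arr s r x"
  using assms by (auto simp: arr_def nwrite_def)

lemma state_nwrite_output[simp]:
  assumes "0 < k" shows "nmem (nwrite k v s) 0 = nmem s 0"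
  using assms by (auto simp: nwrite_def)

text \<open>
  Registers: 0 loop index, 1 centre, 2 grid resolution, 3 key accumulator, 4 group accumulator,
  5 best count, 6 best group, 7 output length. Arrays: 1 keys, 2 groups, 3 the last point
  with a given key, 4 the number of keys in a given group.
  Real registers: 0 radius, 1 current power of two, 2 number to be written in binary.
\<close>

definition scale :: "nat \<Rightarrow> rexp" where
  "scale E = RMul (RMul (RCast (reg 2)) (RCast (reg 2))) (RCast (NConst E))"

text \<open>Rounds a real down by subtracting decreasing powers of two, as the machine has no
  rounding. The digits are appended to whatever register 3 holds, so that consecutive calls build
  one joint code.\<close>

definition digits :: "nat \<Rightarrow> nat \<Rightarrow> com" where
  "digits d E = Seq (setrreg d 1 (scale E))
     (While (RLess (RCast (NConst 1)) (rreg d 1))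
       (Seq (setrreg d 1 (RDiv (rreg d 1) (RCast (NConst 2))))
         (Seq (setreg 3 (NAdd (reg 3) (reg 3)))
           (Cond (RLess (rreg d 2) (rreg d 1)) Skip
             (Seq (setrreg d 2 (RSub (rreg d 2) (rreg d 1)))
               (setreg 3 (NAdd (reg 3) (NConst 1))))))))"

definition frame :: "nat \<Rightarrow> state \<Rightarrow> state \<Rightarrow> bool" where
  "frame d s0 s \<longleftrightarrow> nmem s 0 = nmem s0 0 \<and>
     (\<forall>r x. r < 5 \<longrightarrow> (r, x) \<notin> {(0, 3), (0, 4)} \<longrightarrow> arr s r x = arr s0 r x) \<and>
     rg d s 0 = rg d s0 0 \<and> (\<forall>i<nmem s0 0. \<forall>l<d. cx d s i l = cx d s0 i l)"

lemma frame_refl[simp]: "frame d s s" by (simp add: frame_def)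

lemma frame_arr: "frame d s0 s \<Longrightarrow> r < 5 \<Longrightarrow> (r, x) \<notin> {(0, 3), (0, 4)} \<Longrightarrow> arr s r x = arr s0 r x"
  by (simp add: frame_def)

lemma frame_upd[simp]: "x \<in> {3, 4} \<Longrightarrow> frame d s0 s \<Longrightarrow> frame d s0 (upd 0 x v s)"
  by (auto simp: frame_def)

lemma frame_updr[simp]: "j \<noteq> 0 \<Longrightarrow> frame d s0 s \<Longrightarrow> frame d s0 (updr d j v s)"
  by (auto simp: frame_def)

lemma spec_digits:
  assumes pow: "arr s0 0 2 * arr s0 0 2 * E = 2 ^ L" and x: "0 \<le> rg d s0 2" "rg d s0 2 < 2 ^ L"
  shows "spec (\<lambda>s. s = s0) (digits d E)
    (\<lambda>s. frame d s0 s \<and> arr s 0 4 = arr s0 0 4 \<and> arr s 0 3 = arr s0 0 3 * 2 ^ L + nat \<lfloor>rg d s0 2\<rfloor>) (6 * L + 2)"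
proof -
  \<comment> \<open>Here \<open>t\<close> is the number formed by the \<open>j\<close> leading
    digits, register 3 holds it behind the shifted old content, and real register 2 holds the
    remainder. After \<open>L\<close> digits the remainder is below one, which makes
    \<open>t\<close> the floor.\<close>
  define J where "J = (\<lambda>j s. frame d s0 s \<and> arr s 0 4 = arr s0 0 4 \<and> rg d s 1 = 2 ^ (L - j) \<and>
    (\<exists>t. arr s 0 3 = arr s0 0 3 * 2 ^ j + t \<and> rg d s 2 = rg d s0 2 - real t * rg d s 1 \<and>
       0 \<le> rg d s 2 \<and> rg d s 2 < rg d s 1))"
  have step: "spec (J j)
     (Seq (setrreg d 1 (RDiv (rreg d 1) (RCast (NConst 2))))
         (Seq (setreg 3 (NAdd (reg 3) (reg 3)))
           (Cond (RLess (rreg d 2) (rreg d 1)) Skip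
             (Seq (setrreg d 2 (RSub (rreg d 2) (rreg d 1)))
               (setreg 3 (NAdd (reg 3) (NConst 1))))))) (J (Suc j)) 5" if j: "j < L" for j
  proof -
    define J1 where "J1 = (\<lambda>s. frame d s0 s \<and> arr s 0 4 = arr s0 0 4 \<and> rg d s 1 = 2 ^ (L - Suc j) \<and>
      (\<exists>t. arr s 0 3 = arr s0 0 3 * 2 ^ j + t \<and> rg d s 2 = rg d s0 2 - real t * (2 * rg d s 1) \<and>
       0 \<le> rg d s 2 \<and> rg d s 2 < 2 * rg d s 1))"
    define J2 where "J2 = (\<lambda>s. frame d s0 s \<and> arr s 0 4 = arr s0 0 4 \<and> rg d s 1 = 2 ^ (L - Suc j) \<and>
      (\<exists>t. arr s 0 3 = arr s0 0 3 * 2 ^ Suc j + 2 * t \<and> rg d s 2 = rg d s0 2 - real (2 * t) * rg d s 1 \<and>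
       0 \<le> rg d s 2 \<and> rg d s 2 < 2 * rg d s 1))"
    define J3 where "J3 = (\<lambda>s. frame d s0 s \<and> arr s 0 4 = arr s0 0 4 \<and> rg d s 1 = 2 ^ (L - Suc j) \<and>
      (\<exists>t. arr s 0 3 = arr s0 0 3 * 2 ^ Suc j + 2 * t \<and> rg d s 2 = rg d s0 2 - real (2 * t + 1) * rg d s 1 \<and>
       0 \<le> rg d s 2 \<and> rg d s 2 < rg d s 1))"
    have L: "L - j = Suc (L - Suc j)" using j by simp
    have 1: "spec (J j) (setrreg d 1 (RDiv (rreg d 1) (RCast (NConst 2)))) J1 1"
      by (rule spec_RAssign) (auto simp: J_def J1_def L)
    have 2: "spec J1 (setreg 3 (NAdd (reg 3) (reg 3))) J2 1"
    proof (rule spec_NAssign)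
      fix s assume "J1 s"
      then obtain t where t: "frame d s0 s" "arr s 0 4 = arr s0 0 4" "rg d s 1 = 2 ^ (L - Suc j)"
        "arr s 0 3 = arr s0 0 3 * 2 ^ j + t" "rg d s 2 = rg d s0 2 - real t * (2 * rg d s 1)"
        "0 \<le> rg d s 2" "rg d s 2 < 2 * rg d s 1"
        by (auto simp: J1_def)
      then show "J2 (nwrite (nval s (cell 0 (NConst 3))) (nval s (NAdd (reg 3) (reg 3))) s)"
        unfolding J2_def by (intro conjI exI[of _ t]) auto
    qed
    have 3: "spec (\<lambda>s. J2 s \<and> bval s (RLess (rreg d 2) (rreg d 1))) Skip (J (Suc j)) 2"
      by (rule spec_conseq[OF spec_Skip[of "\<lambda>s. J2 s \<and> bval s (RLess (rreg d 2) (rreg d 1))" "J (Suc j)"]])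
        (auto simp: J2_def J_def)
    have 4: "spec (\<lambda>s. J2 s \<and> \<not> bval s (RLess (rreg d 2) (rreg d 1))) (setrreg d 2 (RSub (rreg d 2) (rreg d 1))) J3 1"
      by (rule spec_RAssign) (auto simp: J2_def J3_def algebra_simps)
    have 5: "spec J3 (setreg 3 (NAdd (reg 3) (NConst 1))) (J (Suc j)) 1"
      by (rule spec_NAssign) (auto simp: J3_def J_def intro: exI[of _ "2 * t + 1" for t])
    show ?thesis
      using spec_Seq[OF 1 spec_Seq[OF 2 spec_Cond[OF 3, of _, OF spec_Seq[OF 4 5, simplified one_add_one]]]]
      by (rule spec_conseq) auto
  qed
  have loop: "spec (J 0) (While (RLess (RCast (NConst 1)) (rreg d 1))
       (Seq (setrreg d 1 (RDiv (rreg d 1) (RCast (NConst 2))))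
         (Seq (setreg 3 (NAdd (reg 3) (reg 3)))
           (Cond (RLess (rreg d 2) (rreg d 1)) Skip
             (Seq (setrreg d 2 (RSub (rreg d 2) (rreg d 1)))
               (setreg 3 (NAdd (reg 3) (NConst 1)))))))) (J L) (L * (5 + 1) + 1)"
  proof (rule spec_For[where J=J, OF step])
    fix j s assume "j \<le> L" "J j s"
    moreover have "(1::real) < 2 ^ k \<longleftrightarrow> 0 < k" for k by (cases "k = 0") (auto simp: one_less_power)
    ultimately show "bval s (RLess (RCast (NConst 1)) (rreg d 1)) \<longleftrightarrow> j < L"
      by (simp add: J_def)
  qed
  have init: "spec (\<lambda>s. s = s0) (setrreg d 1 (scale E)) (J 0) 1"
  proof (rule spec_RAssign)
    fix s assume "s = s0"
    moreover have "real (arr s0 0 2) * real (arr s0 0 2) * real E = 2 ^ L"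
      using arg_cong[OF pow, of real] by simp
    ultimately show "J 0 (rwrite (nval s (rcell d 1)) (rval s (scale E)) s)"
      using x by (simp add: J_def scale_def)
  qed
  show ?thesis
    unfolding digits_def
  proof (rule spec_conseq[OF spec_Seq[OF init loop]])
    fix s assume "J L s"
    then obtain t where J: "frame d s0 s" "arr s 0 4 = arr s0 0 4" "arr s 0 3 = arr s0 0 3 * 2 ^ L + t"
      "0 \<le> rg d s0 2 - real t" "rg d s0 2 - real t < 1"
      by (auto simp: J_def)
    then have "\<lfloor>rg d s0 2\<rfloor> = int t" by linarith
    then show "frame d s0 s \<and> arr s 0 4 = arr s0 0 4 \<and> arr s 0 3 = arr s0 0 3 * 2 ^ L + nat \<lfloor>rg d s0 2\<rfloor>"
      using J by simp
  qed auto
qed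

text \<open>Positional notation in base \<open>B\<close> whose leading part \<open>a\<close> may be
  arbitrarily large. A shell number can thus precede mere parity bits.\<close>

primrec code :: "nat \<Rightarrow> (nat \<Rightarrow> nat) \<Rightarrow> nat \<Rightarrow> nat \<Rightarrow> nat" where
  "code B f a 0 = a"
| "code B f a (Suc k) = code B f a k * B + f k"

lemma code_eqD:
  assumes "code B f a k = code B f' a' k" "\<And>l. l < k \<Longrightarrow> f l < B" "\<And>l. l < k \<Longrightarrow> f' l < B"
  shows "a = a' \<and> (\<forall>l<k. f l = f' l)"
  using assms
proof (induction k)
  case (Suc k)
  have lt: "f k < B" "f' k < B" using Suc.prems(2,3)[of k] by auto
  have eq: "code B f a k * B + f k = code B f' a' k * B + f' k" using Suc.prems(1) by simp
  have "f k = (code B f a k * B + f k) mod B" using lt by simp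
  also have "\<dots> = f' k" unfolding eq using lt by simp
  finally have "f k = f' k" .
  moreover from this eq lt have "code B f a k = code B f' a' k" by simp
  ultimately have "a = a' \<and> (\<forall>l<k. f l = f' l)" by (intro Suc.IH Suc.prems less_SucI)
  with \<open>f k = f' k\<close> show ?case by (simp add: All_less_Suc)
qed simp

lemma code_less:
  assumes "a < A" "\<And>l. l < k \<Longrightarrow> f l < B"
  shows "code B f a k < A * B ^ k"
  using assms
proof (induction k)
  case (Suc k)
  have "code B f a k + 1 \<le> A * B ^ k" using Suc by simp
  then have "(code B f a k + 1) * B \<le> A * B ^ k * B" by (rule mult_le_mono1)
  then show ?case using Suc.prems(2)[of k] by (simp add: algebra_simps)
qed simp

text \<open>The squared distance to the centre in units of \<open>(\<rho> / m)\<^sup>2\<close>;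
  rounding it down numbers the shells.\<close>

definition shell :: "nat \<Rightarrow> nat \<Rightarrow> real \<Rightarrow> (nat \<Rightarrow> nat \<Rightarrow> real) \<Rightarrow> nat \<Rightarrow> nat \<Rightarrow> real" where
  "shell d m \<rho> X c i = (\<Sum>l<d. (X i l - X c l) * (X i l - X c l)) * m * m / (\<rho> * \<rho>)"

text \<open>Position in units of \<open>\<rho> / m\<close>, measured from the lower face of the cube
  around point \<open>0\<close>; the offset \<open>\<rho>\<close> makes it nonnegative.\<close>

definition grid :: "nat \<Rightarrow> real \<Rightarrow> (nat \<Rightarrow> nat \<Rightarrow> real) \<Rightarrow> nat \<Rightarrow> nat \<Rightarrow> real" where
  "grid m \<rho> X i l = (X i l - X 0 l + \<rho>) * m / \<rho>"

definition shell_exp :: "nat \<Rightarrow> rexp" where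
  "shell_exp d = RDiv (RMul (RMul
      (rsum (\<lambda>l. RMul (RSub (coord d (reg 0) l) (coord d (reg 1) l))
                      (RSub (coord d (reg 0) l) (coord d (reg 1) l))) d)
      (RCast (reg 2))) (RCast (reg 2))) (RMul (rreg d 0) (rreg d 0))"

definition grid_exp :: "nat \<Rightarrow> nat \<Rightarrow> rexp" where
  "grid_exp d l = RDiv (RMul (RAdd (RSub (coord d (reg 0) l) (coord d (NConst 0) l)) (rreg d 0))
     (RCast (reg 2))) (rreg d 0)"

definition incr :: com where
  "incr = setreg 0 (NAdd (reg 0) (NConst 1))"

definition for_points :: "com \<Rightarrow> com" where
  "for_points c = Seq (setreg 0 (NConst 0)) (While (NLess (reg 0) (NRead (NConst 0))) (Seq c incr))"

text \<open>Register 3 collects the shell number and all cube numbers in full, register 4 the shell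
  number and only the parities of the cube numbers. The subtraction extracts the last bit of
  register 3.\<close>

definition encode :: "nat \<Rightarrow> nat \<Rightarrow> com" where
  "encode d E =
    Seq (setreg 3 (NConst 0)) (Seq (setrreg d 2 (shell_exp d)) (Seq (digits d E)
      (Seq (setreg 4 (reg 3))
        (seqs (\<lambda>l. Seq (setrreg d 2 (grid_exp d l)) (Seq (digits d E)
          (setreg 4 (NAdd (NAdd (reg 4) (reg 4))
                       (NSub (reg 3) (NAdd (NHalf (reg 3)) (NHalf (reg 3)))))))) d))))"

text \<open>Only table entries at occurring keys and groups are written. Leftovers of earlier trials
  sit elsewhere or are overwritten, and no table has to be cleared.\<close>

definition classify :: "nat \<Rightarrow> nat \<Rightarrow> com" where
  "classify d E = Seq (encode d E)
    (Seq (nput 1 (reg 0) (reg 3)) (Seq (nput 2 (reg 0) (reg 4))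
      (Seq (nput 3 (reg 3) (reg 0)) (nput 4 (reg 4) (NConst 0)))))"

definition tally :: com where
  "tally = Cond (neq (nget 3 (nget 1 (reg 0))) (reg 0))
     (Seq (nput 4 (nget 2 (reg 0)) (NAdd (nget 4 (nget 2 (reg 0))) (NConst 1)))
       (Cond (NLess (reg 5) (nget 4 (nget 2 (reg 0))))
         (Seq (setreg 5 (nget 4 (nget 2 (reg 0)))) (setreg 6 (nget 2 (reg 0))))
         Skip))
     Skip"

definition trial :: "nat \<Rightarrow> nat \<Rightarrow> com" where
  "trial d E = Seq (for_points (classify d E)) (Seq (setreg 5 (NConst 0)) (for_points tally))"

definition emit :: com where
  "emit = Cond (BAnd (neq (nget 2 (reg 0)) (reg 6)) (neq (nget 3 (nget 1 (reg 0))) (reg 0)))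
     (Seq (setreg 7 (NAdd (reg 7) (NConst 1))) (NAssign (reg 7) (reg 0)))
     Skip"

text \<open>Cell \<open>0\<close> is overwritten last, since every array and register address is
  relative to its content.\<close>

definition print_best :: com where
  "print_best = Seq (setreg 7 (NConst 0)) (Seq (for_points emit) (NAssign (NConst 0) (reg 7)))"

text \<open>The resolution \<open>m\<close> is the least power of two with
  \<open>n \<le> m ^ (d + 1)\<close>. Being a power of two, it gives \<open>digits\<close> a power
  of two to start from.\<close>

definition setup_grid :: "nat \<Rightarrow> com" where
  "setup_grid d = Seq (setreg 2 (NConst 1))
     (While (RLess (rpow (RCast (reg 2)) (d + 1)) (RCast (NRead (NConst 0)))) (setreg 2 (NAdd (reg 2) (reg 2))))"

definition enlarge_radius :: "nat \<Rightarrow> rexp \<Rightarrow> com" where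
  "enlarge_radius d e = Cond (RLess (rreg d 0) e) (setrreg d 0 e) Skip"

definition setup_radius :: "nat \<Rightarrow> com" where
  "setup_radius d = Seq (setrreg d 0 (RCast (NConst 0)))
     (for_points (seqs (\<lambda>l.
        Seq (enlarge_radius d (RSub (coord d (reg 0) l) (coord d (NConst 0) l)))
            (enlarge_radius d (RSub (coord d (NConst 0) l) (coord d (reg 0) l)))) d))"

text \<open>\<open>E\<close> is headroom that makes \<open>m * m * E\<close> exceed all shell and
  cube numbers. \<open>C\<close> belongs to the acceptance test: the search stops once the best
  group has at least \<open>n / (m * m * C)\<close> points.\<close>

definition algorithm :: "nat \<Rightarrow> nat \<Rightarrow> nat \<Rightarrow> com" where
  "algorithm d E C = Seq (setup_grid d) (Seq (setup_radius d) (Seq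
     (While (RLess (RMul (scale C) (RCast (reg 5))) (RCast (NRead (NConst 0))))
       (Seq (Random (cell 0 (NConst 1)) (NSub (NRead (NConst 0)) (NConst 1))) (trial d E)))
     print_best))"

lemma spec_for_points:
  assumes "\<And>i. i < n \<Longrightarrow> spec (\<lambda>s. J i s \<and> nmem s 0 = n \<and> arr s 0 0 = i) c (\<lambda>s. J (Suc i) s \<and> nmem s 0 = n \<and> arr s 0 0 = i) T"
    and J: "\<And>i s v. J i s \<Longrightarrow> J i (upd 0 0 v s)"
  shows "spec (\<lambda>s. J 0 s \<and> nmem s 0 = n) (for_points c) (\<lambda>s. J n s \<and> nmem s 0 = n) (n * (T + 2) + 2)"
proof -
  let ?I = "\<lambda>i s. J i s \<and> nmem s 0 = n \<and> arr s 0 0 = i"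
  have "spec (?I 0) (While (NLess (reg 0) (NRead (NConst 0))) (Seq c incr)) (?I n) (n * ((T + 1) + 1) + 1)"
  proof (rule spec_For)
    fix i assume "i < n"
    have "spec (\<lambda>s. J (Suc i) s \<and> nmem s 0 = n \<and> arr s 0 0 = i) incr (?I (Suc i)) 1"
      unfolding incr_def by (rule spec_NAssign) (auto intro: J)
    with assms(1)[OF \<open>i < n\<close>] show "spec (?I i) (Seq c incr) (?I (Suc i)) (T + 1)"
      by (rule spec_Seq)
  qed auto
  moreover have "spec (\<lambda>s. J 0 s \<and> nmem s 0 = n) (setreg 0 (NConst 0)) (?I 0) 1"
    by (rule spec_NAssign) (auto intro: J)
  ultimately have "spec (\<lambda>s. J 0 s \<and> nmem s 0 = n) (for_points c) (?I n) (1 + (n * ((T + 1) + 1) + 1))"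
    unfolding for_points_def by (intro spec_Seq)
  then show ?thesis by (rule spec_conseq) auto
qed

section \<open>One trial on a fixed grid\<close>

locale grid_run =
  fixes d n m E L C :: nat and \<rho> :: real and X :: "nat \<Rightarrow> nat \<Rightarrow> real"
  assumes pow: "m * m * E = 2 ^ L" and L: "L \<ge> 1"
    and shell_range: "\<And>c i. c < n \<Longrightarrow> i < n \<Longrightarrow> 0 \<le> shell d m \<rho> X c i \<and> shell d m \<rho> X c i < 2 ^ L"
    and grid_range: "\<And>i l. i < n \<Longrightarrow> l < d \<Longrightarrow> 0 \<le> grid m \<rho> X i l \<and> grid m \<rho> X i l < 2 ^ L"
begin

definition sh :: "nat \<Rightarrow> nat \<Rightarrow> nat" where "sh c i = nat \<lfloor>shell d m \<rho> X c i\<rfloor>"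
definition gr :: "nat \<Rightarrow> nat \<Rightarrow> nat" where "gr i l = nat \<lfloor>grid m \<rho> X i l\<rfloor>"
definition key :: "nat \<Rightarrow> nat \<Rightarrow> nat" where "key c i = code (2 ^ L) (gr i) (sh c i) d"
definition grp :: "nat \<Rightarrow> nat \<Rightarrow> nat" where "grp c i = code 2 (\<lambda>l. gr i l mod 2) (sh c i) d"

definition base :: "state \<Rightarrow> bool" where
  "base s \<longleftrightarrow> nmem s 0 = n \<and> (\<forall>i<n. \<forall>l<d. cx d s i l = X i l) \<and> arr s 0 2 = m \<and> rg d s 0 = \<rho>"

lemma base_frame: "frame d s0 s \<Longrightarrow> base s0 \<Longrightarrow> base s"
  by (auto simp: base_def frame_def)

lemma base_upd[simp]: "r < 5 \<Longrightarrow> (r, x) \<noteq> (0, 2) \<Longrightarrow> base (upd r x v s) \<longleftrightarrow> base s"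
  by (auto simp: base_def)

lemma base_updr[simp]: "j \<noteq> 0 \<Longrightarrow> base (updr d j v s) \<longleftrightarrow> base s"
  by (auto simp: base_def)

text \<open>The entry of array 3 is pinned down only up to its key: any point processed so far that
  has this key may represent it.\<close>

definition classified :: "nat \<Rightarrow> nat \<Rightarrow> state \<Rightarrow> bool" where
  "classified c i s \<longleftrightarrow> base s \<and> arr s 0 1 = c \<and>
     (\<forall>j<i. arr s 1 j = key c j \<and> arr s 2 j = grp c j \<and> arr s 4 (grp c j) = 0 \<and>
        arr s 3 (key c j) < i \<and> key c (arr s 3 (key c j)) = key c j)"

lemma classified_frame: "frame d s0 s \<Longrightarrow> classified c i s0 \<Longrightarrow> classified c i s"
  using base_frame[of s0 s] by (auto simp: classified_def frame_arr)

definition encoding :: "nat \<Rightarrow> nat \<Rightarrow> nat \<Rightarrow> state \<Rightarrow> bool" where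
  "encoding c i k s \<longleftrightarrow> classified c i s \<and> arr s 0 0 = i \<and>
     arr s 0 3 = code (2 ^ L) (gr i) (sh c i) k \<and> arr s 0 4 = code 2 (\<lambda>l. gr i l mod 2) (sh c i) k"

lemma classified_simps[simp]:
  "x \<in> {0, 3, 4, 5, 6, 7} \<Longrightarrow> classified c i (upd 0 x v s) \<longleftrightarrow> classified c i s"
  "j \<noteq> 0 \<Longrightarrow> classified c i (updr d j w s) \<longleftrightarrow> classified c i s"
  by (auto simp: classified_def)

lemma spec_digits_framed:
  assumes "\<And>s0 s. frame d s0 s \<Longrightarrow> R s0 \<Longrightarrow> R s" "\<And>s. R s \<Longrightarrow> base s" "0 \<le> y" "y < 2 ^ L"
  shows "spec (\<lambda>s. R s \<and> rg d s 2 = y \<and> arr s 0 3 = a \<and> arr s 0 4 = b) (digits d E)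
     (\<lambda>s. R s \<and> arr s 0 3 = a * 2 ^ L + nat \<lfloor>y\<rfloor> \<and> arr s 0 4 = b) (6 * L + 2)"
proof (rule spec_pointwise[OF spec_digits], goal_cases)
  case (1 s0)
  then have "arr s0 0 2 = m" using assms(2) by (auto simp: base_def)
  then show ?case using pow by simp
next
  case (4 s0 s)
  then show ?case using assms(1)[of s0 s] by auto
qed (use assms in auto)

lemma rval_shell_exp:
  assumes "base s" "arr s 0 0 < n" "arr s 0 1 < n"
  shows "rval s (shell_exp d) = shell d m \<rho> X (arr s 0 1) (arr s 0 0)"
  using assms by (auto simp: shell_exp_def shell_def base_def)

lemma rval_grid_exp:
  assumes "base s" "arr s 0 0 < n" "l < d"
  shows "rval s (grid_exp d l) = grid m \<rho> X (arr s 0 0) l"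
  using assms by (auto simp: grid_exp_def grid_def base_def)

lemma spec_encode:
  assumes "i < n" "c < n"
  shows "spec (\<lambda>s. classified c i s \<and> arr s 0 0 = i) (encode d E) (encoding c i d) (6 * L + d * (6 * L + 4) + 6)"
proof -
  let ?R = "\<lambda>s. classified c i s \<and> arr s 0 0 = i"
  have R: "?R s" if "frame d s0 s" "?R s0" for s0 s
    using that classified_frame by (auto simp: frame_arr)
  have Rb: "base s" if "?R s" for s using that by (simp add: classified_def)
  have 1: "spec ?R (setreg 3 (NConst 0)) (\<lambda>s. ?R s \<and> arr s 0 3 = 0) 1"
    by (rule spec_NAssign) auto
  have 2: "spec (\<lambda>s. ?R s \<and> arr s 0 3 = 0) (setrreg d 2 (shell_exp d)) (\<lambda>s. ?R s \<and> rg d s 2 = shell d m \<rho> X c i \<and> arr s 0 3 = 0) 1"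
  proof (rule spec_RAssign)
    fix s assume s: "?R s \<and> arr s 0 3 = 0"
    then have "rval s (shell_exp d) = shell d m \<rho> X c i"
      using rval_shell_exp[of s] assms by (auto simp: classified_def)
    then show "?R (rwrite (nval s (rcell d 2)) (rval s (shell_exp d)) s) \<and>
       rg d (rwrite (nval s (rcell d 2)) (rval s (shell_exp d)) s) 2 = shell d m \<rho> X c i \<and>
       arr (rwrite (nval s (rcell d 2)) (rval s (shell_exp d)) s) 0 3 = 0"
      using s by simp
  qed
  have 3: "spec (\<lambda>s. ?R s \<and> rg d s 2 = shell d m \<rho> X c i \<and> arr s 0 3 = 0) (digits d E)
      (\<lambda>s. ?R s \<and> arr s 0 3 = sh c i) (6 * L + 2)"
    by (rule spec_conseq[OF spec_ex[OF spec_digits_framed[where R="?R" and y="shell d m \<rho> X c i" and a=0]]])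
      (use R Rb shell_range assms in \<open>auto simp: sh_def\<close>)
  have 4: "spec (\<lambda>s. ?R s \<and> arr s 0 3 = sh c i) (setreg 4 (reg 3)) (encoding c i 0) 1"
    by (rule spec_NAssign) (auto simp: encoding_def)
  have 5: "spec (encoding c i l) (Seq (setrreg d 2 (grid_exp d l)) (Seq (digits d E)
          (setreg 4 (NAdd (NAdd (reg 4) (reg 4))
                       (NSub (reg 3) (NAdd (NHalf (reg 3)) (NHalf (reg 3)))))))) (encoding c i (Suc l)) (6 * L + 4)"
    if l: "l < d" for l
  proof -
    let ?a = "code (2 ^ L) (gr i) (sh c i) l" and ?b = "code 2 (\<lambda>l. gr i l mod 2) (sh c i) l"
    let ?y = "grid m \<rho> X i l"
    have 1: "spec (encoding c i l) (setrreg d 2 (grid_exp d l)) (\<lambda>s. ?R s \<and> rg d s 2 = ?y \<and> arr s 0 3 = ?a \<and> arr s 0 4 = ?b) 1"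
    proof (rule spec_RAssign)
      fix s assume s: "encoding c i l s"
      then have "rval s (grid_exp d l) = ?y"
        using rval_grid_exp[of s] assms l by (auto simp: classified_def encoding_def)
      then show "?R (rwrite (nval s (rcell d 2)) (rval s (grid_exp d l)) s) \<and>
       rg d (rwrite (nval s (rcell d 2)) (rval s (grid_exp d l)) s) 2 = ?y \<and>
       arr (rwrite (nval s (rcell d 2)) (rval s (grid_exp d l)) s) 0 3 = ?a \<and>
       arr (rwrite (nval s (rcell d 2)) (rval s (grid_exp d l)) s) 0 4 = ?b"
        using s by (simp add: encoding_def)
    qed
    have 2: "spec (\<lambda>s. ?R s \<and> rg d s 2 = ?y \<and> arr s 0 3 = ?a \<and> arr s 0 4 = ?b) (digits d E)
       (\<lambda>s. ?R s \<and> arr s 0 3 = ?a * 2 ^ L + nat \<lfloor>?y\<rfloor> \<and> arr s 0 4 = ?b) (6 * L + 2)"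
      by (rule spec_digits_framed) (use R Rb grid_range assms l in auto)
    have 3: "spec (\<lambda>s. ?R s \<and> arr s 0 3 = ?a * 2 ^ L + nat \<lfloor>?y\<rfloor> \<and> arr s 0 4 = ?b)
       (setreg 4 (NAdd (NAdd (reg 4) (reg 4)) (NSub (reg 3) (NAdd (NHalf (reg 3)) (NHalf (reg 3))))))
       (encoding c i (Suc l)) 1"
    proof (rule spec_NAssign)
      fix s assume s: "?R s \<and> arr s 0 3 = ?a * 2 ^ L + nat \<lfloor>?y\<rfloor> \<and> arr s 0 4 = ?b"
      \<comment> \<open>The earlier digits contribute a multiple of \<open>2 ^ L\<close>, which is
        even as \<open>L \<ge> 1\<close>, so the last bit belongs to the newest cube number.\<close>
      have "(?a * 2 ^ L + gr i l) mod 2 = gr i l mod 2"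
      proof -
        have "?a * 2 ^ L = 2 * (?a * 2 ^ (L - 1))" using L by (simp add: power_eq_if)
        then show ?thesis by (simp only: mod_mult_self4)
      qed
      moreover have "k - (k div 2 + k div 2) = k mod 2" for k :: nat by presburger
      ultimately show "encoding c i (Suc l) (nwrite (nval s (cell 0 (NConst 4)))
         (nval s (NAdd (NAdd (reg 4) (reg 4)) (NSub (reg 3) (NAdd (NHalf (reg 3)) (NHalf (reg 3)))))) s)"
        using s by (simp add: encoding_def gr_def[symmetric])
    qed
    show ?thesis using spec_Seq[OF 1 spec_Seq[OF 2 3]] by (rule spec_conseq) auto
  qed
  show ?thesis
    unfolding encode_def
    using spec_Seq[OF 1 spec_Seq[OF 2 spec_Seq[OF 3 spec_Seq[OF 4 spec_seqs[where J="encoding c i", OF 5]]]]]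
    by (rule spec_conseq) auto
qed

lemma spec_classify:
  assumes "i < n" "c < n"
  shows "spec (\<lambda>s. classified c i s \<and> arr s 0 0 = i) (classify d E) (\<lambda>s. classified c (Suc i) s \<and> arr s 0 0 = i)
    (6 * L + d * (6 * L + 4) + 10)"
proof -
  define P1 where "P1 s \<longleftrightarrow> classified c i s \<and> arr s 0 0 = i \<and> arr s 0 3 = key c i \<and> arr s 0 4 = grp c i" for s
  define P2 where "P2 s \<longleftrightarrow> P1 s \<and> arr s 1 i = key c i" for s
  define P3 where "P3 s \<longleftrightarrow> P2 s \<and> arr s 2 i = grp c i" for s
  define P4 where "P4 s \<longleftrightarrow> base s \<and> arr s 0 1 = c \<and> arr s 0 0 = i \<and> arr s 0 4 = grp c i \<and>
     (\<forall>j<Suc i. arr s 1 j = key c j \<and> arr s 2 j = grp c j \<and> (j < i \<longrightarrow> arr s 4 (grp c j) = 0) \<and>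
        arr s 3 (key c j) < Suc i \<and> key c (arr s 3 (key c j)) = key c j)" for s
  have 0: "spec (\<lambda>s. classified c i s \<and> arr s 0 0 = i) (encode d E) P1 (6 * L + d * (6 * L + 4) + 6)"
    by (rule spec_conseq[OF spec_encode[OF assms]]) (auto simp: encoding_def P1_def key_def grp_def)
  have 1: "spec P1 (nput 1 (reg 0) (reg 3)) P2 1"
    by (rule spec_NAssign) (auto simp: P1_def P2_def classified_def)
  have 2: "spec P2 (nput 2 (reg 0) (reg 4)) P3 1"
    by (rule spec_NAssign) (auto simp: P1_def P2_def P3_def classified_def)
  have 3: "spec P3 (nput 3 (reg 3) (reg 0)) P4 1"
    by (rule spec_NAssign) (auto simp: P1_def P2_def P3_def P4_def classified_def less_Suc_eq)
  have 4: "spec P4 (nput 4 (reg 4) (NConst 0)) (\<lambda>s. classified c (Suc i) s \<and> arr s 0 0 = i) 1"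
    by (rule spec_NAssign) (auto simp: P4_def classified_def less_Suc_eq)
  show ?thesis
    unfolding classify_def using spec_Seq[OF 0 spec_Seq[OF 1 spec_Seq[OF 2 spec_Seq[OF 3 4]]]]
    by (rule spec_conseq) auto
qed

text \<open>\<open>M\<close> sends an index to the representative of its key, so the condition
  \<open>M j = j\<close> says that \<open>j\<close> is itself a chosen point.\<close>

definition selected :: "nat \<Rightarrow> (nat \<Rightarrow> nat) \<Rightarrow> nat \<Rightarrow> nat \<Rightarrow> nat set" where
  "selected c M g i = {j. j < i \<and> M j = j \<and> grp c j = g}"

definition representatives :: "nat \<Rightarrow> (nat \<Rightarrow> nat) \<Rightarrow> bool" where
  "representatives c M \<longleftrightarrow> (\<forall>j<n. M j < n \<and> key c (M j) = key c j) \<and>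
     (\<forall>i<n. \<forall>j<n. key c i = key c j \<longrightarrow> M i = M j)"

definition indexed :: "nat \<Rightarrow> (nat \<Rightarrow> nat) \<Rightarrow> state \<Rightarrow> bool" where
  "indexed c M s \<longleftrightarrow> base s \<and> c < n \<and> representatives c M \<and>
     (\<forall>j<n. arr s 1 j = key c j \<and> arr s 2 j = grp c j \<and> arr s 3 (key c j) = M j)"

text \<open>Register 5 is an upper bound for all group counts that is attained by register 6. At the
  start this holds for any value left over in register 6, because nothing is selected yet.\<close>

definition tallied :: "nat \<Rightarrow> (nat \<Rightarrow> nat) \<Rightarrow> nat \<Rightarrow> state \<Rightarrow> bool" where
  "tallied c M i s \<longleftrightarrow> indexed c M s \<and>
     (\<forall>j<n. arr s 4 (grp c j) = card (selected c M (grp c j) i) \<and> card (selected c M (grp c j) i) \<le> arr s 0 5) \<and>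
     arr s 0 5 = card (selected c M (arr s 0 6) i)"

lemma selected_Suc: "selected c M g (Suc i) = (if M i = i \<and> grp c i = g then insert i (selected c M g i) else selected c M g i)"
  by (auto simp: selected_def less_Suc_eq)

lemma finite_selected[simp]: "finite (selected c M g i)" "i \<notin> selected c M g i"
  by (auto simp: selected_def)

lemma indexed_simps[simp]:
  "x \<in> {0, 3, 4, 5, 6, 7} \<Longrightarrow> indexed c M (upd 0 x v s) \<longleftrightarrow> indexed c M s"
  "indexed c M (upd 4 y v s) \<longleftrightarrow> indexed c M s"
  by (auto simp: indexed_def)

lemma tallied_simps[simp]: "tallied c M i (upd 0 0 v s) \<longleftrightarrow> tallied c M i s"
  by (auto simp: tallied_def)

lemma spec_tally:
  assumes i: "i < n"
  shows "spec (\<lambda>s. tallied c M i s \<and> nmem s 0 = n \<and> arr s 0 0 = i) tally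
    (\<lambda>s. tallied c M (Suc i) s \<and> nmem s 0 = n \<and> arr s 0 0 = i) 5"
proof -
  let ?b = "neq (nget 3 (nget 1 (reg 0))) (reg 0)"
  let ?P = "\<lambda>s. tallied c M i s \<and> nmem s 0 = n \<and> arr s 0 0 = i"
  let ?Q = "\<lambda>s. tallied c M (Suc i) s \<and> nmem s 0 = n \<and> arr s 0 0 = i"
  have b: "bval s ?b \<longleftrightarrow> M i = i" if "?P s" for s
    using that i by (auto simp: tallied_def indexed_def)
  define P1 where "P1 s \<longleftrightarrow> indexed c M s \<and> nmem s 0 = n \<and> arr s 0 0 = i \<and> M i = i \<and>
    (\<forall>j<n. arr s 4 (grp c j) = card (selected c M (grp c j) (Suc i)) \<and>
       (grp c j \<noteq> grp c i \<longrightarrow> card (selected c M (grp c j) (Suc i)) \<le> arr s 0 5)) \<and>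
     arr s 0 5 = card (selected c M (arr s 0 6) i) \<and> arr s 4 (grp c i) \<le> Suc (arr s 0 5)" for s
  define P2 where "P2 s \<longleftrightarrow> indexed c M s \<and> nmem s 0 = n \<and> arr s 0 0 = i \<and>
    (\<forall>j<n. arr s 4 (grp c j) = card (selected c M (grp c j) (Suc i)) \<and>
       card (selected c M (grp c j) (Suc i)) \<le> arr s 0 5) \<and>
     arr s 0 5 = card (selected c M (grp c i) (Suc i))" for s
  have 1: "spec (\<lambda>s. ?P s \<and> bval s ?b) (nput 4 (nget 2 (reg 0)) (NAdd (nget 4 (nget 2 (reg 0))) (NConst 1))) P1 1"
  proof (rule spec_NAssign)
    fix s assume "?P s \<and> bval s ?b"
    with b[of s] have s: "?P s" "M i = i" by auto
    then have g: "arr s 2 i = grp c i" using i by (auto simp: tallied_def indexed_def)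
    show "P1 (nwrite (nval s (cell 4 (nget 2 (reg 0)))) (nval s (NAdd (nget 4 (nget 2 (reg 0))) (NConst 1))) s)"
      using s i g by (auto simp: P1_def tallied_def selected_Suc)
  qed
  have 2: "spec (\<lambda>s. P1 s \<and> bval s (NLess (reg 5) (nget 4 (nget 2 (reg 0))))) (setreg 5 (nget 4 (nget 2 (reg 0)))) P2 1"
  proof (rule spec_NAssign)
    fix s assume s: "P1 s \<and> bval s (NLess (reg 5) (nget 4 (nget 2 (reg 0))))"
    then have g: "arr s 2 i = grp c i" using i by (auto simp: P1_def indexed_def)
    have lt: "arr s 0 5 < arr s 4 (grp c i)" using s g by (auto simp: P1_def)
    have "card (selected c M (grp c j) (Suc i)) \<le> arr s 4 (grp c i)" if "j < n" for j
      using s that i lt by (cases "grp c j = grp c i") (fastforce simp: P1_def)+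
    then show "P2 (nwrite (nval s (cell 0 (NConst 5))) (nval s (nget 4 (nget 2 (reg 0)))) s)"
      using s i g by (auto simp: P1_def P2_def)
  qed
  have 3: "spec P2 (setreg 6 (nget 2 (reg 0))) ?Q 1"
  proof (rule spec_NAssign)
    fix s assume s: "P2 s"
    then have g: "arr s 2 i = grp c i" using i by (auto simp: P2_def indexed_def)
    show "?Q (nwrite (nval s (cell 0 (NConst 6))) (nval s (nget 2 (reg 0))) s)"
      using s i g by (auto simp: P2_def tallied_def)
  qed
  have 4: "spec (\<lambda>s. P1 s \<and> \<not> bval s (NLess (reg 5) (nget 4 (nget 2 (reg 0))))) Skip ?Q 2"
  proof (rule spec_conseq[OF spec_Skip[of "\<lambda>s. P1 s \<and> \<not> bval s (NLess (reg 5) (nget 4 (nget 2 (reg 0))))" ?Q]])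
    fix s assume s: "P1 s \<and> \<not> bval s (NLess (reg 5) (nget 4 (nget 2 (reg 0))))"
    then have g: "arr s 2 i = grp c i" using i by (auto simp: P1_def indexed_def)
    have le: "arr s 4 (grp c i) \<le> arr s 0 5" using s g by (auto simp: P1_def)
    have all: "card (selected c M (grp c j) (Suc i)) \<le> arr s 0 5" if "j < n" for j
      using s that i le by (cases "grp c j = grp c i") (fastforce simp: P1_def)+
    \<comment> \<open>Were the group of \<open>i\<close> the recorded best one, its counter would
      just have overtaken the best count.\<close>
    have "arr s 0 6 \<noteq> grp c i"
    proof
      assume "arr s 0 6 = grp c i"
      then have "arr s 4 (grp c i) = Suc (arr s 0 5)" using s i by (auto simp: P1_def selected_Suc)
      then show False using le by simp
    qed
    then show "?Q s" using s all by (auto simp: P1_def tallied_def selected_Suc)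
  qed auto
  have 5: "spec (\<lambda>s. ?P s \<and> \<not> bval s ?b) Skip ?Q 4"
  proof (rule spec_conseq[OF spec_Skip[of "\<lambda>s. ?P s \<and> \<not> bval s ?b" ?Q]])
    fix s assume "?P s \<and> \<not> bval s ?b"
    with b[of s] have s: "?P s" "M i \<noteq> i" by auto
    then show "?Q s" by (auto simp: tallied_def selected_Suc)
  qed auto
  have 6: "spec P1 (Cond (NLess (reg 5) (nget 4 (nget 2 (reg 0))))
         (Seq (setreg 5 (nget 4 (nget 2 (reg 0)))) (setreg 6 (nget 2 (reg 0)))) Skip) ?Q 3"
    using spec_Cond[OF _ 4, of _] spec_Seq[OF 2 3] by (simp add: numeral_eq_Suc)
  show ?thesis unfolding tally_def
    using spec_Cond[OF _ 5, of _] spec_Seq[OF 1 6] by (simp add: numeral_eq_Suc)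
qed

definition trial_time :: nat where
  "trial_time = n * (6 * L + d * (6 * L + 4) + 12) + 2 + 1 + (n * 7 + 2)"

lemma spec_trial:
  assumes c: "c < n"
  shows "spec (\<lambda>s. base s \<and> arr s 0 1 = c) (trial d E) (\<lambda>s. \<exists>M. tallied c M n s) trial_time"
proof -
  have 1: "spec (\<lambda>s. base s \<and> arr s 0 1 = c) (for_points (classify d E)) (\<lambda>s. classified c n s)
     (n * (6 * L + d * (6 * L + 4) + 12) + 2)"
  proof (rule spec_conseq[OF spec_for_points[where J="classified c"]])
    fix i assume "i < n"
    show "spec (\<lambda>s. classified c i s \<and> nmem s 0 = n \<and> arr s 0 0 = i) (classify d E)
      (\<lambda>s. classified c (Suc i) s \<and> nmem s 0 = n \<and> arr s 0 0 = i) (6 * L + d * (6 * L + 4) + 10)"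
      by (rule spec_conseq[OF spec_classify[OF \<open>i < n\<close> c]]) (auto simp: classified_def base_def)
  qed (auto simp: classified_def base_def)
  have 2: "spec (\<lambda>s. classified c n s) (setreg 5 (NConst 0)) (\<lambda>s. \<exists>M. tallied c M 0 s \<and> nmem s 0 = n) 1"
  proof (rule spec_NAssign)
    fix s assume s: "classified c n s"
    \<comment> \<open>Classification is complete, and the content of array 3 is frozen as the choice
      of representatives.\<close>
    define M where "M j = arr s 3 (key c j)" for j
    have "tallied c M 0 (upd 0 5 0 s)"
      using s c by (auto simp: tallied_def indexed_def representatives_def classified_def selected_def M_def)
    then show "\<exists>M. tallied c M 0 (nwrite (nval s (cell 0 (NConst 5))) (nval s (NConst 0)) s) \<and>
        nmem (nwrite (nval s (cell 0 (NConst 5))) (nval s (NConst 0)) s) 0 = n"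
      using s by (auto simp: classified_def base_def)
  qed
  have 3: "spec (\<lambda>s. \<exists>M. tallied c M 0 s \<and> nmem s 0 = n) (for_points tally) (\<lambda>s. \<exists>M. tallied c M n s \<and> nmem s 0 = n) (n * (5 + 2) + 2)"
    by (rule spec_ex, rule spec_for_points[OF spec_tally]) auto
  show ?thesis
    unfolding trial_def
    using spec_Seq[OF 1 spec_Seq[OF 2 3]]
    by (rule spec_conseq) (auto simp: trial_time_def)
qed

end

section \<open>Output and initialisation\<close>

lemma nwrite_output_simps[simp]:
  "0 < k \<Longrightarrow> rg d (nwrite k v s) = rg d s" "cx d (nwrite k v s) = cx d s"
  by (auto simp: nwrite_def rg_def cx_def fun_eq_iff)

lemma nmem_nwrite: "nmem (nwrite k v s) x = (if x = k then v else nmem s x)"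
  by (simp add: nwrite_def)

section \<open>Writing out the best group, and the search loop\<close>

context grid_run
begin

lemma indexed_nwrite[simp]: "0 < k \<Longrightarrow> k \<le> n \<Longrightarrow> indexed c M (nwrite k v s) \<longleftrightarrow> indexed c M s"
  using arr_nwrite_output[of k s v] by (auto simp: indexed_def base_def)

text \<open>The bound of register 7 by \<open>i\<close> confines the output to the cells
  \<open>1\<close> to \<open>n\<close>, below all arrays.\<close>

definition emitted :: "nat \<Rightarrow> (nat \<Rightarrow> nat) \<Rightarrow> nat \<Rightarrow> nat \<Rightarrow> state \<Rightarrow> bool" where
  "emitted c M g i s \<longleftrightarrow> indexed c M s \<and> i \<le> n \<and> arr s 0 6 = g \<and> arr s 0 7 \<le> i \<and>
     nmem s ` {1..arr s 0 7} = selected c M g i"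

lemma emitted_upd[simp]: "emitted c M g i s \<Longrightarrow> emitted c M g i (upd 0 0 v s)"
proof -
  assume e: "emitted c M g i s"
  then have "nmem s 0 = n" by (simp add: emitted_def indexed_def base_def)
  then have "nmem (upd 0 0 v s) ` {1..arr s 0 7} = nmem s ` {1..arr s 0 7}"
    using e by (intro image_cong) (auto simp: emitted_def)
  with e show ?thesis by (simp add: emitted_def)
qed

lemma spec_emit:
  assumes i: "i < n"
  shows "spec (\<lambda>s. emitted c M g i s \<and> nmem s 0 = n \<and> arr s 0 0 = i) emit
    (\<lambda>s. emitted c M g (Suc i) s \<and> nmem s 0 = n \<and> arr s 0 0 = i) 3"
proof -
  let ?b = "BAnd (neq (nget 2 (reg 0)) (reg 6)) (neq (nget 3 (nget 1 (reg 0))) (reg 0))"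
  let ?P = "\<lambda>s. emitted c M g i s \<and> nmem s 0 = n \<and> arr s 0 0 = i"
  let ?Q = "\<lambda>s. emitted c M g (Suc i) s \<and> nmem s 0 = n \<and> arr s 0 0 = i"
  have b: "bval s ?b \<longleftrightarrow> grp c i = g \<and> M i = i" if "?P s" for s
    using that i by (auto simp: emitted_def indexed_def)
  define P1 where "P1 s \<longleftrightarrow> indexed c M s \<and> nmem s 0 = n \<and> arr s 0 0 = i \<and> grp c i = g \<and> M i = i \<and> arr s 0 6 = g \<and>
     (\<exists>k\<le>i. arr s 0 7 = Suc k \<and> nmem s ` {1..k} = selected c M g i)" for s
  have 1: "spec (\<lambda>s. ?P s \<and> bval s ?b) (setreg 7 (NAdd (reg 7) (NConst 1))) P1 1"
  proof (rule spec_NAssign)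
    fix s assume "?P s \<and> bval s ?b"
    with b[of s] have s: "?P s" "M i = i" "grp c i = g" by auto
    have "nmem (upd 0 7 (Suc (arr s 0 7)) s) ` {1..arr s 0 7} = nmem s ` {1..arr s 0 7}"
      using s i by (intro image_cong) (auto simp: emitted_def)
    then show "P1 (nwrite (nval s (cell 0 (NConst 7))) (nval s (NAdd (reg 7) (NConst 1))) s)"
      using s by (auto simp: P1_def emitted_def)
  qed
  have 2: "spec P1 (NAssign (reg 7) (reg 0)) ?Q 1"
  proof (rule spec_NAssign)
    fix s assume s: "P1 s"
    then obtain k where k: "k \<le> i" "arr s 0 7 = Suc k" "nmem s ` {1..k} = selected c M g i"
      by (auto simp: P1_def)
    have "nmem (nwrite (Suc k) i s) ` {1..Suc k} = insert i (nmem s ` {1..k})"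
      by (auto simp: nmem_nwrite atLeastAtMostSuc_conv)
    then show "?Q (nwrite (nval s (reg 7)) (nval s (reg 0)) s)"
      using s k i by (auto simp: P1_def emitted_def selected_Suc)
  qed
  have 3: "spec (\<lambda>s. ?P s \<and> \<not> bval s ?b) Skip ?Q 2"
  proof (rule spec_conseq[OF spec_Skip[of "\<lambda>s. ?P s \<and> \<not> bval s ?b" ?Q]])
    fix s assume "?P s \<and> \<not> bval s ?b"
    with b[of s] have s: "?P s" "\<not> (grp c i = g \<and> M i = i)" by auto
    then show "?Q s" using i by (auto simp: emitted_def selected_Suc)
  qed auto
  show ?thesis unfolding emit_def
    using spec_Cond[OF _ 3, of _] spec_Seq[OF 1 2] by (simp add: numeral_eq_Suc)
qed

lemma spec_print_best:
  "spec (\<lambda>s. tallied c M n s \<and> arr s 0 6 = g) print_best (\<lambda>s. output_indices s = selected c M g n) (n * 5 + 4)"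
proof -
  have 1: "spec (\<lambda>s. tallied c M n s \<and> arr s 0 6 = g) (setreg 7 (NConst 0)) (\<lambda>s. emitted c M g 0 s \<and> nmem s 0 = n) 1"
    by (rule spec_NAssign) (auto simp: tallied_def emitted_def selected_def indexed_def base_def)
  have 2: "spec (\<lambda>s. emitted c M g 0 s \<and> nmem s 0 = n) (for_points emit) (\<lambda>s. emitted c M g n s \<and> nmem s 0 = n) (n * (3 + 2) + 2)"
    by (rule spec_for_points[OF spec_emit]) auto
  have 3: "spec (\<lambda>s. emitted c M g n s \<and> nmem s 0 = n) (NAssign (NConst 0) (reg 7)) (\<lambda>s. output_indices s = selected c M g n) 1"
  proof (rule spec_NAssign)
    fix s assume s: "emitted c M g n s \<and> nmem s 0 = n"
    have "nmem (nwrite 0 (arr s 0 7) s) ` {1..arr s 0 7} = nmem s ` {1..arr s 0 7}"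
      by (rule image_cong) (auto simp: nmem_nwrite)
    then show "output_indices (nwrite (nval s (NConst 0)) (nval s (reg 7)) s) = selected c M g n"
      using s by (simp add: output_indices_def nmem_nwrite emitted_def)
  qed
  show ?thesis unfolding print_best_def
    using spec_Seq[OF 1 spec_Seq[OF 2 3]] by (rule spec_conseq) auto
qed

text \<open>Quantifying over all choices of representatives makes this a property of the centre
  alone, independent of memory and of earlier trials.\<close>

definition good :: "nat \<Rightarrow> bool" where
  "good c \<longleftrightarrow> (\<forall>M. representatives c M \<longrightarrow> (\<exists>j<n. n \<le> m * m * C * card (selected c M (grp c j) n)))"

lemma spec_search:
  assumes n: "n \<ge> 1" and good: "n \<le> 2 * card {c. c < n \<and> good c}"
  shows "spec (\<lambda>s. base s \<and> arr s 0 5 = 0)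
    (While (RLess (RMul (scale C) (RCast (reg 5))) (RCast (NRead (NConst 0))))
       (Seq (Random (cell 0 (NConst 1)) (NSub (NRead (NConst 0)) (NConst 1))) (trial d E)))
    (\<lambda>s. \<exists>c M g. tallied c M n s \<and> arr s 0 6 = g \<and> n \<le> m * m * C * card (selected c M g n)) (2 * trial_time + 6)"
proof -
  let ?b = "RLess (RMul (scale C) (RCast (reg 5))) (RCast (NRead (NConst 0)))"
  \<comment> \<open>A best count of zero marks that no trial need have taken place yet. The guard
    holds for it because \<open>n \<ge> 1\<close>, so on exit the tables stem from a trial.\<close>
  define I where "I s \<longleftrightarrow> base s \<and> (arr s 0 5 = 0 \<or> (\<exists>c M. tallied c M n s))" for s
  have b: "bval s ?b \<longleftrightarrow> m * m * C * arr s 0 5 < n" if "base s" for s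
  proof -
    have "bval s ?b \<longleftrightarrow> real (m * m * C * arr s 0 5) < real n"
      using that by (simp add: base_def scale_def)
    then show ?thesis by (simp only: of_nat_less_iff)
  qed
  have upd: "base (upd 0 1 v s) \<and> arr (upd 0 1 v s) 0 1 = v" if "I s" for s v
    using that by (simp add: I_def)
  have e: "nval s (NSub (NRead (NConst 0)) (NConst 1)) = n - 1" if "I s" for s
    using that by (simp add: I_def base_def)
  have I: "I s" if "tallied c M n s" for c M s
  proof -
    have "base s" using that by (simp add: tallied_def indexed_def)
    then show ?thesis using that unfolding I_def by blast
  qed
  have "spec I (While ?b (Seq (Random (cell 0 (NConst 1)) (NSub (NRead (NConst 0)) (NConst 1))) (trial d E)))
     (\<lambda>s. I s \<and> \<not> bval s ?b) (2 * trial_time + 6)"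
  proof (rule spec_geometric_loop)
    fix s assume s: "I s"
    have "n - 1 + 1 \<le> 2 * card {c. c < n \<and> good c}" using n good by simp
    moreover have "{c. c < n \<and> good c} \<subseteq> {..n - 1}" by auto
    moreover have "spec (\<lambda>s'. s' = nwrite (nval s (cell 0 (NConst 1))) v s) (trial d E) (\<lambda>s'. I s' \<and> \<not> bval s' ?b) trial_time"
      if v: "v < n" "good v" for v
    proof (rule spec_conseq[OF spec_trial[OF \<open>v < n\<close>]])
      fix s' assume "\<exists>M. tallied v M n s'"
      then obtain M where M: "tallied v M n s'" by blast
      then obtain j where j: "j < n" and le: "n \<le> m * m * C * card (selected v M (grp v j) n)"
        using v by (auto simp: good_def tallied_def indexed_def)
      note le
      also have "m * m * C * card (selected v M (grp v j) n) \<le> m * m * C * arr s' 0 5"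
        using M j by (intro mult_le_mono2) (auto simp: tallied_def)
      finally show "I s' \<and> \<not> bval s' ?b" using I[OF M] b[of s'] unfolding I_def by simp
    qed (use upd[OF s] in auto)
    ultimately show "\<exists>G\<subseteq>{..nval s (NSub (NRead (NConst 0)) (NConst 1))}.
            nval s (NSub (NRead (NConst 0)) (NConst 1)) + 1 \<le> 2 * card G \<and>
            (\<forall>v\<in>G. spec (\<lambda>s'. s' = nwrite (nval s (cell 0 (NConst 1))) v s) (trial d E)
                     (\<lambda>s'. I s' \<and> \<not> bval s' ?b) trial_time)"
      unfolding e[OF s] by (intro exI[of _ "{c. c < n \<and> good c}"]) blast
  next
    fix s v assume s: "I s" and "v \<le> nval s (NSub (NRead (NConst 0)) (NConst 1))"
    then have "v < n" using n unfolding e[OF s] by simp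
    then show "spec (\<lambda>s'. s' = nwrite (nval s (cell 0 (NConst 1))) v s) (trial d E) I trial_time"
      by (rule spec_conseq[OF spec_trial]) (use upd[OF s] I in auto)
  qed
  then show ?thesis
  proof (rule spec_conseq)
    fix s assume s: "I s \<and> \<not> bval s ?b"
    then have le: "n \<le> m * m * C * arr s 0 5" using b[of s] by (auto simp: I_def)
    then have "arr s 0 5 \<noteq> 0" using n by (cases "arr s 0 5 = 0") auto
    then obtain c M where "tallied c M n s" using s by (auto simp: I_def)
    then show "\<exists>c M g. tallied c M n s \<and> arr s 0 6 = g \<and> n \<le> m * m * C * card (selected c M g n)"
      using le by (metis tallied_def)
  qed (auto simp: I_def)
qed

lemma spec_search_and_print:
  assumes n: "n \<ge> 1" and good: "n \<le> 2 * card {c. c < n \<and> good c}"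
  shows "spec (\<lambda>s. base s \<and> arr s 0 5 = 0)
    (Seq (While (RLess (RMul (scale C) (RCast (reg 5))) (RCast (NRead (NConst 0))))
       (Seq (Random (cell 0 (NConst 1)) (NSub (NRead (NConst 0)) (NConst 1))) (trial d E))) print_best)
    (\<lambda>s. \<exists>c M g. c < n \<and> representatives c M \<and> output_indices s = selected c M g n \<and>
        n \<le> m * m * C * card (selected c M g n)) (2 * trial_time + 6 + (n * 5 + 4))"
proof (rule spec_Seq[OF spec_search[OF assms]])
  let ?S = "\<lambda>c M g. \<lambda>s. tallied c M n s \<and> arr s 0 6 = g \<and> n \<le> m * m * C * card (selected c M g n)"
  let ?R = "\<lambda>c M g. \<lambda>s. c < n \<and> representatives c M \<and> output_indices s = selected c M g n \<and>
        n \<le> m * m * C * card (selected c M g n)"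
  have "spec (?S c M g) print_best (?R c M g) (n * 5 + 4)" for c M g
  proof (rule spec_pointwise)
    fix s0 assume s0: "?S c M g s0"
    show "spec (\<lambda>s. s = s0) print_best (?R c M g) (n * 5 + 4)"
      by (rule spec_conseq[OF spec_print_best[of c M g]]) (use s0 in \<open>auto simp: tallied_def indexed_def\<close>)
  qed
  then show "spec (\<lambda>s. \<exists>c M g. ?S c M g s) print_best (\<lambda>s. \<exists>c M g. ?R c M g s) (n * 5 + 4)"
    by (intro spec_ex)
qed

end

section \<open>Resolution and radius\<close>

definition input :: "nat \<Rightarrow> nat \<Rightarrow> (nat \<Rightarrow> nat \<Rightarrow> real) \<Rightarrow> state \<Rightarrow> bool" where
  "input d n X s \<longleftrightarrow> nmem s 0 = n \<and> (\<forall>i<n. \<forall>l<d. cx d s i l = X i l) \<and> arr s 0 5 = 0"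

lemma spec_setup_grid:
  assumes "\<And>j. j \<le> k \<Longrightarrow> (2 ^ j) ^ (d + 1) < n \<longleftrightarrow> j < k"
  shows "spec (input d n X) (setup_grid d) (\<lambda>s. input d n X s \<and> arr s 0 2 = 2 ^ k) (2 * k + 2)"
proof -
  let ?J = "\<lambda>j s. input d n X s \<and> arr s 0 2 = 2 ^ j"
  have 1: "spec (input d n X) (setreg 2 (NConst 1)) (?J 0) 1"
    by (rule spec_NAssign) (auto simp: input_def)
  have 2: "spec (?J 0) (While (RLess (rpow (RCast (reg 2)) (d + 1)) (RCast (NRead (NConst 0)))) (setreg 2 (NAdd (reg 2) (reg 2)))) (?J k) (k * (1 + 1) + 1)"
  proof (rule spec_For)
    show "spec (?J j) (setreg 2 (NAdd (reg 2) (reg 2))) (?J (Suc j)) 1" for j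
      by (rule spec_NAssign) (auto simp: input_def)
    fix j s assume j: "j \<le> k" "?J j s"
    have "bval s (RLess (rpow (RCast (reg 2)) (d + 1)) (RCast (NRead (NConst 0)))) \<longleftrightarrow> real ((2 ^ j) ^ (d + 1)) < real n"
      using j by (simp add: input_def)
    also have "\<dots> \<longleftrightarrow> j < k" unfolding of_nat_less_iff by (rule assms[OF j(1)])
    finally show "bval s (RLess (rpow (RCast (reg 2)) (d + 1)) (RCast (NRead (NConst 0)))) \<longleftrightarrow> j < k" .
  qed
  show ?thesis unfolding setup_grid_def using spec_Seq[OF 1 2] by (rule spec_conseq) auto
qed

definition radius :: "nat \<Rightarrow> nat \<Rightarrow> (nat \<Rightarrow> nat \<Rightarrow> real) \<Rightarrow> real" where
  "radius d n X = Max ((\<lambda>(i, l). \<bar>X i l - X 0 l\<bar>) ` ({..<n} \<times> {..<d}))"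

lemma le_radius: "i < n \<Longrightarrow> l < d \<Longrightarrow> \<bar>X i l - X 0 l\<bar> \<le> radius d n X"
  unfolding radius_def by (rule Max_ge) auto

lemma radius_attained:
  assumes "n \<ge> 1" "d \<ge> 1"
  obtains i l where "i < n" "l < d" "radius d n X = \<bar>X i l - X 0 l\<bar>"
proof -
  have "radius d n X \<in> (\<lambda>(i, l). \<bar>X i l - X 0 l\<bar>) ` ({..<n} \<times> {..<d})"
    unfolding radius_def using assms by (intro Max_in) (auto simp: lessThan_empty_iff)
  then show ?thesis using that by auto
qed

lemma spec_enlarge_radius:
  assumes "\<And>s. P s \<Longrightarrow> rval s e = y" "\<And>s. P s \<Longrightarrow> rg d s 0 < y \<Longrightarrow> P (updr d 0 y s)"
  shows "spec P (enlarge_radius d e) (\<lambda>s. P s \<and> y \<le> rg d s 0) 2"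
proof -
  have "spec (\<lambda>s. P s \<and> bval s (RLess (rreg d 0) e)) (setrreg d 0 e) (\<lambda>s. P s \<and> y \<le> rg d s 0) 1"
    by (rule spec_RAssign) (use assms in auto)
  moreover have "spec (\<lambda>s. P s \<and> \<not> bval s (RLess (rreg d 0) e)) Skip (\<lambda>s. P s \<and> y \<le> rg d s 0) 1"
    by (rule spec_Skip) (use assms in auto)
  ultimately show ?thesis
    unfolding enlarge_radius_def by (rule spec_conseq[OF spec_Cond]) auto
qed

lemma spec_setup_radius:
  assumes n: "n \<ge> 1" and d: "d \<ge> 1"
  shows "spec (\<lambda>s. input d n X s \<and> arr s 0 2 = m) (setup_radius d)
    (\<lambda>s. input d n X s \<and> arr s 0 2 = m \<and> rg d s 0 = radius d n X) (n * (d * 4 + 3) + 3)"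
proof -
  \<comment> \<open>Coordinates preceding \<open>(i, l)\<close> in lexicographic order are dominated
    by the current radius, which never exceeds the true one; at the end both inequalities give
    equality.\<close>
  define J where "J i l s \<longleftrightarrow> input d n X s \<and> arr s 0 2 = m \<and> rg d s 0 \<le> radius d n X \<and>
     (\<forall>j<n. \<forall>l'<d. j < i \<or> j = i \<and> l' < l \<longrightarrow> \<bar>X j l' - X 0 l'\<bar> \<le> rg d s 0)" for i l s
  have upd: "J i l (upd 0 0 v s)" if "J i l s" for i l s v
    using that by (auto simp: J_def input_def)
  have updr: "J i l (updr d 0 v s)" if "J i l s" "rg d s 0 < v" "v \<le> radius d n X" for i l s v
    using that by (fastforce simp: J_def input_def)
  have 1: "spec (\<lambda>s. input d n X s \<and> arr s 0 2 = m) (setrreg d 0 (RCast (NConst 0))) (\<lambda>s. J 0 0 s \<and> nmem s 0 = n) 1"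
    by (rule spec_RAssign) (use le_radius[of 0 n 0 d X] n d in \<open>auto simp: J_def input_def\<close>)
  have step: "spec (\<lambda>s. J i l s \<and> nmem s 0 = n \<and> arr s 0 0 = i)
     (Seq (enlarge_radius d (RSub (coord d (reg 0) l) (coord d (NConst 0) l)))
          (enlarge_radius d (RSub (coord d (NConst 0) l) (coord d (reg 0) l))))
     (\<lambda>s. J i (Suc l) s \<and> nmem s 0 = n \<and> arr s 0 0 = i) 4" if i: "i < n" and l: "l < d" for i l
  proof -
    let ?P = "\<lambda>s. J i l s \<and> nmem s 0 = n \<and> arr s 0 0 = i"
    let ?P1 = "\<lambda>s. ?P s \<and> X i l - X 0 l \<le> rg d s 0"
    have v: "cx d s i l = X i l" "cx d s 0 l = X 0 l" if "J i l s" for s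
      using that n i l by (auto simp: J_def input_def)
    have le: "X i l - X 0 l \<le> radius d n X" "X 0 l - X i l \<le> radius d n X"
      using le_radius[OF i l, of X] by auto
    have 1: "spec ?P (enlarge_radius d (RSub (coord d (reg 0) l) (coord d (NConst 0) l))) ?P1 2"
      by (rule spec_enlarge_radius) (use v updr le in auto)
    have 2: "spec ?P1 (enlarge_radius d (RSub (coord d (NConst 0) l) (coord d (reg 0) l)))
       (\<lambda>s. ?P1 s \<and> X 0 l - X i l \<le> rg d s 0) 2"
      by (rule spec_enlarge_radius) (use v updr le in auto)
    show ?thesis using spec_Seq[OF 1 2]
      by (rule spec_conseq) (auto simp: J_def less_Suc_eq)
  qed
  have 2: "spec (\<lambda>s. J 0 0 s \<and> nmem s 0 = n) (for_points (seqs (\<lambda>l.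
        Seq (enlarge_radius d (RSub (coord d (reg 0) l) (coord d (NConst 0) l)))
            (enlarge_radius d (RSub (coord d (NConst 0) l) (coord d (reg 0) l)))) d))
      (\<lambda>s. J n 0 s \<and> nmem s 0 = n) (n * (d * 4 + 1 + 2) + 2)"
  proof (rule spec_for_points[where J="\<lambda>i. J i 0"])
    fix i assume i: "i < n"
    show "spec (\<lambda>s. J i 0 s \<and> nmem s 0 = n \<and> arr s 0 0 = i) (seqs (\<lambda>l.
        Seq (enlarge_radius d (RSub (coord d (reg 0) l) (coord d (NConst 0) l)))
            (enlarge_radius d (RSub (coord d (NConst 0) l) (coord d (reg 0) l)))) d)
        (\<lambda>s. J (Suc i) 0 s \<and> nmem s 0 = n \<and> arr s 0 0 = i) (d * 4 + 1)"
      by (rule spec_conseq[OF spec_seqs[where J="\<lambda>l s. J i l s \<and> nmem s 0 = n \<and> arr s 0 0 = i", OF step[OF i]]])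
        (auto simp: J_def less_Suc_eq)
  qed (rule upd)
  have final: "rg d s 0 = radius d n X" if J: "J n 0 s" for s
  proof -
    obtain i l where "i < n" "l < d" "radius d n X = \<bar>X i l - X 0 l\<bar>"
      using radius_attained[OF n d] by blast
    then show ?thesis using J by (auto simp: J_def intro: antisym)
  qed
  show ?thesis unfolding setup_radius_def
    by (rule spec_conseq[OF spec_Seq[OF 1 2]]) (auto simp: final algebra_simps, auto simp: J_def)
qed

lemma (in grid_run) spec_algorithm:
  assumes m: "m = 2 ^ k" and \<rho>: "\<rho> = radius d n X"
    and n: "n \<ge> 1" and d: "d \<ge> 1" and k: "\<And>j. j \<le> k \<Longrightarrow> (2 ^ j) ^ (d + 1) < n \<longleftrightarrow> j < k"
    and good: "n \<le> 2 * card {c. c < n \<and> good c}"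
  shows "spec (input d n X) (algorithm d E C)
    (\<lambda>s. \<exists>c M g. c < n \<and> representatives c M \<and> output_indices s = selected c M g n \<and>
      n \<le> m * m * C * card (selected c M g n))
    (2 * k + 2 + (n * (d * 4 + 3) + 3 + (2 * trial_time + 6 + (n * 5 + 4))))"
proof -
  have 1: "spec (\<lambda>s. input d n X s \<and> arr s 0 2 = m) (setup_radius d) (\<lambda>s. base s \<and> arr s 0 5 = 0) (n * (d * 4 + 3) + 3)"
    by (rule spec_conseq[OF spec_setup_radius[OF n d, where m=m and X=X]]) (simp_all add: input_def base_def \<rho>[symmetric])
  have 0: "spec (input d n X) (setup_grid d) (\<lambda>s. input d n X s \<and> arr s 0 2 = m) (2 * k + 2)"
    unfolding m by (rule spec_setup_grid[OF k])
  show ?thesis unfolding algorithm_def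
    by (rule spec_Seq[OF 0 spec_Seq[OF 1 spec_search_and_print[OF n good]]])
qed

section \<open>Correctness of the output\<close>

lemma expected_time_eq_wp: "expected_time c s = wp c (\<lambda>_. 0) s"
  unfolding expected_time_def wp_def by (intro nn_integral_cong) (auto split: option.split)

lemma spec_expected_time:
  assumes "spec P c Q T" "P s"
  shows "expected_time c s \<le> of_nat T"
  using specD[OF assms, of "\<lambda>_. 0" 0] by (simp add: expected_time_eq_wp)

text \<open>Charge infinite cost for violating \<open>Q\<close>: as the expected cost stays finite,
  no outcome in the support can violate it.\<close>

lemma spec_set_spmf:
  assumes "spec P c Q T" "P s" "(s', t) \<in> set_spmf (exec c s)"
  shows "Q s'"
proof -
  let ?f = "\<lambda>s. if Q s then 0 else (\<infinity>::ennreal)"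
  let ?g = "\<lambda>r. case r of None \<Rightarrow> \<infinity> | Some (s', t) \<Rightarrow> ?f s' + of_nat t"
  have "wp c ?f s \<le> 0 + of_nat T" by (rule specD[OF assms(1,2)]) auto
  then have "(\<integral>\<^sup>+ r. ?g r \<partial>measure_pmf (exec c s)) \<noteq> \<infinity>"
    unfolding wp_def by (metis add_0 ennreal_of_nat_neq_top infinity_ennreal_def top_unique)
  then have "AE r in measure_pmf (exec c s). ?g r \<noteq> \<infinity>"
    by (intro nn_integral_PInf_AE) auto
  moreover have "Some (s', t) \<in> set_pmf (exec c s)" using assms(3) by (simp add: in_set_spmf)
  ultimately have "?g (Some (s', t)) \<noteq> \<infinity>"
    unfolding AE_measure_pmf_iff by (rule bspec)
  then show ?thesis by (auto split: if_splits)
qed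

lemma code_cong: "(\<And>l. l < k \<Longrightarrow> f l = f' l) \<Longrightarrow> code B f a k = code B f' a k"
  by (induction k) auto

lemma input_input_state:
  fixes ps :: "(real ^ 'n) list"
  shows "input CARD('n) (length ps) (\<lambda>i l. ps ! i $ e l) (input_state e ps)"
proof -
  have "CARD('n) * i + l < length ps * CARD('n)" if "i < length ps" "l < CARD('n)" for i l
  proof -
    have "CARD('n) * i + l < CARD('n) * Suc i" using that by simp
    also have "\<dots> \<le> CARD('n) * length ps" using that by (intro mult_le_mono2) auto
    finally show ?thesis by (simp add: mult.commute)
  qed
  then show ?thesis by (simp add: input_def input_state_def cx_def arr_def)
qed

section \<open>Few collisions force a large group\<close>

lemma (in grid_run) gr_less: "i < n \<Longrightarrow> l < d \<Longrightarrow> gr i l < 2 ^ L"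
  using grid_range[of i l] by (simp add: gr_def nat_less_iff floor_less_iff)

lemma (in grid_run) sh_less: "c < n \<Longrightarrow> i < n \<Longrightarrow> sh c i < 2 ^ L"
  using shell_range[of c i] by (simp add: sh_def nat_less_iff floor_less_iff)

lemma (in grid_run) key_eqD:
  "key c i = key c j \<Longrightarrow> i < n \<Longrightarrow> j < n \<Longrightarrow> sh c i = sh c j \<and> (\<forall>l<d. gr i l = gr j l)"
  unfolding key_def by (rule code_eqD) (auto intro: gr_less)

lemma (in grid_run) grp_eqD:
  "grp c i = grp c j \<Longrightarrow> sh c i = sh c j \<and> (\<forall>l<d. gr i l mod 2 = gr j l mod 2)"
  unfolding grp_def by (rule code_eqD) auto

lemma (in grid_run) key_eqI:
  "sh c i = sh c j \<Longrightarrow> (\<And>l. l < d \<Longrightarrow> gr i l = gr j l) \<Longrightarrow> key c i = key c j"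
  unfolding key_def by (metis code_cong)

lemma (in grid_run) grp_less: "c < n \<Longrightarrow> i < n \<Longrightarrow> grp c i < 2 ^ L * 2 ^ d"
  unfolding grp_def by (rule code_less) (auto intro: sh_less)

text \<open>At most \<open>K * n\<close> collisions leave at least \<open>n / K\<close> distinct
  keys by \<open>card_collision_pairs\<close>, hence that many representatives. They are spread over
  at most \<open>2 ^ L * 2 ^ d = m * m * E * 2 ^ d\<close> groups. If all groups were smaller than
  \<open>n / (m * m * C)\<close>, their total would be less than \<open>n / K\<close>, by the choice
  of \<open>C\<close>.\<close>

lemma (in grid_run) good_if_few_collisions:
  fixes K :: real
  assumes c: "c < n" and few: "real (card {(i, j) \<in> {..<n} \<times> {..<n}. key c i = key c j}) \<le> K * n"
    and C: "K * E * 2 ^ d \<le> C"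
  shows "good c"
  unfolding good_def
proof (intro allI impI, rule ccontr)
  fix M assume M: "representatives c M"
  assume neg: "\<not> (\<exists>j<n. n \<le> m * m * C * card (selected c M (grp c j) n))"
  define R where "R = {j. j < n \<and> M j = j}"
  have Rfin: "finite R" by (simp add: R_def)
  have MM: "M (M j) = M j" if "j < n" for j
    using M that unfolding representatives_def by blast
  have MR: "M j \<in> R \<and> key c (M j) = key c j" if "j < n" for j
    using MM[OF that] M that unfolding R_def representatives_def by blast
  then have "M c \<in> R" using c by blast
  then have Rne: "R \<noteq> {}" by blast
  have "key c ` {..<n} = key c ` R"
  proof
    show "key c ` {..<n} \<subseteq> key c ` R"
    proof
      fix x assume "x \<in> key c ` {..<n}"
      then obtain j where j: "j < n" "x = key c j" by auto
      then have "M j \<in> R" "x = key c (M j)" using MR by auto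
      then show "x \<in> key c ` R" by blast
    qed
  qed (auto simp: R_def)
  then have keys: "card (key c ` {..<n}) \<le> card R" using Rfin by (simp add: card_image_le)
  have "n\<^sup>2 \<le> card {(i, j) \<in> {..<n} \<times> {..<n}. key c i = key c j} * card R"
    using card_collision_pairs[of "{..<n}" "key c"] keys
    by (simp) (meson le_trans mult_le_mono2)
  then have "real (n\<^sup>2) \<le> real (card {(i, j) \<in> {..<n} \<times> {..<n}. key c i = key c j} * card R)"
    by (simp only: of_nat_le_iff)
  also have "\<dots> \<le> K * n * card R" unfolding of_nat_mult by (intro mult_right_mono few) auto
  finally have nK: "real n \<le> K * card R" using c by (simp add: power2_eq_square)
  have "m > 0" using pow by (cases m) auto
  have "grp c ` R \<subseteq> {..<2 ^ L * 2 ^ d}" using grp_less[OF c] by (auto simp: R_def)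
  then have groups: "card (grp c ` R) \<le> m * m * E * 2 ^ d"
    using card_mono[of "{..<2 ^ L * 2 ^ d}" "grp c ` R"] pow by simp
  have "card R = (\<Sum>g\<in>grp c ` R. card (selected c M g n))"
  proof -
    have "R = (\<Union>g\<in>grp c ` R. selected c M g n)" by (auto simp: R_def selected_def)
    then have "card R = card (\<Union>g\<in>grp c ` R. selected c M g n)" by simp
    also have "\<dots> = (\<Sum>g\<in>grp c ` R. card (selected c M g n))"
      by (rule card_UN_disjoint) (use Rfin in \<open>auto simp: selected_def\<close>)
    finally show ?thesis .
  qed
  then have "m * m * C * card R = (\<Sum>g\<in>grp c ` R. m * m * C * card (selected c M g n))"
    by (simp add: sum_distrib_left)
  also have "\<dots> < (\<Sum>g\<in>grp c ` R. n)"
    using neg Rne Rfin by (intro sum_strict_mono) (auto simp: R_def)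
  also have "\<dots> \<le> m * m * E * 2 ^ d * n" using groups by simp
  finally have "m * m * (C * card R) < m * m * (E * 2 ^ d * n)" by (simp add: mult_ac)
  then have "C * card R < E * 2 ^ d * n" using \<open>m > 0\<close> by simp
  then have "real (C * card R) < real (E * 2 ^ d * n)" by (simp only: of_nat_less_iff)
  also have "\<dots> \<le> E * 2 ^ d * (K * card R)" using nK by (simp add: mult_left_mono)
  also have "\<dots> = (K * E * 2 ^ d) * card R" by simp
  also have "\<dots> \<le> real (C * card R)" unfolding of_nat_mult by (intro mult_right_mono C) auto
  finally show False by simp
qed

section \<open>Geometric meaning of keys and groups\<close>

locale embedded_run = grid_run "CARD('n)" n m E L C \<rho> X
  for n m E L C \<rho> X +
  fixes ps :: "(real ^ 'n) list" and e :: "nat \<Rightarrow> 'n"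
  assumes e: "bij_betw e {..<CARD('n)} UNIV"
    and X: "\<And>i l. X i l = ps ! i $ e l"
    and ps: "distinct ps" "length ps = n"
    and pos: "\<rho> > 0" "m > 0"
begin

definition side :: real where "side = \<rho> / m"

lemma side_pos: "side > 0" using pos by (simp add: side_def)

lemma shell_eq: "shell CARD('n) m \<rho> X c i = (norm (ps ! i - ps ! c))\<^sup>2 / side\<^sup>2"
proof -
  have "(norm (ps ! i - ps ! c))\<^sup>2 = (\<Sum>k\<in>UNIV. (ps ! i $ k - ps ! c $ k) * (ps ! i $ k - ps ! c $ k))"
    by (simp add: power2_norm_eq_inner inner_vec_def)
  also have "\<dots> = (\<Sum>l<CARD('n). (X i l - X c l) * (X i l - X c l))"
    unfolding X by (rule sum.reindex_bij_betw[OF e, symmetric])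
  finally show ?thesis using pos by (simp add: shell_def side_def power2_eq_square)
qed

lemma obtain_index:
  fixes k :: 'n
  obtains l where "l < CARD('n)" "k = e l"
  using e unfolding bij_betw_def by (metis UNIV_I imageE lessThan_iff)

lemma grid_diff: "grid m \<rho> X i l - grid m \<rho> X j l = (ps ! i - ps ! j) $ e l / side"
  by (simp add: grid_def X side_def diff_divide_distrib[symmetric] algebra_simps)

lemma shell_close:
  assumes "c < n" "i < n" "j < n" "sh c i = sh c j"
  shows "\<bar>(norm (ps ! i - ps ! c))\<^sup>2 - (norm (ps ! j - ps ! c))\<^sup>2\<bar> < side\<^sup>2"
proof -
  have "\<lfloor>shell CARD('n) m \<rho> X c i\<rfloor> = \<lfloor>shell CARD('n) m \<rho> X c j\<rfloor>"
    using assms shell_range[of c i] shell_range[of c j] by (simp add: sh_def eq_nat_nat_iff)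
  then have "\<bar>shell CARD('n) m \<rho> X c i - shell CARD('n) m \<rho> X c j\<bar> < 1" by linarith
  then have "\<bar>(norm (ps ! i - ps ! c))\<^sup>2 - (norm (ps ! j - ps ! c))\<^sup>2\<bar> / side\<^sup>2 < 1"
    by (simp add: shell_eq diff_divide_distrib[symmetric] abs_divide)
  then show ?thesis using side_pos by simp
qed

lemma close_if_same_key:
  assumes "c < n" "i < n" "j < n" "key c i = key c j"
  shows "close side (ps ! c) (ps ! i) (ps ! j)"
proof -
  have sh: "sh c i = sh c j" and gr: "\<And>l. l < CARD('n) \<Longrightarrow> gr i l = gr j l"
    using key_eqD[OF assms(4,2,3)] by blast+
  have "\<bar>(ps ! i - ps ! j) $ k\<bar> < side" for k
  proof -
    obtain l where l: "l < CARD('n)" "k = e l" by (rule obtain_index)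
    have "\<lfloor>grid m \<rho> X i l\<rfloor> = \<lfloor>grid m \<rho> X j l\<rfloor>"
      using gr[OF l(1)] grid_range[OF assms(2) l(1)] grid_range[OF assms(3) l(1)] by (simp add: gr_def eq_nat_nat_iff)
    then have "\<bar>grid m \<rho> X i l - grid m \<rho> X j l\<bar> < 1" by linarith
    then have "\<bar>(ps ! i - ps ! j) $ k\<bar> / side < 1" unfolding grid_diff using l side_pos by (simp add: abs_divide)
    then show ?thesis using side_pos by simp
  qed
  then have "norm (ps ! i - ps ! j) < CARD('n) * side" by (rule norm_less_card_times)
  then show ?thesis using shell_close[OF assms(1-3) sh] by (simp add: close_def)
qed

lemma selected_convex_position:
  assumes c: "c < n" and M: "representatives c M"
  shows "convex_position ((!) ps ` selected c M g n)"
proof (rule convex_position_if_norm_diff_less[where c="ps ! c"])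
  fix p q assume "p \<in> (!) ps ` selected c M g n" "q \<in> (!) ps ` selected c M g n" "p \<noteq> q"
  then obtain i j where ij: "i \<in> selected c M g n" "j \<in> selected c M g n" "p = ps ! i" "q = ps ! j" "i \<noteq> j"
    by auto
  then have lt: "i < n" "j < n" and grp: "grp c i = grp c j" and Mij: "M i = i" "M j = j"
    by (auto simp: selected_def)
  have sh: "sh c i = sh c j" and par: "\<And>l. l < CARD('n) \<Longrightarrow> gr i l mod 2 = gr j l mod 2"
    using grp_eqD[OF grp] by blast+
  have "key c i \<noteq> key c j"
    using M lt Mij \<open>i \<noteq> j\<close> unfolding representatives_def by metis
  then obtain l where l: "l < CARD('n)" "gr i l \<noteq> gr j l" using key_eqI[OF sh] by blast
  \<comment> \<open>Distinct numbers of equal parity differ by at least two, so the unrounded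
    coordinates still differ by more than one, that is, by more than one cube side.\<close>
  have "gr i l + 2 \<le> gr j l \<or> gr j l + 2 \<le> gr i l" using l(2) par[OF l(1)] by presburger
  then have gap: "real (gr i l) + 2 \<le> real (gr j l) \<or> real (gr j l) + 2 \<le> real (gr i l)" by linarith
  have "real (gr i' l) \<le> grid m \<rho> X i' l \<and> grid m \<rho> X i' l < real (gr i' l) + 1" if "i' < n" for i'
    using grid_range[OF that l(1)] by (simp add: gr_def of_nat_nat)
  from this[OF lt(1)] this[OF lt(2)] gap have "1 < \<bar>grid m \<rho> X i l - grid m \<rho> X j l\<bar>" by linarith
  then have "1 < \<bar>(p - q) $ e l\<bar> / side" unfolding grid_diff using ij side_pos by (simp add: abs_divide)
  then have "side < \<bar>(p - q) $ e l\<bar>" using side_pos by simp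
  also have "\<dots> \<le> norm (p - q)" by (rule component_le_norm_cart)
  finally have "side\<^sup>2 < (norm (p - q))\<^sup>2" using side_pos by (intro power_strict_mono) auto
  then show "(norm (q - ps ! c))\<^sup>2 - (norm (p - ps ! c))\<^sup>2 < (norm (p - q))\<^sup>2"
    using shell_close[OF c lt sh] ij by simp
qed

lemma card_selected: "card ((!) ps ` selected c M g n) = card (selected c M g n)"
  using ps by (intro card_image inj_onI) (auto simp: selected_def nth_eq_iff_index_eq)

text \<open>Index pairs with equal keys inject into close pairs of points. The centres found by
  \<open>many_good_centers\<close> thus satisfy \<open>good_if_few_collisions\<close> with
  \<open>K\<close> equal to \<open>2 * ?H\<close>.\<close>

lemma many_good:
  fixes \<delta> \<beta> :: real
  assumes spread: "spread_set (set ps) o' \<delta> \<rho> side \<beta>"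
    and C: "2 * (close_const CARD('n) * \<beta>\<^sup>2 + 1) * E * 2 ^ CARD('n) \<le> C"
  shows "n \<le> 2 * card {c. c < n \<and> good c}"
proof -
  interpret spread_set "set ps" o' \<delta> \<rho> side \<beta> by (rule spread)
  let ?H = "close_const CARD('n) * \<beta>\<^sup>2 + 1"
  let ?G = "{c \<in> set ps. real (card {(x, y) \<in> set ps \<times> set ps. close side c x y}) \<le> 2 * ?H * real (card (set ps))}"
  have n: "card (set ps) = n" using ps by (simp add: distinct_card)
  have inj: "inj_on ((!) ps) {..<n}" using ps by (auto simp: inj_on_def nth_eq_iff_index_eq)
  have "?G \<subseteq> (!) ps ` {c. c < n \<and> good c}"
  proof
    fix x assume x: "x \<in> ?G"
    then obtain c where c: "c < n" "x = ps ! c" using ps by (auto simp: in_set_conv_nth)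
    let ?P = "{(i, j) \<in> {..<n} \<times> {..<n}. key c i = key c j}"
    have "card ?P = card (map_prod ((!) ps) ((!) ps) ` ?P)"
      by (rule card_image[symmetric]) (use inj in \<open>auto simp: inj_on_def\<close>)
    also have "\<dots> \<le> card {(y, z) \<in> set ps \<times> set ps. close side x y z}"
      using ps c close_if_same_key[OF c(1)] by (intro card_mono) (auto intro: finite_subset[of _ "set ps \<times> set ps"])
    finally have "real (card ?P) \<le> 2 * ?H * real n" using x n by simp
    then have "good c" using C by (intro good_if_few_collisions[OF c(1)]) auto
    then show "x \<in> (!) ps ` {c. c < n \<and> good c}" using c by blast
  qed
  then have "card ?G \<le> card ((!) ps ` {c. c < n \<and> good c})" by (intro card_mono) auto
  also have "\<dots> \<le> card {c. c < n \<and> good c}" by (intro card_image_le) auto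
  finally show ?thesis using many_good_centers n by linarith
qed

end

section \<open>Quantitative bounds\<close>

text \<open>Coordinates differ by at most \<open>2 * \<rho>\<close>, so shell numbers are at most
  \<open>4 * d * m\<^sup>2\<close> and cube numbers at most \<open>2 * m\<close>. Both stay below
  \<open>m\<^sup>2 * 2 ^ (4 * d)\<close> because \<open>4 * d < 2 ^ (4 * d)\<close>.\<close>

lemma grid_run_power_two:
  fixes X :: "nat \<Rightarrow> nat \<Rightarrow> real"
  assumes d: "d \<ge> 1" and \<rho>: "\<rho> > 0" and X: "\<And>i l. i < n \<Longrightarrow> l < d \<Longrightarrow> \<bar>X i l - X 0 l\<bar> \<le> \<rho>"
  shows "grid_run d n (2 ^ k) (2 ^ (4 * d)) (2 * k + 4 * d) \<rho> X"
proof
  have "4 * d < 2 ^ (4 * d)" by (rule less_exp)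
  then have "real (4 * d) < real (2 ^ (4 * d))" by (simp only: of_nat_less_iff)
  then have E: "4 * real d < 2 ^ (4 * d)" by simp
  define m where "m = real (2 ^ k)"
  have m: "m \<ge> 1" by (simp add: m_def)
  have P: "(2 :: real) ^ (2 * k + 4 * d) = m * m * 2 ^ (4 * d)"
    by (simp only: m_def of_nat_power of_nat_numeral power_add mult_2)
  show "(2 :: nat) ^ k * 2 ^ k * 2 ^ (4 * d) = 2 ^ (2 * k + 4 * d)"
    by (simp only: power_add mult_2)
  show "2 * k + 4 * d \<ge> 1" using d by simp
  show "0 \<le> shell d (2 ^ k) \<rho> X c i \<and> shell d (2 ^ k) \<rho> X c i < 2 ^ (2 * k + 4 * d)" if ci: "c < n" "i < n" for c i
  proof -
    have sq: "0 \<le> (X i l - X c l) * (X i l - X c l) \<and> (X i l - X c l) * (X i l - X c l) \<le> 4 * (\<rho> * \<rho>)" if "l < d" for l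
    proof -
      have "\<bar>X i l - X c l\<bar> \<le> 2 * \<rho>" using X[OF ci(1) that] X[OF ci(2) that] by linarith
      then have "\<bar>X i l - X c l\<bar> * \<bar>X i l - X c l\<bar> \<le> (2 * \<rho>) * (2 * \<rho>)" by (intro mult_mono) auto
      then show ?thesis by (simp add: abs_mult_self_eq)
    qed
    have "(\<Sum>l<d. (X i l - X c l) * (X i l - X c l)) \<le> (\<Sum>l<d. 4 * (\<rho> * \<rho>))"
      using sq by (intro sum_mono) auto
    then have "(\<Sum>l<d. (X i l - X c l) * (X i l - X c l)) / (\<rho> * \<rho>) \<le> 4 * real d"
      using \<rho> by (simp add: field_simps)
    then have "(\<Sum>l<d. (X i l - X c l) * (X i l - X c l)) / (\<rho> * \<rho>) * (m * m) \<le> 4 * real d * (m * m)"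
      using m by (intro mult_right_mono) auto
    also have "\<dots> < 2 ^ (4 * d) * (m * m)" using E m by (intro mult_strict_right_mono) auto
    finally have "shell d (2 ^ k) \<rho> X c i < 2 ^ (2 * k + 4 * d)"
      unfolding P shell_def m_def by (simp add: field_simps)
    moreover have "0 \<le> shell d (2 ^ k) \<rho> X c i"
    proof -
      have "0 \<le> (\<Sum>l<d. (X i l - X c l) * (X i l - X c l))" by (rule sum_nonneg) simp
      then show ?thesis using \<rho> by (simp add: shell_def)
    qed
    ultimately show ?thesis by simp
  qed
  show "0 \<le> grid (2 ^ k) \<rho> X i l \<and> grid (2 ^ k) \<rho> X i l < 2 ^ (2 * k + 4 * d)" if il: "i < n" "l < d" for i l
  proof -
    have r: "0 \<le> X i l - X 0 l + \<rho>" "X i l - X 0 l + \<rho> \<le> 2 * \<rho>" using X[OF il] by linarith+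
    have grid: "grid (2 ^ k) \<rho> X i l = (X i l - X 0 l + \<rho>) / \<rho> * m" by (simp add: grid_def m_def)
    have "(X i l - X 0 l + \<rho>) / \<rho> \<le> 2" using r \<rho> by (simp add: field_simps)
    then have "(X i l - X 0 l + \<rho>) / \<rho> * m \<le> 2 * m" using m by (intro mult_right_mono) auto
    also have "\<dots> < 2 ^ (4 * d) * m" using E d m by (intro mult_strict_right_mono) auto
    also have "\<dots> \<le> 2 ^ (4 * d) * (m * m)" using m by (intro mult_left_mono) auto
    finally have "(X i l - X 0 l + \<rho>) / \<rho> * m < m * m * 2 ^ (4 * d)" by (simp only: mult_ac)
    moreover have "0 \<le> (X i l - X 0 l + \<rho>) / \<rho> * m" using r \<rho> m by simp
    ultimately show ?thesis unfolding P grid by simp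
  qed
qed

definition resolution :: "nat \<Rightarrow> nat \<Rightarrow> nat" where
  "resolution d n = (LEAST k. n \<le> (2 ^ k) ^ (d + 1))"

lemma resolution:
  shows "n \<le> (2 ^ resolution d n) ^ (d + 1)"
    and "j \<le> resolution d n \<Longrightarrow> (2 ^ j) ^ (d + 1) < n \<longleftrightarrow> j < resolution d n"
proof -
  have "n \<le> 2 ^ n" by (simp add: less_imp_le)
  also have "\<dots> \<le> (2 ^ n) ^ (d + 1)" by (rule self_le_power) auto
  finally show *: "n \<le> (2 ^ resolution d n) ^ (d + 1)"
    unfolding resolution_def by (rule LeastI)
  show "(2 ^ j) ^ (d + 1) < n \<longleftrightarrow> j < resolution d n" if "j \<le> resolution d n"
  proof
    show "(2 ^ j) ^ (d + 1) < n \<Longrightarrow> j < resolution d n" using * that by (cases "j = resolution d n") auto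
    show "j < resolution d n \<Longrightarrow> (2 ^ j) ^ (d + 1) < n"
      using not_less_Least[of j "\<lambda>k. n \<le> (2 ^ k) ^ (d + 1)"] by (simp add: resolution_def)
  qed
qed

text \<open>By minimality, half the resolution has its power of order \<open>d + 1\<close> below
  \<open>n\<close>, and doubling costs the factor \<open>2 ^ (d + 1)\<close>.\<close>

lemma resolution_upper:
  assumes "n \<ge> 1"
  shows "(2 ^ resolution d n) ^ (d + 1) \<le> 2 ^ (d + 1) * n"
proof (cases "resolution d n")
  case 0
  have "1 * 1 \<le> 2 ^ (d + 1) * n" using assms by (intro mult_le_mono) auto
  then show ?thesis using 0 by simp
next
  case (Suc j)
  then have "(2 ^ j) ^ (d + 1) < n" using resolution(2)[of j d n] by simp
  then have "2 ^ (d + 1) * (2 ^ j) ^ (d + 1) \<le> 2 ^ (d + 1) * n" by (intro mult_le_mono2) simp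
  moreover have "(2 ^ Suc j) ^ (d + 1) = (2 :: nat) ^ (d + 1) * (2 ^ j) ^ (d + 1)"
    unfolding power_Suc[of 2 j] by (rule power_mult_distrib)
  ultimately show ?thesis unfolding Suc by simp
qed

lemma resolution_le_ln:
  assumes "n \<ge> 2"
  shows "real (resolution d n + 1) \<le> 3 * ln n / ln 2"
proof -
  have l2: "ln 2 \<le> ln (real n)" using assms by (subst ln_le_cancel_iff) auto
  have "real (resolution d n) \<le> ln n / ln 2 + 1"
  proof (cases "resolution d n")
    case 0
    then show ?thesis using assms by simp
  next
    case (Suc j)
    have "(2 :: nat) ^ j \<le> (2 ^ j) ^ (d + 1)" by (rule self_le_power) auto
    also have "\<dots> < n" using resolution(2)[of j d n] Suc by simp
    finally have "real (2 ^ j) < real n" by (simp only: of_nat_less_iff)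
    then have "ln ((2 :: real) ^ j) \<le> ln (real n)" by (subst ln_le_cancel_iff) auto
    then have "real j \<le> ln n / ln 2" by (simp add: ln_realpow field_simps)
    then show ?thesis using Suc by simp
  qed
  \<comment> \<open>The two additive ones are each at most the binary logarithm of \<open>n\<close>,
    which explains the factor three.\<close>
  moreover have "1 \<le> ln n / ln 2" using l2 by simp
  ultimately have "real (resolution d n + 1) \<le> 3 * (ln n / ln 2)" unfolding of_nat_add of_nat_1 by linarith
  then show ?thesis by simp
qed

section \<open>Running time\<close>

definition time_bound :: "nat \<Rightarrow> nat \<Rightarrow> nat" where
  "time_bound d n = (let k = resolution d n; L = 2 * k + 4 * d in
     2 * k + 2 + (n * (d * 4 + 3) + 3 +
       (2 * (n * (6 * L + d * (6 * L + 4) + 12) + 2 + 1 + (n * 7 + 2)) + 6 + (n * 5 + 4))))"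

text \<open>Bounds the sum of the coefficients of \<open>time_bound\<close> after \<open>n\<close>,
  \<open>k\<close>, \<open>n * k\<close> and all constant terms are replaced by
  \<open>n * (k + 1)\<close>.\<close>

definition time_const :: "nat \<Rightarrow> nat" where
  "time_const d = 77 + 12 * d + 24 * (1 + d) * (1 + 2 * d)"

lemma time_bound_le:
  assumes "n \<ge> 2"
  shows "real (time_bound d n) \<le> 3 * real (time_const d) / ln 2 * (n * ln n)"
proof -
  define K where "K = time_const d"
  define k where "k = resolution d n"
  define q where "q = n * (k + 1)"
  have "1 * k \<le> n * k" by (rule mult_le_mono1) (use assms in simp)
  then have "k \<le> n * k" by (simp only: mult_1)
  moreover have "q = n * k + n" by (simp add: q_def)
  ultimately have q: "n \<le> q" "k \<le> q" "1 \<le> q" "n * k \<le> q" using assms by linarith+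
  have "time_bound d n = 2 * k + 2 + 4 * d * n + 3 * n + 3 + 24 * (1 + d) * (n * k) + 48 * (1 + d) * d * n
       + 8 * d * n + 24 * n + 10 + 14 * n + 6 + 5 * n + 4"
    by (simp add: time_bound_def Let_def k_def[symmetric] algebra_simps)
  also have "\<dots> \<le> 2 * q + 2 * q + 4 * d * q + 3 * q + 3 * q + 24 * (1 + d) * q + 48 * (1 + d) * d * q
       + 8 * d * q + 24 * q + 10 * q + 14 * q + 6 * q + 5 * q + 4 * q"
    using q by (intro add_mono mult_le_mono2) auto
  also have "\<dots> \<le> K * q"
    by (simp add: K_def time_const_def algebra_simps)
  finally have "real (time_bound d n) \<le> real (K * q)" by (simp only: of_nat_le_iff)
  also have "\<dots> = real K * n * real (k + 1)" by (simp add: q_def algebra_simps)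
  also have "\<dots> \<le> real K * n * (3 * ln n / ln 2)"
    unfolding k_def by (intro mult_left_mono resolution_le_ln assms) auto
  finally show ?thesis by (simp add: K_def mult_ac)
qed

text \<open>Take for \<open>\<delta>\<close> the minimum distance. The radius \<open>\<rho>\<close>
  is attained in some coordinate and hence is at most the diameter, so
  \<open>\<rho> / \<delta>\<close> is at most the spread; its \<open>d\<close>-th power gives the
  constant \<open>\<alpha> ^ d\<close>.\<close>

lemma spread_set_of_points:
  fixes A :: "(real ^ 'n) set"
  assumes fin: "finite A" and two: "card A \<ge> 2" and dim: "CARD('n) \<ge> 2" and a: "a \<in> A"
    and \<rho>: "\<And>x k. x \<in> A \<Longrightarrow> \<bar>x $ k - a $ k\<bar> \<le> \<rho>" and att: "\<exists>x\<in>A. \<exists>k. \<rho> = \<bar>x $ k - a $ k\<bar>"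
    and spr: "spread A \<le> \<alpha> * real (card A) powr (1 / real CARD('n))" and \<alpha>: "\<alpha> > 0"
    and m: "m \<ge> 1" "card A \<le> m ^ (CARD('n) + 1)"
  obtains \<delta> where "spread_set A a \<delta> \<rho> (\<rho> / real m) (\<alpha> ^ CARD('n))" "\<rho> / \<delta> \<le> \<alpha> * real (card A) powr (1 / real CARD('n))"
proof -
  let ?D = "{dist x y | x y. x \<in> A \<and> y \<in> A \<and> x \<noteq> y}"
  have "?D \<subseteq> (\<lambda>(x, y). dist x y) ` (A \<times> A)" by auto
  then have finD: "finite ?D" using fin by (meson finite_SigmaI finite_imageI finite_subset)
  have "\<exists>a'\<in>A. a' \<noteq> a"
  proof (rule ccontr)
    assume "\<not> ?thesis"
    then have "A \<subseteq> {a}" by blast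
    then have "card A \<le> card {a}" by (intro card_mono) auto
    then show False using two by simp
  qed
  then obtain a' where a': "a' \<in> A" "a' \<noteq> a" by blast
  then have D: "dist a' a \<in> ?D" using a by blast
  define \<delta> where "\<delta> = Min ?D"
  have "\<delta> \<in> ?D" unfolding \<delta>_def using finD D by (intro Min_in) auto
  then have \<delta>: "\<delta> > 0" by auto
  have sep: "\<delta> \<le> norm (x - y)" if "x \<in> A" "y \<in> A" "x \<noteq> y" for x y
    unfolding \<delta>_def dist_norm[symmetric] using finD that by (intro Min_le) auto
  have "\<delta> \<le> norm (a' - a)" by (rule sep) (use a a' in auto)
  also obtain l where "norm (a' - a) \<le> CARD('n) * \<bar>(a' - a) $ l\<bar>" using obtain_max_component[of "a' - a"] by blast
  also have "\<dots> \<le> CARD('n) * \<rho>" using \<rho>[OF a'(1), of l] by (intro mult_left_mono) auto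
  finally have \<delta>\<rho>: "\<delta> \<le> real CARD('n) * \<rho>" .
  then have \<rho>0: "\<rho> > 0" using \<delta> by (smt (verit) mult_nonneg_nonpos of_nat_0_le_iff)
  obtain x k where x: "x \<in> A" "\<rho> = \<bar>x $ k - a $ k\<bar>" using att by blast
  then have "x \<noteq> a" using \<rho>0 by auto
  have "\<rho> \<le> dist x a" using x component_le_norm_cart[of "x - a" k] by (simp add: dist_norm)
  also have "\<dots> \<le> Max ?D" using finD x a \<open>x \<noteq> a\<close> by (intro Max_ge) auto
  finally have "\<rho> / \<delta> \<le> spread A" unfolding spread_def \<delta>_def[symmetric] using \<delta> by (intro divide_right_mono) auto
  then have le: "\<rho> / \<delta> \<le> \<alpha> * real (card A) powr (1 / real CARD('n))" using spr by linarith
  have n: "real (card A) > 0" using two by simp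
  have "(\<rho> / \<delta>) ^ CARD('n) \<le> (\<alpha> * real (card A) powr (1 / real CARD('n))) ^ CARD('n)"
    using le \<rho>0 \<delta> by (intro power_mono) auto
  also have "\<dots> = \<alpha> ^ CARD('n) * real (card A)"
    using n by (simp add: power_mult_distrib powr_powr flip: powr_realpow)
  finally have vol: "(\<rho> / \<delta>) ^ CARD('n) \<le> \<alpha> ^ CARD('n) * real (card A)" .
  have "real (card A) \<le> real (m ^ (CARD('n) + 1))" using m(2) by (simp only: of_nat_le_iff)
  then have "(\<rho> / m) ^ (CARD('n) + 1) * card A \<le> (\<rho> / m) ^ (CARD('n) + 1) * real m ^ (CARD('n) + 1)"
    using \<rho>0 by (intro mult_left_mono) auto
  also have "\<dots> = \<rho> ^ (CARD('n) + 1)" using m(1) by (simp add: power_divide)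
  finally have b: "(\<rho> / m) ^ (CARD('n) + 1) * card A \<le> \<rho> ^ (CARD('n) + 1)" .
  have "spread_set A a \<delta> \<rho> (\<rho> / real m) (\<alpha> ^ CARD('n))"
    by unfold_locales (use fin dim \<delta> sep \<rho> \<delta>\<rho> b \<rho>0 m vol in auto)
  then show ?thesis using le that by blast
qed

lemma (in spread_set) OPT_le:
  "real (OPT A) \<le> 2 * real CARD('n) * (7 * real CARD('n) * (\<rho> / \<delta>)) ^ (CARD('n) - 1)"
proof -
  let ?S = "{card B | B. B \<subseteq> A \<and> convex_position B}"
  have "?S \<subseteq> card ` Pow A" by auto
  then have "finite ?S" using finite by (meson finite_Pow_iff finite_imageI finite_subset)
  moreover have "card {} \<in> ?S" by (force simp: convex_position_def)
  ultimately have "OPT A \<in> ?S" unfolding OPT_def by (intro Max_in) auto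
  then obtain B where B: "B \<subseteq> A" "convex_position B" "OPT A = card B" by auto
  have "real (card B) \<le> 2 * real CARD('n) * (6 * real CARD('n) * \<rho> / \<delta> + 1) ^ (CARD('n) - 1)"
  proof (rule card_convex_position_le[where o'=o'])
    show "\<delta> \<le> norm (x - y)" if "x \<in> B" "y \<in> B" "x \<noteq> y" for x y
      using sep that B(1) by blast
    show "finite B" using B(1) finite by (rule finite_subset)
  qed (use \<delta> cube \<rho>_pos B in auto)
  also have "\<dots> \<le> 2 * real CARD('n) * (7 * real CARD('n) * (\<rho> / \<delta>)) ^ (CARD('n) - 1)"
  proof (intro mult_left_mono power_mono)
    have "1 \<le> real CARD('n) * (\<rho> / \<delta>)" using \<rho> \<delta> by (simp add: field_simps)
    moreover have "6 * a + 1 \<le> 7 * a" if "1 \<le> a" for a :: real using that by simp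
    ultimately have "6 * (real CARD('n) * (\<rho> / \<delta>)) + 1 \<le> 7 * (real CARD('n) * (\<rho> / \<delta>))" by blast
    then show "6 * real CARD('n) * \<rho> / \<delta> + 1 \<le> 7 * real CARD('n) * (\<rho> / \<delta>)" by (simp add: mult_ac)
  qed (use \<delta> \<rho>_pos in auto)
  finally show ?thesis using B by simp
qed

text \<open>Here \<open>s\<close> stands for \<open>\<rho> / \<delta>\<close> and \<open>b\<close>
  for the output size. As \<open>m\<^sup>2\<close> has order at most \<open>2 / (d + 1)\<close> in
  \<open>n\<close>, the output has order at least \<open>(d - 1) / (d + 1)\<close>, while the
  optimum has order at most \<open>(d - 1) / d\<close>. The two exponents differ by
  \<open>(d - 1) / (d * (d + 1))\<close>.\<close>

lemma approximation_ratio: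
  fixes n d m C :: nat and opt s \<alpha> b :: real
  assumes d: "d \<ge> 2" and n: "n \<ge> 2" and m: "m ^ (d + 1) \<le> 2 ^ (d + 1) * n"
    and b: "real n \<le> real m * real m * real C * b" "b \<ge> 0" and C: "C > 0" and \<alpha>: "\<alpha> > 0"
    and opt: "opt \<le> 2 * real d * (7 * real d * s) ^ (d - 1)" and s: "0 \<le> s" "s \<le> \<alpha> * real n powr (1 / real d)"
  shows "1 / (4 * real C * (2 * real d * (7 * real d * \<alpha>) ^ (d - 1))) * real n powr (- ((real d - 1) / (real d * (real d + 1)))) * opt \<le> b"
proof -
  define D where "D = 2 * real d * (7 * real d * \<alpha>) ^ (d - 1)"
  have D: "D > 0" using d \<alpha> by (simp add: D_def)
  have n0: "real n > 0" using n by simp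
  have "opt \<le> 2 * real d * (7 * real d * (\<alpha> * real n powr (1 / d))) ^ (d - 1)"
    using s by (intro order_trans[OF opt] mult_left_mono power_mono) auto
  also have "\<dots> = D * (real n powr (1 / d)) ^ (d - 1)"
    by (simp add: D_def power_mult_distrib)
  also have "(real n powr (1 / d)) ^ (d - 1) = n powr ((real d - 1) / d)"
    using n0 d by (simp add: powr_powr of_nat_diff flip: powr_realpow)
  finally have opt': "opt \<le> D * n powr ((real d - 1) / d)" .
  have "real m \<le> 2 * n powr (1 / (real d + 1))"
  proof (rule power_le_imp_le_base[where n=d])
    have "real (m ^ (d + 1)) \<le> real (2 ^ (d + 1) * n)" using m by (simp only: of_nat_le_iff)
    also have "\<dots> = (2 * n powr (1 / (real d + 1))) ^ (d + 1)"
      using n0 unfolding power_mult_distrib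
      by (simp add: powr_powr add.commute[of 1] del: power_Suc flip: powr_realpow)
    finally show "real m ^ Suc d \<le> (2 * n powr (1 / (real d + 1))) ^ Suc d" by simp
  qed auto
  then have "real m * real m \<le> (2 * n powr (1 / (real d + 1))) * (2 * n powr (1 / (real d + 1)))"
    by (intro mult_mono) auto
  also have "\<dots> = 4 * n powr (2 / (real d + 1))" by (simp flip: powr_add add_divide_distrib)
  finally have "real m * real m * (C * b) \<le> 4 * n powr (2 / (real d + 1)) * (C * b)"
    using b(2) by (intro mult_right_mono) auto
  then have "real n \<le> 4 * real C * b * n powr (2 / (real d + 1))" using b(1) by (simp add: mult_ac)
  moreover have "real n = n powr ((real d - 1) / (real d + 1)) * n powr (2 / (real d + 1))"
  proof -
    have "(real d - 1) / (real d + 1) + 2 / (real d + 1) = (real d + 1) / (real d + 1)"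
      unfolding add_divide_distrib[symmetric] by simp
    moreover have "real d + 1 \<noteq> 0" by linarith
    ultimately have "(real d - 1) / (real d + 1) + 2 / (real d + 1) = 1" by simp
    then show ?thesis using n0 by (simp flip: powr_add)
  qed
  ultimately have "n powr ((real d - 1) / (real d + 1)) * n powr (2 / (real d + 1)) \<le> 4 * real C * b * n powr (2 / (real d + 1))"
    by linarith
  then have size: "n powr ((real d - 1) / (real d + 1)) \<le> 4 * real C * b"
    using n0 by (subst (asm) mult_le_cancel_right_pos) auto
  let ?q = "- ((real d - 1) / (real d * (real d + 1)))"
  have "n powr ?q * opt \<le> n powr ?q * (D * n powr ((real d - 1) / d))" using opt' by (intro mult_left_mono) auto
  also have "\<dots> = D * n powr (?q + (real d - 1) / d)" by (simp only: powr_add mult_ac)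
  also have "?q + (real d - 1) / d = (real d - 1) / (real d + 1)"
  proof -
    have "(real d - 1) / d = (real d - 1) * (real d + 1) / (real d * (real d + 1))" by simp
    then have "?q + (real d - 1) / d = ((real d - 1) * (real d + 1) - (real d - 1)) / (real d * (real d + 1))"
      by (simp only: diff_divide_distrib)
    also have "(real d - 1) * (real d + 1) - (real d - 1) = real d * (real d - 1)" by (simp add: algebra_simps)
    also have "real d * (real d - 1) / (real d * (real d + 1)) = (real d - 1) / (real d + 1)" using d by simp
    finally show ?thesis .
  qed
  also have "D * n powr ((real d - 1) / (real d + 1)) \<le> D * (4 * real C * b)" using size D by (intro mult_left_mono) auto
  finally have "n powr ?q * opt \<le> (4 * real C * D) * b" by (simp add: mult_ac)
  then have "1 / (4 * real C * D) * (n powr ?q * opt) \<le> 1 / (4 * real C * D) * ((4 * real C * D) * b)"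
    using C D by (intro mult_left_mono) auto
  then show ?thesis unfolding D_def[symmetric] using C D by simp
qed

theorem theorem11:
  fixes \<alpha> :: real
  assumes "CARD('n::finite) \<ge> 2" and "\<alpha> > 0"
  shows "\<exists>(prog :: com) (c :: real) (T :: nat \<Rightarrow> real).
    c > 0 \<and> T \<in> O(\<lambda>n. real n * ln (real n)) \<and>
    (\<forall>(A :: (real ^ 'n) set) n ps e.
       finite A \<and> card A = n \<and> n \<ge> 2 \<and> general_position A \<and>
       spread A \<le> \<alpha> * real n powr (1 / real CARD('n)) \<and>
       distinct ps \<and> set ps = A \<and> bij_betw e {..<CARD('n)} (UNIV :: 'n set) \<longrightarrow>
         expected_time prog (input_state e ps) \<le> ennreal (T n) \<and>
         (\<forall>(s, t) \<in> set_spmf (exec prog (input_state e ps)).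
            \<exists>B. outputs ps s B \<and> B \<subseteq> A \<and> convex_position B \<and>
                real (card B) \<ge> c * real n powr
                    (- ((real CARD('n) - 1) / (real CARD('n) * (real CARD('n) + 1))))
                  * real (OPT A)))"
proof -
  let ?d = "CARD('n)"
  define E :: nat where "E = 2 ^ (4 * ?d)"
  define \<beta> where "\<beta> = \<alpha> ^ ?d"
  \<comment> \<open>The least natural number meeting the requirement of \<open>many_good\<close>; it
    depends on the dimension and \<open>\<alpha>\<close> only, and so does \<open>c\<close>, the
    constant of \<open>approximation_ratio\<close>.\<close>
  define C :: nat where "C = nat \<lceil>2 * (close_const ?d * \<beta>\<^sup>2 + 1) * E * 2 ^ ?d\<rceil>"
  define c where "c = 1 / (4 * real C * (2 * real ?d * (7 * real ?d * \<alpha>) ^ (?d - 1)))"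
  define T where "T n = 3 * real (time_const ?d) / ln 2 * (real n * ln (real n))" for n
  have C_ge: "2 * (close_const ?d * \<beta>\<^sup>2 + 1) * E * 2 ^ ?d \<le> C"
    unfolding C_def by (rule real_nat_ceiling_ge)
  have C: "C > 0"
  proof -
    have "close_const ?d \<ge> 0" by (simp add: close_const_def)
    then have "0 < 2 * (close_const ?d * \<beta>\<^sup>2 + 1) * real E * 2 ^ ?d"
      by (intro mult_pos_pos) (auto simp: E_def intro: add_nonneg_pos)
    then have "0 < real C" using C_ge by (rule less_le_trans)
    then show ?thesis by simp
  qed
  have main: "expected_time (algorithm ?d E C) (input_state e ps) \<le> ennreal (T n) \<and>
      (\<forall>(s, t) \<in> set_spmf (exec (algorithm ?d E C) (input_state e ps)).
        \<exists>B. outputs ps s B \<and> B \<subseteq> A \<and> convex_position B \<and>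
          real (card B) \<ge> c * real n powr (- ((real ?d - 1) / (real ?d * (real ?d + 1)))) * real (OPT A))"
    if A: "finite A" "card A = n" "n \<ge> 2" and spread: "spread A \<le> \<alpha> * real n powr (1 / real ?d)"
      and set_ps: "distinct ps" "set ps = A" and e: "bij_betw e {..<?d} (UNIV :: 'n set)"
    for A :: "(real ^ 'n) set" and n ps e
  proof -
    have len: "length ps = n" using set_ps A by (metis distinct_card)
    define X where "X i l = ps ! i $ e l" for i l
    \<comment> \<open>The radius, in the maximum norm about \<open>ps ! 0\<close>, fixes the cubes;
      the centre of the shells is drawn independently in each trial.\<close>
    define \<rho> where "\<rho> = radius ?d n X"
    define k where "k = resolution ?d n"
    define m :: nat where "m = 2 ^ k"
    have n1: "n \<ge> 1" and d1: "?d \<ge> 1" using A assms(1) by auto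
    have coord: "\<exists>i<n. \<exists>l<?d. x = ps ! i \<and> j = e l" if "x \<in> A" for x j
      using that e set_ps len unfolding bij_betw_def
      by (metis UNIV_I imageE in_set_conv_nth lessThan_iff)
    have cube: "\<bar>x $ j - ps ! 0 $ j\<bar> \<le> \<rho>" if "x \<in> A" for x j
      using coord[OF that, of j] le_radius[of _ n _ ?d X] by (auto simp: \<rho>_def X_def)
    have "\<exists>x\<in>A. \<exists>j. \<rho> = \<bar>x $ j - ps ! 0 $ j\<bar>"
    proof -
      obtain i l where "i < n" "\<rho> = \<bar>X i l - X 0 l\<bar>"
        using radius_attained[OF n1 d1] unfolding \<rho>_def by metis
      then show ?thesis using set_ps len nth_mem[of i ps] by (auto simp: X_def)
    qed
    moreover have "ps ! 0 \<in> A" using set_ps len n1 nth_mem[of 0 ps] by auto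
    moreover have m: "m \<ge> 1" "n \<le> m ^ (?d + 1)" using resolution(1)[of n ?d] by (auto simp: m_def k_def)
    ultimately obtain \<delta> where set: "spread_set A (ps ! 0) \<delta> \<rho> (\<rho> / real m) \<beta>"
      and ratio: "\<rho> / \<delta> \<le> \<alpha> * real n powr (1 / real ?d)"
      unfolding \<beta>_def
      using spread_set_of_points[of A "ps ! 0" \<rho> \<alpha> m] A assms spread cube by metis
    interpret S: spread_set A "ps ! 0" \<delta> \<rho> "\<rho> / real m" \<beta> by (rule set)
    interpret grid_run ?d n m E "2 * k + 4 * ?d" C \<rho> X
      unfolding m_def E_def
    proof (rule grid_run_power_two[OF d1 S.\<rho>_pos])
      show "\<bar>X i l - X 0 l\<bar> \<le> \<rho>" if "i < n" "l < ?d" for i l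
        using that unfolding \<rho>_def by (rule le_radius)
    qed
    interpret embedded_run n m E "2 * k + 4 * ?d" C \<rho> X ps e
      by unfold_locales (use e X_def set_ps len S.\<rho>_pos m in auto)
    have "spread_set (set ps) (ps ! 0) \<delta> \<rho> side \<beta>" using set set_ps by (simp add: side_def)
    then have "n \<le> 2 * card {c. c < n \<and> good c}" by (rule many_good[OF _ C_ge])
    from spec_algorithm[OF m_def \<rho>_def n1 d1 _ this]
    have spec: "spec (input ?d n X) (algorithm ?d E C)
      (\<lambda>s. \<exists>c M g. c < n \<and> representatives c M \<and> output_indices s = selected c M g n \<and>
        n \<le> m * m * C * card (selected c M g n)) (time_bound ?d n)"
      using resolution(2)[of _ ?d n] by (simp add: time_bound_def Let_def trial_time_def k_def[symmetric])
    have input: "input ?d n X (input_state e ps)"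
      using input_input_state[of ps e] by (simp add: len X_def[abs_def])
    have "expected_time (algorithm ?d E C) (input_state e ps) \<le> of_nat (time_bound ?d n)"
      by (rule spec_expected_time[OF spec input])
    also have "\<dots> \<le> ennreal (T n)"
      unfolding ennreal_of_nat_eq_real_of_nat T_def by (intro ennreal_leI time_bound_le A)
    finally have time: "expected_time (algorithm ?d E C) (input_state e ps) \<le> ennreal (T n)" .
    have "\<exists>B. outputs ps s B \<and> B \<subseteq> A \<and> convex_position B \<and>
          real (card B) \<ge> c * real n powr (- ((real ?d - 1) / (real ?d * (real ?d + 1)))) * real (OPT A)"
      if st: "(s, t) \<in> set_spmf (exec (algorithm ?d E C) (input_state e ps))" for s t
    proof -
      obtain c' M g where run: "c' < n" "representatives c' M" "output_indices s = selected c' M g n"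
        "n \<le> m * m * C * card (selected c' M g n)"
        using spec_set_spmf[OF spec input st] by blast
      define B where "B = (!) ps ` selected c' M g n"
      have sub: "selected c' M g n \<subseteq> {..<length ps}" by (auto simp: selected_def len)
      have "outputs ps s B" using run(3) sub by (simp add: outputs_def B_def)
      moreover have "B \<subseteq> A" using sub set_ps by (auto simp: B_def)
      moreover have "convex_position B" unfolding B_def by (rule selected_convex_position[OF run(1,2)])
      moreover have "c * real n powr (- ((real ?d - 1) / (real ?d * (real ?d + 1)))) * real (OPT A) \<le> real (card B)"
        unfolding c_def
      proof (rule approximation_ratio)
        show "m ^ (?d + 1) \<le> 2 ^ (?d + 1) * n" unfolding m_def k_def by (rule resolution_upper[OF n1])
        have "real n \<le> real (m * m * C * card B)"
          using run(4) card_selected unfolding B_def of_nat_le_iff by simp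
        then show "real n \<le> real m * real m * real C * real (card B)" by simp
        show "real (OPT A) \<le> 2 * real ?d * (7 * real ?d * (\<rho> / \<delta>)) ^ (?d - 1)" by (rule S.OPT_le)
      qed (use assms A C ratio S.\<rho>_pos S.\<delta> in auto)
      ultimately show ?thesis by blast
    qed
    with time show ?thesis by blast
  qed
  have "c > 0" unfolding c_def using C assms by simp
  moreover have "T \<in> O(\<lambda>n. real n * ln (real n))" unfolding T_def by simp
  ultimately show ?thesis using main
    by (intro exI[of _ "algorithm ?d E C"] exI[of _ c] exI[of _ T]) blast
qed

end
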